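(* Let $N\ge 2$ and let $W$ be one of the weight matrices $W_H$, $W_L$ or $W_J$ of size $N\times N$ defined in the context. Then: (i) $W$ is a solution to the Matrix Bochner Problem, i.e. the algebra $\mathcal D(W)$ contains a differential operator of order exactly $2$; (ii) $W$ is not a Darboux transformation of any direct sum $w_1\oplus\cdots\oplus w_N$ of classical scalar weights.
   Context: A weight matrix of size $N$ is a smooth function $W$ on an interval $(x_0,x_1)$ with values in $N\times N$ complex matrices, positive definite almost everywhere, with finite moments of all orders; it defines $\langle P,Q\rangle_W=\int_{x_0}^{x_1}P(x)W(x)Q(x)^*dx$ on matrix polynomials $\mathrm{Mat}_N(\mathbb C[x])$, and there is a unique sequence $(P_n)_{n\ge0}$ of monic orthogonal matrix polynomials ($\deg P_n=n$, leading coefficient $I$, $\langle P_n,P_m\rangle_W=0$ for $n\ne m$). Differential operators $D=\sum_{j=0}^m\partial^jF_j(x)$ ($\partial=d/dx$) act on the right: $P\cdot D=\sum_j \partial^j(P)F_j$. $\mathcal D(W)$ is the algebra of such operators with matrix polynomial coefficients $F_j$ such that $P_n\cdot D=\Lambda_n(D)P_n$ for all $n\ge0$ with constant matrices $\Lambda_n(D)$. The right Fourier algebra $\mathcal F_R(W)$ is the set of differential operators $\mathfrak D$ with matrix polynomial coefficients for which there exist finitely many sequences of constant matrices $A_j(n)$, $-\ell\le j\le k$, with $P_n\cdot\mathfrak D=\sum_{j=-\ell}^kA_j(n)P_{n+j}$ for all $n$ (with $P_m=0$ for $m<0$). Darboux transformation: given weights $W_1,W_2$ with monic orthogonal polynomials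 $P_n,Q_n$, $W_2$ is a Darboux transformation of $W_1$ if there exist $\mathfrak D,\widetilde{\mathfrak D}\in\mathcal F_R(W_1)$, matrix polynomials $F,\widetilde F$ invertible as rational matrix functions, and sequences of constant matrices $C_n,\widetilde C_n$ nonsingular for almost every $n$ with $C_nQ_n=P_n\cdot\mathfrak D F^{-1}$ and $\widetilde C_nP_n=Q_n\cdot\widetilde F^{-1}\widetilde{\mathfrak D}$. Classical scalar weights: Hermite $w_b(x)=e^{-x^2+2bx}$ on $(-\infty,\infty)$ ($b\in\mathbb R$); Laguerre $w_\alpha(x)=e^{-x}x^\alpha$ on $(0,\infty)$ ($\alpha>-1$); Jacobi $w_{\alpha,\beta}(x)=(1-x)^\alpha(1+x)^\beta$ on $(-1,1)$ ($\alpha,\beta>-1$). Let $E_{s,t}$ be the matrix units, $A=\sum_{j=1}^{\lfloor N/2\rfloor}a_{2j-1}E_{2j-1,2j}+\sum_{j=1}^{\lfloor (N-1)/2\rfloor}a_{2j}E_{2j+1,2j}$ with all $a_j\in\mathbb R\setminus\{0\}$, and $T(x)=I+Ax$. Define $W_H=T\,\mathrm{diag}(w_{b_1},\dots,w_{b_N})\,T^*$ with $b_i$ pairwise distinct; $W_L=T\,\mathrm{diag}(w_{\alpha_1},\dots,w_{\alpha_N})\,T^*$ with $\alpha_i-\alpha_j\notin\mathbb Z$ for $i\neq j$; $W_J=T\,\mathrm{diag}(w_{\alpha_1,\beta_1},\dots,w_{\alpha_N,\beta_N})\,T^*$ with, for $i\ne j$, $\alpha_i-\alpha_j\notin\mathbb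 Z$ or $\beta_i-\beta_j\notin\mathbb Z$, and $\alpha_1+\beta_1=\alpha_j+\beta_j+1+(-1)^j$ for all $j=1,\dots,N$. *)

theory Defs
  imports "HOL-Analysis.Analysis" "HOL-Computational_Algebra.Polynomial"
    "Jordan_Normal_Form.Determinant"
begin

text \<open>An element of Mat_N(C[x]) is a complex poly mat in carrier_mat N N.
  Matrix indices are 0-based internally.\<close>

definition evalM :: "complex poly mat \<Rightarrow> complex \<Rightarrow> complex mat" where
  "evalM P z = map_mat (\<lambda>p. poly p z) P"

definition constP :: "complex mat \<Rightarrow> complex poly mat" where
  "constP A = map_mat (\<lambda>c. [:c:]) A"

definition mderiv :: "nat \<Rightarrow> complex poly mat \<Rightarrow> complex poly mat" where
  "mderiv j P = map_mat (pderiv ^^ j) P"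

definition msum :: "nat \<Rightarrow> ('b \<Rightarrow> 'a::comm_monoid_add mat) \<Rightarrow> 'b set \<Rightarrow> 'a mat" where
  "msum N f J = mat N N (\<lambda>(i,k). \<Sum>j\<in>J. f j $$ (i,k))"

definition cadj :: "complex mat \<Rightarrow> complex mat" where
  "cadj A = mat (dim_col A) (dim_row A) (\<lambda>(i,j). cnj (A $$ (j,i)))"

text \<open>Right action of the differential operator D = sum_j d^j F_j
  (coefficient list [F_0,...,F_m]): P.D = sum_j d^j(P) F_j.\<close>
definition apply_op :: "nat \<Rightarrow> complex poly mat \<Rightarrow> complex poly mat list \<Rightarrow> complex poly mat" where
  "apply_op N P Ds = msum N (\<lambda>j. mderiv j P * Ds ! j) {..<length Ds}"

definition smooth_fun :: "real set \<Rightarrow> (real \<Rightarrow> complex) \<Rightarrow> bool" where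
  "smooth_fun S f \<longleftrightarrow> (\<exists>D. D 0 = f \<and>
     (\<forall>k. \<forall>x\<in>S. (D k has_vector_derivative D (Suc k) x) (at x)))"

definition pos_def_mat :: "nat \<Rightarrow> complex mat \<Rightarrow> bool" where
  "pos_def_mat N M \<longleftrightarrow> M \<in> carrier_mat N N \<and> cadj M = M \<and>
     (\<forall>v::nat \<Rightarrow> complex. (\<exists>i<N. v i \<noteq> 0) \<longrightarrow>
        (let q = (\<Sum>i<N. \<Sum>j<N. cnj (v i) * M $$ (i,j) * v j) in Im q = 0 \<and> Re q > 0))"

definition weight_matrix :: "nat \<Rightarrow> real set \<Rightarrow> (real \<Rightarrow> complex mat) \<Rightarrow> bool" where
  "weight_matrix N S W \<longleftrightarrow> is_interval S \<and> open S \<and> S \<noteq> {} \<and>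
     (\<forall>x. W x \<in> carrier_mat N N) \<and>
     (\<forall>i<N. \<forall>j<N. smooth_fun S (\<lambda>x. W x $$ (i,j))) \<and>
     (AE x in lborel. x \<in> S \<longrightarrow> pos_def_mat N (W x)) \<and>
     (\<forall>k i j. i < N \<longrightarrow> j < N \<longrightarrow>
        set_integrable lborel S (\<lambda>x. complex_of_real (x ^ k) * W x $$ (i,j)))"

definition ip :: "nat \<Rightarrow> real set \<Rightarrow> (real \<Rightarrow> complex mat) \<Rightarrow> complex poly mat \<Rightarrow> complex poly mat \<Rightarrow> complex mat" where
  "ip N S W P Q = mat N N (\<lambda>(i,j). LINT x:S|lborel.
      (evalM P (of_real x) * W x * cadj (evalM Q (of_real x))) $$ (i,j))"

definition monic_deg :: "nat \<Rightarrow> complex poly mat \<Rightarrow> nat \<Rightarrow> bool" where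
  "monic_deg N P n \<longleftrightarrow> P \<in> carrier_mat N N \<and>
     (\<forall>i<N. \<forall>j<N. degree (P $$ (i,j)) \<le> n \<and> coeff (P $$ (i,j)) n = (if i = j then 1 else 0))"

definition monic_OPS :: "nat \<Rightarrow> real set \<Rightarrow> (real \<Rightarrow> complex mat) \<Rightarrow> (nat \<Rightarrow> complex poly mat) \<Rightarrow> bool" where
  "monic_OPS N S W P \<longleftrightarrow> (\<forall>n. monic_deg N (P n) n) \<and>
     (\<forall>n m. n \<noteq> m \<longrightarrow> ip N S W (P n) (P m) = 0\<^sub>m N N)"

definition op_coeffs :: "nat \<Rightarrow> complex poly mat list \<Rightarrow> bool" where
  "op_coeffs N Ds \<longleftrightarrow> (\<forall>j<length Ds. Ds ! j \<in> carrier_mat N N)"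

definition in_DW :: "nat \<Rightarrow> real set \<Rightarrow> (real \<Rightarrow> complex mat) \<Rightarrow> complex poly mat list \<Rightarrow> bool" where
  "in_DW N S W Ds \<longleftrightarrow> op_coeffs N Ds \<and> (\<exists>P. monic_OPS N S W P \<and>
     (\<forall>n. \<exists>\<Lambda>\<in>carrier_mat N N. apply_op N (P n) Ds = constP \<Lambda> * P n))"

definition Pz :: "nat \<Rightarrow> (nat \<Rightarrow> complex poly mat) \<Rightarrow> int \<Rightarrow> complex poly mat" where
  "Pz N P m = (if m < 0 then 0\<^sub>m N N else P (nat m))"

text \<open>Membership in the right Fourier algebra F_R(W), W given through its monic OPS P.\<close>
definition in_FR :: "nat \<Rightarrow> (nat \<Rightarrow> complex poly mat) \<Rightarrow> complex poly mat list \<Rightarrow> bool" where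
  "in_FR N P Ds \<longleftrightarrow> op_coeffs N Ds \<and>
     (\<exists>(l::nat) (k::nat) (A::int \<Rightarrow> nat \<Rightarrow> complex mat).
        (\<forall>j n. A j n \<in> carrier_mat N N) \<and>
        (\<forall>n. apply_op N (P n) Ds =
               msum N (\<lambda>j. constP (A j n) * Pz N P (int n + j)) {- int l .. int k}))"

text \<open>Value at z of (R / d) . D where R / d is the rational matrix function with
  polynomial numerator matrix R and scalar polynomial denominator d, and D has
  coefficient list Ds; derivatives are complex derivatives of the rational entries.\<close>
definition rat_apply :: "nat \<Rightarrow> complex poly mat \<Rightarrow> complex poly \<Rightarrow> complex poly mat list \<Rightarrow> complex \<Rightarrow> complex mat" where
  "rat_apply N R d Ds z = mat N N (\<lambda>(i,k). \<Sum>j<length Ds. \<Sum>l<N.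
      (deriv ^^ j) (\<lambda>w. poly (R $$ (i,l)) w / poly d w) z * poly (Ds ! j $$ (l,k)) z)"

text \<open>darboux N S1 W1 S2 W2: W2 is a Darboux transformation of W1.
  F^{-1} is written as adj F / det F.\<close>
definition darboux :: "nat \<Rightarrow> real set \<Rightarrow> (real \<Rightarrow> complex mat) \<Rightarrow> real set \<Rightarrow> (real \<Rightarrow> complex mat) \<Rightarrow> bool" where
  "darboux N S1 W1 S2 W2 \<longleftrightarrow> weight_matrix N S1 W1 \<and> weight_matrix N S2 W2 \<and>
    (\<exists>P Q. monic_OPS N S1 W1 P \<and> monic_OPS N S2 W2 Q \<and>
      (\<exists>D Dt F Ft C Ct. in_FR N P D \<and> in_FR N P Dt \<and>
         F \<in> carrier_mat N N \<and> Ft \<in> carrier_mat N N \<and> det F \<noteq> 0 \<and> det Ft \<noteq> 0 \<and>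
         (\<forall>n. C n \<in> carrier_mat N N \<and> Ct n \<in> carrier_mat N N) \<and>
         finite {n. det (C n) = 0} \<and> finite {n. det (Ct n) = 0} \<and>
         (\<forall>n z. poly (det F) z \<noteq> 0 \<longrightarrow>
            C n * evalM (Q n) z = (1 / poly (det F) z) \<cdot>\<^sub>m evalM (apply_op N (P n) D * adj_mat F) z) \<and>
         (\<forall>n z. poly (det Ft) z \<noteq> 0 \<longrightarrow>
            Ct n * evalM (P n) z = rat_apply N (Q n * adj_mat Ft) (det Ft) Dt z)))"

definition hermite_w :: "real \<Rightarrow> real \<Rightarrow> real" where
  "hermite_w b x = exp (- (x ^ 2) + 2 * b * x)"
definition laguerre_w :: "real \<Rightarrow> real \<Rightarrow> real" where
  "laguerre_w \<alpha> x = exp (- x) * x powr \<alpha>"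
definition jacobi_w :: "real \<Rightarrow> real \<Rightarrow> real \<Rightarrow> real" where
  "jacobi_w \<alpha> \<beta> x = (1 - x) powr \<alpha> * (1 + x) powr \<beta>"

definition diagW :: "nat \<Rightarrow> (nat \<Rightarrow> real \<Rightarrow> real) \<Rightarrow> real \<Rightarrow> complex mat" where
  "diagW N f x = mat N N (\<lambda>(i,j). if i = j then complex_of_real (f i x) else 0)"

text \<open>Direct sums of classical scalar weights (they must share the interval of
  orthogonality, hence all belong to the same family).\<close>
definition classical_sum :: "nat \<Rightarrow> real set \<Rightarrow> (real \<Rightarrow> complex mat) \<Rightarrow> bool" where
  "classical_sum N S W \<longleftrightarrow>
     (\<exists>b. S = UNIV \<and> W = diagW N (\<lambda>i. hermite_w (b i))) \<or>
     (\<exists>\<alpha>. (\<forall>i<N. \<alpha> i > -1) \<and> S = {0<..} \<and> W = diagW N (\<lambda>i. laguerre_w (\<alpha> i))) \<or>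
     (\<exists>\<alpha> \<beta>. (\<forall>i<N. \<alpha> i > -1 \<and> \<beta> i > -1) \<and> S = {-1<..<1} \<and>
        W = diagW N (\<lambda>i. jacobi_w (\<alpha> i) (\<beta> i)))"

section \<open>The weights W_H, W_L, W_J (parameters indexed 1..N as in the paper)\<close>

text \<open>Matrix unit E_{s,t}, 1-based indices.\<close>
definition Eunit :: "nat \<Rightarrow> nat \<Rightarrow> nat \<Rightarrow> complex mat" where
  "Eunit N s t = mat N N (\<lambda>(i,j). if i = s - 1 \<and> j = t - 1 then 1 else 0)"

definition Amat :: "nat \<Rightarrow> (nat \<Rightarrow> real) \<Rightarrow> complex mat" where
  "Amat N a = msum N (\<lambda>j. complex_of_real (a (2*j-1)) \<cdot>\<^sub>m Eunit N (2*j-1) (2*j)) {1..N div 2}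
            + msum N (\<lambda>j. complex_of_real (a (2*j)) \<cdot>\<^sub>m Eunit N (2*j+1) (2*j)) {1..(N-1) div 2}"

definition Tmat :: "nat \<Rightarrow> (nat \<Rightarrow> real) \<Rightarrow> real \<Rightarrow> complex mat" where
  "Tmat N a x = 1\<^sub>m N + complex_of_real x \<cdot>\<^sub>m Amat N a"

definition W_H :: "nat \<Rightarrow> (nat \<Rightarrow> real) \<Rightarrow> (nat \<Rightarrow> real) \<Rightarrow> real \<Rightarrow> complex mat" where
  "W_H N a b x = Tmat N a x * diagW N (\<lambda>i. hermite_w (b (i+1))) x * cadj (Tmat N a x)"

definition W_L :: "nat \<Rightarrow> (nat \<Rightarrow> real) \<Rightarrow> (nat \<Rightarrow> real) \<Rightarrow> real \<Rightarrow> complex mat" where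
  "W_L N a \<alpha> x = Tmat N a x * diagW N (\<lambda>i. laguerre_w (\<alpha> (i+1))) x * cadj (Tmat N a x)"

definition W_J :: "nat \<Rightarrow> (nat \<Rightarrow> real) \<Rightarrow> (nat \<Rightarrow> real) \<Rightarrow> (nat \<Rightarrow> real) \<Rightarrow> real \<Rightarrow> complex mat" where
  "W_J N a \<alpha> \<beta> x = Tmat N a x * diagW N (\<lambda>i. jacobi_w (\<alpha> (i+1)) (\<beta> (i+1))) x * cadj (Tmat N a x)"

end

theory Submission
  imports Defs "HOL-Library.Function_Algebras" "HOL-Probability.Sinc_Integral" "HOL-Real_Asymp.Real_Asymp"
begin

text \<open>
  Right multiplication by \<open>T\<close> turns the weight \<open>W = T diag(w) T\<^sup>*\<close> into the diagonal weight, and rows of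
  degree at most \<open>n\<close> into rows \<open>q\<close> whose components of odd (1-based) index have degree at most \<open>n\<close>, while the
  coefficients of \<open>x\<^sup>n\<^sup>+\<^sup>1\<close> in the others are \<open>A\<close>-combinations of the coefficients of \<open>x\<^sup>n\<close> in
  the former.

  For (i), the diagonal of the classical operators \<open>\<rho> \<partial>\<^sup>2 + \<psi>\<^sub>i \<partial> + c\<^sub>i\<close> is symmetric by the Pearson equations
  \<open>(\<rho> w\<^sub>i)' = \<psi>\<^sub>i w\<^sub>i\<close>, and for suitable constants \<open>c\<^sub>i\<close> its eigenvalues at degrees \<open>n\<close> and \<open>n + 1\<close> match, so
  that it preserves these spaces.

  For (ii), the Darboux data of a diagonal weight, whose orthogonal polynomials \<open>P\<^sub>n\<close> are diagonal, yield
  the operator \<open>Ft\<^sup>-\<^sup>1 Dt E\<^sub>1\<^sub>1 D F\<^sup>-\<^sup>1\<close>, which lies in \<open>D(W)\<close> and has eigenvalues of rank one. After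
  conjugation by \<open>T\<close> it has an adjoint; an off-diagonal entry of it would make \<open>w\<^sub>j / w\<^sub>i\<close> rational, so it is
  diagonal. A nonzero scalar differential operator shifts all large degrees by a constant, hence the
  kernel vectors force some diagonal entry to vanish. The path structure of \<open>A\<close> propagates the vanishing
  of the leading eigenvalue to all entries; then the square of the operator is zero for degree reasons,
  although its entries do not vanish.
\<close>

hide_const (open) Module.smult

subsection \<open>Scalar differential operators\<close>

text \<open>The obstacle is that T raises degrees by one in half of the components only, so the
  conjugated operator has no single degree to work with. Positivity of the weights supplies a
  substitute: in the space belonging to P_n every nonzero component has one of two adjacent degrees.
  An operator lowering all large degrees by at least one may survive one application in such a
  window but not two, which is why the square is examined. The factor E_11 works because diagonal
  P_n pass a single scalar polynomial from one Darboux operator to the other: the eigenvalue becomes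
  a column of the second constant matrix times a row of the first. It has a kernel for every n since
  N is at least 2, and it is nonzero for almost all n since both matrices are nonsingular there. In
  (i), the eigenvalue condition dictates the constants c_i, and in the Jacobi case it is the
  condition on alpha_j + beta_j that makes it solvable for all n at once.\<close>

definition lin :: "(complex poly \<Rightarrow> complex poly) \<Rightarrow> bool" where
  "lin f \<longleftrightarrow> (\<forall>p q. f (p + q) = f p + f q) \<and> (\<forall>c p. f (smult c p) = smult c (f p))"

definition adx :: "(complex poly \<Rightarrow> complex poly) \<Rightarrow> complex poly \<Rightarrow> complex poly" where
  "adx f p = f (pCons 0 p) - pCons 0 (f p)"

text \<open>Grothendieck's characterisation: \<open>f\<close> is a differential operator of order less than \<open>m\<close>
  iff the \<open>m\<close>-fold commutator with multiplication by \<open>x\<close> vanishes. It makes compositions and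
  the clearing of denominators easy.\<close>

fun dop :: "nat \<Rightarrow> (complex poly \<Rightarrow> complex poly) \<Rightarrow> bool" where
  "dop 0 f = (\<forall>p. f p = 0)"
| "dop (Suc m) f = (lin f \<and> dop m (adx f))"

lemma lin_add: "lin f \<Longrightarrow> f (p + q) = f p + f q" by (simp add: lin_def)
lemma lin_smult: "lin f \<Longrightarrow> f (smult c p) = smult c (f p)" by (simp add: lin_def)
lemma lin_zero: "lin f \<Longrightarrow> f 0 = 0" using lin_smult[of f 0 0] by simp
lemma lin_minus: "lin f \<Longrightarrow> f (- p) = - f p" using lin_smult[of f "-1" p] by simp
lemma lin_diff: "lin f \<Longrightarrow> f (p - q) = f p - f q"
  using lin_add[of f p "-q"] by (simp add: lin_minus)

lemma dop_lin: "dop m f \<Longrightarrow> lin f"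
  by (cases m) (auto simp: lin_def)

lemma pCons0_add: "pCons 0 (p + q) = pCons 0 p + pCons 0 (q :: complex poly)" by simp
lemma pCons0_smult: "pCons 0 (smult c p) = smult c (pCons 0 (p :: complex poly))" by simp

lemma dop_mono1: "dop m f \<Longrightarrow> dop (Suc m) f"
proof (induction m arbitrary: f)
  case 0
  then show ?case by (auto simp: lin_def adx_def)
next
  case (Suc m)
  then show ?case by simp
qed

lemma dop_mono: "dop m f \<Longrightarrow> m \<le> k \<Longrightarrow> dop k f"
  by (induction k) (auto simp: le_Suc_eq intro: dop_mono1 simp del: dop.simps)

lemma dop_add: "dop m f \<Longrightarrow> dop m g \<Longrightarrow> dop m (\<lambda>p. f p + g p)"
proof (induction m arbitrary: f g)
  case (Suc m)
  have "adx (\<lambda>p. f p + g p) = (\<lambda>p. adx f p + adx g p)"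
    by (auto simp: adx_def fun_eq_iff pCons0_add simp del: add_pCons)
  then show ?case using Suc by (auto simp: lin_def smult_add_right)
qed auto

lemma dop_zero: "dop m (\<lambda>p. 0)"
  using dop_mono[of 0 "\<lambda>p. 0" m] by simp

lemma dop_sum:
  assumes "\<And>i. i \<in> I \<Longrightarrow> dop m (f i)"
  shows "dop m (\<lambda>p. \<Sum>i\<in>I. f i p)"
  using assms by (induction I rule: infinite_finite_induct) (auto intro: dop_zero dop_add)

lemma dop_mult: "dop 1 (\<lambda>p. p * g)"
  by (auto simp: lin_def adx_def algebra_simps)

text \<open>The commutator with x obeys the Leibniz rule [f g, x] = [f, x] g + f [g, x], and both
  summands have a smaller total m + k. The bound is generous by one order, which keeps it
  additive.\<close>

lemma dop_comp: "dop m f \<Longrightarrow> dop k g \<Longrightarrow> dop (m + k) (\<lambda>p. f (g p))"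
proof (induction "m + k" arbitrary: m k f g)
  case 0
  then show ?case by simp
next
  case (Suc n)
  have lf: "lin f" and lg: "lin g" using Suc.prems dop_lin by auto
  show ?case
  proof (cases "m = 0 \<or> k = 0")
    case True
    then have "(\<lambda>p. f (g p)) = (\<lambda>p. 0)"
      using Suc.prems lf by (auto simp: fun_eq_iff lin_zero)
    then show ?thesis using dop_zero by metis
  next
    case False
    then obtain m' k' where mk: "m = Suc m'" "k = Suc k'" by (meson not0_implies_Suc)
    have e: "adx (\<lambda>p. f (g p)) = (\<lambda>p. adx f (g p) + f (adx g p))"
      by (auto simp: adx_def fun_eq_iff lin_diff[OF lf])
    have "dop (m' + k) (\<lambda>p. adx f (g p))"
      using Suc.hyps(1)[of m' k] Suc.hyps(2) mk Suc.prems by simp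
    moreover have "dop (m + k') (\<lambda>p. f (adx g p))"
      using Suc.hyps(1)[of m k'] Suc.hyps(2) mk Suc.prems by simp
    ultimately have "dop n (\<lambda>p. adx f (g p) + f (adx g p))"
      using Suc.hyps(2) mk by (intro dop_add) auto
    moreover have "lin (\<lambda>p. f (g p))"
      using lf lg by (auto simp: lin_def)
    ultimately show ?thesis
      using e Suc.hyps(2)[symmetric] by simp
  qed
qed

lemma dop_mult_right: "dop m f \<Longrightarrow> dop m (\<lambda>p. f p * g)"
proof (induction m arbitrary: f)
  case (Suc m)
  have "adx (\<lambda>p. f p * g) = (\<lambda>p. adx f p * g)"
    by (auto simp: adx_def fun_eq_iff left_diff_distrib)
  then show ?case using Suc by (auto simp: lin_def distrib_right)
qed simp

lemma dop_mult_left: "dop m f \<Longrightarrow> dop m (\<lambda>p. f (p * g))"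
proof (induction m arbitrary: f)
  case (Suc m)
  have "adx (\<lambda>p. f (p * g)) = (\<lambda>p. adx f (p * g))"
    by (auto simp: adx_def fun_eq_iff)
  then show ?case using Suc by (auto simp: lin_def distrib_right)
qed simp

lemma dop_smult: "dop m f \<Longrightarrow> dop m (\<lambda>p. smult c (f p))"
  using dop_mult_right[of m f "[:c:]"] by simp

lemma dop_pCons0: "dop m f \<Longrightarrow> dop m (\<lambda>p. pCons 0 (f p))"
  using dop_mult_right[of m f "[:0, 1:]"] by simp

lemma dop_diff: "dop m f \<Longrightarrow> dop m g \<Longrightarrow> dop m (\<lambda>p. f p - g p)"
  using dop_add[OF _ dop_smult[of m g "-1"], of f] by simp

lemma higher_pderiv_pCons0:
  "(pderiv ^^ Suc k) (pCons 0 p) = pCons 0 ((pderiv ^^ Suc k) p) + smult (of_nat (Suc k)) ((pderiv ^^ k) (p :: complex poly))"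
proof (induction k)
  case (Suc k)
  have "(pderiv ^^ Suc (Suc k)) (pCons 0 p) = pderiv ((pderiv ^^ Suc k) (pCons 0 p))" by simp
  also have "\<dots> = pCons 0 ((pderiv ^^ Suc (Suc k)) p) + smult (of_nat (Suc (Suc k))) ((pderiv ^^ Suc k) p)"
    unfolding Suc.IH by (simp add: pderiv_add pderiv_smult pderiv_pCons smult_add_left numeral_poly)
  finally show ?case .
qed (simp add: pderiv_pCons)

lemma dop_higher_pderiv: "dop (Suc k) (pderiv ^^ k)"
proof (induction k)
  case 0
  then show ?case by (auto simp: lin_def adx_def)
next
  case (Suc k)
  have "adx (pderiv ^^ Suc k) = (\<lambda>p. smult (of_nat (Suc k)) ((pderiv ^^ k) p))"
    by (rule ext) (simp only: adx_def higher_pderiv_pCons0 add_diff_cancel_left')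
  then have "dop (Suc k) (adx (pderiv ^^ Suc k))"
    using dop_smult[OF Suc, of "of_nat (Suc k)"] by (simp only:)
  moreover have "lin (pderiv ^^ Suc k)"
    unfolding lin_def by (simp only: higher_pderiv_add higher_pderiv_smult) simp
  ultimately show ?case by (simp only: dop.simps)
qed

text \<open>Multiplication by g commutes with multiplication by x, so the relation g f = L passes to
  commutators, and g cancels at every stage. Thus dividing by a determinant stays within
  differential operators as soon as the quotients are polynomials.\<close>

lemma dop_cancel:
  assumes "dop m L" "g \<noteq> 0" "\<And>p. g * f p = L p"
  shows "dop m f"
  using assms
proof (induction m arbitrary: f L)
  case 0
  then show ?case by auto
next
  case (Suc m)
  have l: "lin L" using Suc.prems by simp
  have "lin f"
    unfolding lin_def
  proof (intro conjI allI)
    fix p q c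
    have "g * f (p + q) = g * (f p + f q)"
      using Suc.prems(3) lin_add[OF l] by (simp add: distrib_left)
    then show "f (p + q) = f p + f q" using Suc.prems(2) by simp
    have "g * f (smult c p) = g * smult c (f p)"
      using Suc.prems(3) lin_smult[OF l] by simp
    then show "f (smult c p) = smult c (f p)" using Suc.prems(2) by (simp only: mult_cancel_left) simp
  qed
  moreover have "dop m (adx f)"
  proof (rule Suc.IH)
    show "dop m (adx L)" using Suc.prems by simp
    show "g * adx f p = adx L p" for p
      using Suc.prems(3)[of p] Suc.prems(3)[of "pCons 0 p"] by (auto simp: adx_def right_diff_distrib)
  qed (use Suc.prems in auto)
  ultimately show ?case by simp
qed

lemma lin_eq_zero:
  assumes "lin f" "f 1 = 0" "\<And>p. f (pCons 0 p) = pCons 0 (f p)"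
  shows "f p = 0"
proof (induction p)
  case 0
  then show ?case using lin_zero assms by blast
next
  case (pCons a p)
  have "pCons a p = smult a 1 + pCons 0 p" by simp
  then have "f (pCons a p) = smult a (f 1) + f (pCons 0 p)" using assms(1) lin_add lin_smult by metis
  then show ?case using pCons assms by simp
qed

lemma smult_sum2: "Polynomial.smult c (\<Sum>i\<in>I. f i) = (\<Sum>i\<in>I. Polynomial.smult c (f i :: complex poly))"
  by (induction I rule: infinite_finite_induct) (auto simp: smult_add_right)

lemma coeff_mult_degree_le:
  assumes "degree p \<le> a" "degree q \<le> b"
  shows "coeff (p * q) (a + b) = coeff p a * coeff (q :: complex poly) b"
proof -
  have "coeff p i * coeff q (a + b - i) = (if i = a then coeff p a * coeff q b else 0)" for i
    using assms by (cases i a rule: linorder_cases) (auto simp: coeff_eq_0)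
  then show ?thesis by (simp add: coeff_mult)
qed

lemma diff_swap: "a - b = c - d \<Longrightarrow> a - c = b - (d :: 'a :: ab_group_add)"
  by (simp add: algebra_simps)

text \<open>The commutator is integrated: the map sending p to p^(k) h has commutator k p^(k-1) h,
  so \<open>h (Suc j)\<close> is \<open>g j\<close> divided by j + 1. The difference from
  \<open>f\<close> commutes with x, and \<open>h 0 = f 1\<close> makes it vanish at 1, hence
  everywhere.\<close>

lemma dop_representation:
  "dop m f \<Longrightarrow> \<exists>h. \<forall>p. f p = (\<Sum>k<m. (pderiv ^^ k) p * h k)"
proof (induction m arbitrary: f)
  case 0
  then show ?case by auto
next
  case (Suc m)
  then obtain g where g: "\<And>p. adx f p = (\<Sum>k<m. (pderiv ^^ k) p * g k)" by force
  define h where "h k = (case k of 0 \<Rightarrow> f 1 | Suc j \<Rightarrow> smult (1 / of_nat (Suc j)) (g j))" for k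
  define r where "r p = (\<Sum>k<Suc m. (pderiv ^^ k) p * h k)" for p
  have lr: "lin r"
    unfolding r_def lin_def
    by (auto simp: higher_pderiv_add higher_pderiv_smult distrib_right sum.distrib smult_sum2 smult_add_right)
  have lf: "lin f" using Suc.prems by simp
  have ar: "adx r p = adx f p" for p
  proof -
    have t: "(pderiv ^^ Suc k) (pCons 0 p) * h (Suc k) = pCons 0 ((pderiv ^^ Suc k) p * h (Suc k)) + (pderiv ^^ k) p * g k" for k
      unfolding higher_pderiv_pCons0 distrib_right mult_pCons_left by (simp add: h_def del: of_nat_Suc)
    have s: "(\<Sum>k<m. pCons 0 (u k)) = pCons 0 (\<Sum>k<m. u k)" for u :: "nat \<Rightarrow> complex poly"
      by (induction m) simp_all
    have "r (pCons 0 p) = pCons 0 (r p) + (\<Sum>k<m. (pderiv ^^ k) p * g k)"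
      unfolding r_def sum.lessThan_Suc_shift t sum.distrib s by simp
    then show ?thesis by (simp add: adx_def[of r] g)
  qed
  have "f p - r p = 0" for p
  proof (rule lin_eq_zero[of "\<lambda>p. f p - r p"])
    show "lin (\<lambda>p. f p - r p)"
      using lf lr by (auto simp: lin_def smult_diff_right)
    have "(pderiv ^^ Suc k) (1 :: complex poly) = 0" for k
      by (induction k) simp_all
    then have "r 1 = f 1"
      unfolding r_def sum.lessThan_Suc_shift by (simp add: h_def del: funpow.simps)
    then show "f 1 - r 1 = 0" by simp
    show "f (pCons 0 p) - r (pCons 0 p) = pCons 0 (f p - r p)" for p
    proof -
      have "f (pCons 0 p) - pCons 0 (f p) = r (pCons 0 p) - pCons 0 (r p)"
        using ar[of p] by (simp add: adx_def)
      then have "f (pCons 0 p) - r (pCons 0 p) = pCons 0 (f p) - pCons 0 (r p)"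
        by (rule diff_swap)
      then show ?thesis by simp
    qed
  qed
  then show ?case unfolding r_def by (intro exI[of _ h]) auto
qed

text \<open>The degree shift \<open>M - m\<close> comes from the terms of \<open>f\<close> of maximal weight; their contribution to
  the leading coefficient is a nonzero polynomial in the degree of \<open>q\<close>.\<close>

lemma dop_degree_shift:
  assumes "dop m f" "f p0 \<noteq> 0"
  shows "\<exists>M d0. \<forall>q. degree q \<ge> d0 \<longrightarrow> q \<noteq> 0 \<longrightarrow> f q \<noteq> 0 \<and> degree (f q) + m = degree q + M"
proof -
  obtain h where h: "\<And>p. f p = (\<Sum>k<m. (pderiv ^^ k) p * h k)"
    using dop_representation[OF assms(1)] by auto
  define K where "K = {k. k < m \<and> h k \<noteq> 0}"
  have fK: "finite K" by (simp add: K_def)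
  have neK: "K \<noteq> {}"
  proof
    assume "K = {}"
    then have "\<And>k. k < m \<Longrightarrow> h k = 0" by (auto simp: K_def)
    then show False using h[of p0] assms(2) by simp
  qed
  \<comment> \<open>The term with k derivatives changes degrees by degree (h k) - k; adding m keeps
    this a natural number, and M is its maximum.\<close>
  define M where "M = Max ((\<lambda>k. degree (h k) + (m - k)) ` K)"
  have Mge: "degree (h k) + (m - k) \<le> M" if "k \<in> K" for k
    unfolding M_def using fK that by (intro Max_ge) auto
  obtain k1 where k1: "k1 \<in> K" "degree (h k1) + (m - k1) = M"
    using Max_in[of "(\<lambda>k. degree (h k) + (m - k)) ` K"] fK neK unfolding M_def by fastforce
  define c where "c k = (if k \<in> K then coeff (h k) (M + k - m) else 0)" for k
  have ck1: "c k1 \<noteq> 0"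
  proof -
    have "M + k1 - m = degree (h k1)" using k1 by (auto simp: K_def)
    then show ?thesis using k1(1) by (simp add: c_def K_def)
  qed
  \<comment> \<open>The falling factorial z (z - 1) ... (z - k + 1), the factor that k derivatives
    of x^z produce.\<close>
  define FF where "FF k = (\<Prod>i<k. [:1 + of_nat i - of_nat k, 1:] :: complex poly)" for k
  have FFval: "poly (FF k) (of_nat d) = pochhammer (of_nat (Suc (d - k))) k" if "k \<le> d" for k d
    using that unfolding FF_def poly_prod pochhammer_prod
    by (auto intro!: prod.cong simp: of_nat_diff algebra_simps atLeast0LessThan)
  have FFself: "poly (FF k) (of_nat k) \<noteq> 0" for k
    using FFval[of k k] by (simp add: pochhammer_fact[symmetric])
  have FFless: "poly (FF k) (of_nat d) = 0" if "d < k" for k d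
  proof -
    have "1 + of_nat (k - 1 - d) - of_nat k + of_nat d = (0 :: complex)"
      using that by (simp add: of_nat_diff)
    moreover have "k - 1 - d < k" using that by auto
    ultimately show ?thesis unfolding FF_def poly_prod
      by (intro prod_zero) (auto intro!: bexI[of _ "k - 1 - d"] simp: add.commute)
  qed
  define \<sigma> where "\<sigma> = (\<Sum>k<m. smult (c k) (FF k))"
  have "\<sigma> \<noteq> 0"
  proof -
    \<comment> \<open>Evaluation at the least k with \<open>c k\<close> nonzero isolates one term:
      smaller k have zero coefficient, and for larger k the falling factorial vanishes at
      \<open>k0\<close>.\<close>
    define k0 where "k0 = (LEAST k. c k \<noteq> 0)"
    have k0: "c k0 \<noteq> 0" unfolding k0_def by (rule LeastI[of "\<lambda>k. c k \<noteq> 0", OF ck1])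
    have k0m: "k0 < m" using k0 by (auto simp: c_def K_def split: if_splits)
    have less: "c k = 0" if "k < k0" for k using not_less_Least that unfolding k0_def by blast
    have "poly \<sigma> (of_nat k0) = (\<Sum>k<m. c k * poly (FF k) (of_nat k0))"
      by (simp add: \<sigma>_def poly_sum)
    also have "\<dots> = (\<Sum>k<m. if k = k0 then c k0 * poly (FF k0) (of_nat k0) else 0)"
      by (rule sum.cong) (use less FFless in \<open>auto simp: linorder_neq_iff\<close>)
    also have "\<dots> \<noteq> 0" using k0m k0 FFself by simp
    finally show ?thesis by auto
  qed
  then have fin: "finite {z. poly \<sigma> z = 0}" by (rule poly_roots_finite)
  have "finite {d. poly \<sigma> (of_nat d) = 0}"
    using finite_vimageI[OF fin, of of_nat] by (simp add: vimage_def inj_of_nat)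
  then obtain d1 where "\<forall>d\<in>{d. poly \<sigma> (of_nat d) = 0}. d < d1"
    using finite_nat_set_iff_bounded by blast
  then have d1: "\<And>d. poly \<sigma> (of_nat d) = 0 \<Longrightarrow> d < d1" by blast
  define d0 where "d0 = max d1 m"
  have main: "f q \<noteq> 0 \<and> degree (f q) + m = degree q + M" if q: "degree q \<ge> d0" "q \<noteq> 0" for q
  proof -
    define d where "d = degree q"
    have dm: "d \<ge> m" and sd: "poly \<sigma> (of_nat d) \<noteq> 0" using q d1[of d] by (auto simp: d_def d0_def)
    have q0: "coeff q d \<noteq> 0" using q(2) by (simp add: d_def)
    have t: "coeff ((pderiv ^^ k) q * h k) (d + M - m) = poly (FF k) (of_nat d) * coeff q d * c k
        \<and> degree ((pderiv ^^ k) q * h k) \<le> d + M - m" if k: "k < m" for k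
    proof (cases "k \<in> K")
      case False
      then show ?thesis using k by (auto simp: K_def c_def)
    next
      case True
      have kd: "k \<le> d" using k dm by simp
      have e: "d + M - m = (d - k) + (M + k - m)" using Mge[OF True] k dm by auto
      have dh: "degree (h k) \<le> M + k - m" using Mge[OF True] k by auto
      have dp: "degree ((pderiv ^^ k) q) \<le> d - k" by (simp add: degree_higher_pderiv d_def)
      have "coeff ((pderiv ^^ k) q * h k) (d + M - m) = coeff ((pderiv ^^ k) q) (d - k) * coeff (h k) (M + k - m)"
        unfolding e by (rule coeff_mult_degree_le[OF dp dh])
      also have "coeff ((pderiv ^^ k) q) (d - k) = poly (FF k) (of_nat d) * coeff q d"
        using kd by (simp add: coeff_higher_pderiv FFval)
      finally show ?thesis
        using True degree_mult_le[of "(pderiv ^^ k) q" "h k"] dh dp e by (auto simp: c_def)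
    qed
    have cf: "coeff (f q) (d + M - m) = poly \<sigma> (of_nat d) * coeff q d"
      using t by (simp add: h coeff_sum \<sigma>_def poly_sum sum_distrib_left mult_ac)
    have df: "degree (f q) \<le> d + M - m"
      unfolding h using t by (intro degree_sum_le) auto
    have nz: "coeff (f q) (d + M - m) \<noteq> 0" using cf sd q0 by simp
    then have "degree (f q) = d + M - m" using df le_degree by (metis antisym)
    then show ?thesis using nz dm by (auto simp: d_def)
  qed
  show ?thesis using main by blast
qed

section \<open>Riesz representation on finite spans\<close>

text \<open>One Gram-Schmidt step per spanning vector: the induction hypothesis also represents the
  functional given by the new vector v, and subtracting that representative t makes v orthogonal to
  the old span. Anisotropy is asked on Z only, because the form on rows ignores components of index
  N and above.\<close>

lemma riesz_representation:
  fixes scale :: "complex \<Rightarrow> 'b :: ab_group_add \<Rightarrow> 'b" and B :: "'b \<Rightarrow> 'b \<Rightarrow> complex"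
  assumes vs: "vector_space scale" and Z: "module.subspace scale Z"
    and add_l: "\<And>p q r. B (p + q) r = B p r + B q r"
    and sm_l: "\<And>c p r. B (scale c p) r = c * B p r"
    and add_r: "\<And>p q r. B r (p + q) = B r p + B r q"
    and sm_r: "\<And>c p r. B r (scale c p) = cnj c * B r p"
    and pos: "\<And>q. q \<in> Z \<Longrightarrow> B q q = 0 \<Longrightarrow> q = 0"
    and F: "finite F" "F \<subseteq> Z"
    and L_add: "\<And>p q. L (p + q) = L p + L q" and L_sm: "\<And>c p. L (scale c p) = c * L p"
  shows "\<exists>s\<in>module.span scale F. \<forall>v\<in>module.span scale F. B v s = L v"
proof -
  interpret vs: vector_space scale by (rule vs)
  show ?thesis
    using F L_add L_sm
  proof (induction F arbitrary: L rule: finite_induct)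
  case empty
  have "L 0 = 0" using empty(3)[of 0 0] by simp
  moreover have "B 0 0 = 0" using sm_l[of 0 0 0] by simp
  ultimately show ?case by simp
next
  case (insert v F)
  obtain s where s: "s \<in> vs.span F" "\<And>x. x \<in> vs.span F \<Longrightarrow> B x s = L x"
    using insert.IH[of L] insert.prems by auto
  obtain t where t: "t \<in> vs.span F" "\<And>x. x \<in> vs.span F \<Longrightarrow> B x t = B x v"
    using insert.IH[of "\<lambda>x. B x v"] insert.prems add_l sm_l by auto
  define v' where "v' = v + scale (-1) t"
  have vv': "v = v' + t" by (simp add: v'_def)
  have orth: "B x v' = 0" if "x \<in> vs.span F" for x
    using t(2)[OF that] unfolding v'_def add_r sm_r by simp
  show ?case
  proof (cases "v' = 0")
    case True
    then have "vs.span (insert v F) = vs.span F"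
      using t(1) vv' vs.span_redundant[of v F] by simp
    then show ?thesis using s by auto
  next
    case False
    have "v' \<in> Z"
    proof -
      have "vs.span F \<subseteq> Z" using insert.prems(1) Z by (simp add: vs.span_minimal)
      then show ?thesis using t(1) insert.prems(1) Z unfolding v'_def
        by (intro vs.subspace_add vs.subspace_scale) auto
    qed
    then have nz: "B v' v' \<noteq> 0" using pos False by blast
    have Bvv': "B v v' = B v' v'"
      using orth[OF t(1)] by (subst vv') (simp add: add_l)
    \<comment> \<open>Conjugated because \<open>B\<close> is antilinear in its second
      argument.\<close>
    define c where "c = cnj ((L v - B v s) / B v' v')"
    define s' where "s' = s + scale c v'"
    have Bs': "B x s' = B x s + cnj c * B x v'" for x by (simp add: s'_def add_r sm_r)
    have Bv: "B v s' = L v" using nz by (simp add: Bs' Bvv' c_def)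
    have "s' \<in> vs.span (insert v F)"
    proof -
      have *: "vs.span F \<subseteq> vs.span (insert v F)" by (intro vs.span_mono) auto
      have "v \<in> vs.span (insert v F)" by (simp add: vs.span_base)
      then show ?thesis unfolding s'_def v'_def using s(1) t(1) *
        by (intro vs.span_add vs.span_scale) auto
    qed
    moreover have "B y s' = L y" if y: "y \<in> vs.span (insert v F)" for y
    proof -
      from y obtain k where k: "y - scale k v \<in> vs.span F" by (auto simp: vs.span_insert)
      define z where "z = y - scale k v"
      have yz: "y = scale k v + z" by (simp add: z_def)
      have "B z s' = L z" using k orth s(2) by (simp add: z_def Bs')
      then show ?thesis unfolding yz by (simp add: add_l sm_l insert.prems Bv)
    qed
    ultimately show ?thesis by blast
  qed
qed
qed

subsection \<open>Rows of polynomials\<close>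

type_synonym row = "nat \<Rightarrow> complex poly"

definition rsm :: "complex \<Rightarrow> row \<Rightarrow> row" where
  "rsm c q = (\<lambda>i. smult c (q i))"

lemma rsm_apply: "rsm c q i = smult c (q i)"
  by (simp add: rsm_def)

text \<open>As default rewrite rules these would eta-expand rows occurring as arguments.\<close>

declare plus_fun_apply [simp del] zero_fun_apply [simp del]

lemmas row_simps = plus_fun_apply zero_fun_apply rsm_apply

interpretation rowvs: vector_space rsm
  by standard (auto simp: row_simps fun_eq_iff smult_add_left smult_add_right)

lemma row_sum_apply: "(\<Sum>i\<in>I. f i) j = (\<Sum>i\<in>I. (f i j :: complex poly))"
  by (induction I rule: infinite_finite_induct) (auto simp: row_simps)

text \<open>On the real axis this is the complex conjugate of p, so sesquilinear integrands remain
  polynomials times weights.\<close>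

definition cj :: "complex poly \<Rightarrow> complex poly" where "cj p = map_poly cnj p"

lemma poly_cj [simp]: "poly (cj p) x = cnj (poly p (cnj x))"
  by (simp add: cj_def)

lemma poly_ext: "(\<And>x. poly p x = poly q x) \<Longrightarrow> p = (q :: complex poly)"
  using poly_eq_poly_eq_iff by blast

lemma cj_simps [simp]:
  "cj (p + q) = cj p + cj q" "cj (p * q) = cj p * cj q" "cj (smult c p) = smult (cnj c) (cj p)"
  "cj (cj p) = p" "cj 0 = 0" "cj (p - q) = cj p - cj q" "cj (- p) = - cj p" "cj (p ^ n) = cj p ^ n"
  by (rule poly_ext; simp)+

definition unit_row :: "nat \<Rightarrow> complex poly \<Rightarrow> row" where
  "unit_row i p = (\<lambda>j. if j = i then p else 0)"

text \<open>Here \<open>l i\<close> stands for the moment functional of the i-th scalar weight, so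
  that the algebra below never mentions integrals. Linearity is asked for every index, positivity
  only below N.\<close>

locale row_form =
  fixes N :: nat and l :: "nat \<Rightarrow> complex poly \<Rightarrow> complex"
  assumes l_add: "l i (p + q) = l i p + l i q"
    and l_smult: "l i (smult c p) = c * l i p"
    and l_cj: "l i (cj p) = cnj (l i p)"
    and l_pos: "i < N \<Longrightarrow> p \<noteq> 0 \<Longrightarrow> Re (l i (p * cj p)) > 0"
begin

definition B :: "row \<Rightarrow> row \<Rightarrow> complex" where
  "B q r = (\<Sum>j<N. l j (q j * cj (r j)))"

definition rows :: "row set" where
  "rows = {q. \<forall>i\<ge>N. q i = 0}"

text \<open>Strict bound: degrees less than n. Coefficients are used instead of
  \<open>degree\<close> so that \<open>V 0\<close> is the zero space.\<close>

definition V :: "nat \<Rightarrow> row set" where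
  "V n = {q \<in> rows. \<forall>i. \<forall>k\<ge>n. coeff (q i) k = 0}"

lemma l_zero [simp]: "l i 0 = 0"
  using l_smult[of i 0 0] by simp

lemma l_minus: "l i (- p) = - l i p"
  using l_smult[of i "-1" p] by simp

lemma l_diff: "l i (p - q) = l i p - l i q"
  using l_add[of i p "-q"] by (simp add: l_minus)

lemma l_sum: "l i (\<Sum>x\<in>I. f x) = (\<Sum>x\<in>I. l i (f x))"
  by (induction I rule: infinite_finite_induct) (auto simp: l_add)

lemma B_add_left: "B (p + q) r = B p r + B q r"
  by (simp add: B_def row_simps distrib_right l_add sum.distrib)
lemma B_add_right: "B r (p + q) = B r p + B r q"
  by (simp add: B_def row_simps distrib_left l_add sum.distrib)
lemma B_smult_left: "B (rsm c p) r = c * B p r"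
  by (simp add: B_def row_simps l_smult sum_distrib_left)
lemma B_smult_right: "B r (rsm c p) = cnj c * B r p"
  by (simp add: B_def row_simps l_smult sum_distrib_left)
lemma B_cnj: "B r p = cnj (B p r)"
proof -
  have "l j (r j * cj (p j)) = cnj (l j (p j * cj (r j)))" for j
    using l_cj[of j "p j * cj (r j)"] by (simp add: mult.commute)
  then show ?thesis by (simp add: B_def)
qed
lemma B_zero [simp]: "B 0 r = 0" "B r 0 = 0"
  by (simp_all add: B_def row_simps)
lemma B_sum_left: "B (\<Sum>x\<in>I. f x) r = (\<Sum>x\<in>I. B (f x) r)"
  by (induction I rule: infinite_finite_induct) (simp_all add: B_add_left)

lemma B_unit_right: "j < N \<Longrightarrow> B q (unit_row j p) = l j (q j * cj p)"
  unfolding B_def unit_row_def by (subst sum.remove[of _ j]) auto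

lemma B_unit_left: "j < N \<Longrightarrow> B (unit_row j p) q = l j (p * cj (q j))"
  unfolding B_def unit_row_def by (subst sum.remove[of _ j]) auto

lemma l_eq_0: "i < N \<Longrightarrow> l i (p * cj p) = 0 \<Longrightarrow> p = 0"
  using l_pos[of i p] by auto

lemma l_nondegenerate:
  assumes "i < N" "\<And>q. l i (q * p) = 0" shows "p = 0"
  using assms(2)[of "cj p"] l_eq_0[OF assms(1), of p] by (simp add: mult.commute)

lemma B_pos: "q \<in> rows \<Longrightarrow> B q q = 0 \<Longrightarrow> q = 0"
proof (rule ccontr)
  assume q: "q \<in> rows" "B q q = 0" "q \<noteq> 0"
  from q(3) obtain i where "q i \<noteq> 0" by (auto simp: fun_eq_iff row_simps)
  with q(1) have i: "i < N" "q i \<noteq> 0" by (auto simp: rows_def not_le[symmetric])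
  have ge: "Re (l j (q j * cj (q j))) \<ge> 0" if "j < N" for j
    using l_pos[OF that, of "q j"] by (cases "q j = 0") auto
  have "0 < (\<Sum>j<N. Re (l j (q j * cj (q j))))"
    using i l_pos ge by (intro sum_pos2[of _ i]) auto
  also have "\<dots> = Re (B q q)" by (simp add: B_def)
  finally show False using q by simp
qed

lemma rows_subspace: "rowvs.subspace rows"
  by (auto simp: rowvs.subspace_def rows_def row_simps)

lemma unit_rows [simp]: "i < N \<Longrightarrow> unit_row i p \<in> rows"
  by (auto simp: unit_row_def rows_def)

lemma V_subspace: "rowvs.subspace (V n)"
  by (auto simp: rowvs.subspace_def V_def rows_def row_simps)

lemma V_rows: "V n \<subseteq> rows" by (auto simp: V_def)

lemma V_mono: "m \<le> n \<Longrightarrow> V m \<subseteq> V n" by (auto simp: V_def)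

lemma V_0: "V 0 = {0}" by (auto simp: V_def rows_def poly_eq_iff fun_eq_iff row_simps)

lemma V_degree: "q \<in> V (Suc n) \<Longrightarrow> degree (q i) \<le> n"
  by (auto simp: V_def intro!: degree_le)

lemma rows_in_V: "q \<in> rows \<Longrightarrow> \<exists>n. q \<in> V n"
proof -
  assume q: "q \<in> rows"
  have "coeff (q i) k = 0" if "k \<ge> Suc (\<Sum>i<N. degree (q i))" for i k
  proof (cases "i < N")
    case True
    then have "degree (q i) \<le> (\<Sum>i<N. degree (q i))" by (intro member_le_sum) auto
    then show ?thesis using that by (intro coeff_eq_0) simp
  qed (use q in \<open>simp add: rows_def\<close>)
  then show ?thesis using q by (auto simp: V_def)
qed

definition monic_family :: "(nat \<Rightarrow> nat \<Rightarrow> row) \<Rightarrow> bool" where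
  "monic_family Q \<longleftrightarrow> (\<forall>n. \<forall>i<N. Q n i \<in> V (Suc n) \<and>
     (\<forall>k<N. coeff (Q n i k) n = (if i = k then 1 else 0)))"

lemma monic_reduce:
  assumes "monic_family Q" "q \<in> V (Suc n)"
  shows "q - (\<Sum>i<N. rsm (coeff (q i) n) (Q n i)) \<in> V n"
proof -
  let ?s = "\<Sum>i<N. rsm (coeff (q i) n) (Q n i)"
  have Q: "Q n i \<in> V (Suc n)" "\<And>k. k < N \<Longrightarrow> coeff (Q n i k) n = (if i = k then 1 else 0)" if "i < N" for i
    using assms(1) that by (auto simp: monic_family_def)
  have s: "?s \<in> V (Suc n)"
    using Q by (intro rowvs.subspace_sum[OF V_subspace] rowvs.subspace_scale[OF V_subspace]) auto
  then have d: "q - ?s \<in> V (Suc n)" using assms(2) rowvs.subspace_diff[OF V_subspace] by blast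
  moreover have "coeff ((q - ?s) k) n = 0" for k
  proof (cases "k < N")
    case True
    have "coeff (?s k) n = (\<Sum>i<N. if i = k then coeff (q i) n else 0)"
      unfolding row_sum_apply coeff_sum using Q(2) True by (intro sum.cong) (auto simp: rsm_apply)
    then show ?thesis using True by simp
  next
    case False
    then have "(q - ?s) k = 0" using d unfolding V_def rows_def by auto
    then show ?thesis by simp
  qed
  ultimately show ?thesis unfolding V_def by (auto simp del: minus_apply) (metis le_antisym not_less_eq_eq)
qed

text \<open>Subtracting the combination with the same leading coefficients lowers the degree, so a
  linear property of all rows of degree below n needs checking on the monic family only.\<close>

lemma monic_family_span:
  assumes "monic_family Q" "rowvs.subspace Z" "\<And>m i. m < n \<Longrightarrow> i < N \<Longrightarrow> Q m i \<in> Z"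
  shows "V n \<subseteq> Z"
  using assms(3)
proof (induction n)
  case 0
  then show ?case using V_0 rowvs.subspace_0[OF assms(2)] by auto
next
  case (Suc n)
  show ?case
  proof
    fix q assume q: "q \<in> V (Suc n)"
    let ?s = "\<Sum>i<N. rsm (coeff (q i) n) (Q n i)"
    have "q - ?s \<in> Z" using Suc monic_reduce[OF assms(1) q] by auto
    moreover have "?s \<in> Z" using Suc.prems
      by (intro rowvs.subspace_sum[OF assms(2)] rowvs.subspace_scale[OF assms(2)]) auto
    ultimately have "(q - ?s) + ?s \<in> Z" by (rule rowvs.subspace_add[OF assms(2)])
    then show "q \<in> Z" by simp
  qed
qed

lemma V_finite_span:
  "\<exists>F. finite F \<and> F \<subseteq> rows \<and> rowvs.span F = V n"
proof -
  define F where "F = (\<lambda>(i, k). unit_row i (monom 1 k)) ` ({..<N} \<times> {..<n})"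
  have FV: "F \<subseteq> V n" by (auto simp: F_def V_def unit_row_def rows_def)
  have m: "monic_family (\<lambda>n i. unit_row i (monom 1 n))"
    by (auto simp: monic_family_def V_def unit_row_def rows_def)
  have "V n \<subseteq> rowvs.span F"
    by (rule monic_family_span[OF m rowvs.subspace_span]) (auto simp: F_def intro!: rowvs.span_base)
  moreover have "rowvs.span F \<subseteq> V n" using FV V_subspace by (rule rowvs.span_minimal)
  moreover have "finite F" by (simp add: F_def)
  moreover have "F \<subseteq> rows" using FV V_rows by (rule subset_trans)
  ultimately show ?thesis by (metis subset_antisym)
qed

end

section \<open>Right multiplication by T on rows\<close>

text \<open>Indices are 0-based. A leads from even to odd indices, so A^2 = 0, which makes I - A x
  the inverse of I + A x. The adjacency assumptions put every edge of the path 0, 1, ..., N - 1 into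
  its support. \<open>pearson\<close> is the weak form of (rho w_i)' = psi_i w_i with vanishing
  boundary terms.\<close>

locale weight_system = row_form N l for N :: nat and l :: "nat \<Rightarrow> complex poly \<Rightarrow> complex" +
  fixes A :: "nat \<Rightarrow> nat \<Rightarrow> complex" and \<rho> :: "complex poly" and \<psi> :: "nat \<Rightarrow> complex poly"
  assumes N2: "2 \<le> N"
    and pearson: "i < N \<Longrightarrow> l i (\<rho> * pderiv p + \<psi> i * p) = 0"
    and rho_nz: "\<rho> \<noteq> 0"
    and A_supp: "A i j \<noteq> 0 \<Longrightarrow> even i \<and> odd j \<and> i < N \<and> j < N"
    and A_adj_even: "Suc i < N \<Longrightarrow> even i \<Longrightarrow> A i (Suc i) \<noteq> 0"
    and A_adj_odd: "Suc i < N \<Longrightarrow> odd i \<Longrightarrow> A (Suc i) i \<noteq> 0"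
begin

definition \<alpha> :: "row \<Rightarrow> row" where
  "\<alpha> q = (\<lambda>j. \<Sum>i<N. smult (A i j) (q i))"

text \<open>\<open>\<tau>\<close> and \<open>\<tau>i\<close> are right multiplication by \<open>T = I + A x\<close> and by \<open>T\<^sup>-\<^sup>1 = I - A x\<close>.\<close>

definition \<tau> :: "row \<Rightarrow> row" where
  "\<tau> q = (\<lambda>j. q j + pCons 0 (\<alpha> q j))"

definition \<tau>i :: "row \<Rightarrow> row" where
  "\<tau>i q = (\<lambda>j. q j - pCons 0 (\<alpha> q j))"

lemma \<alpha>_even [simp]: "even j \<Longrightarrow> \<alpha> q j = 0"
  unfolding \<alpha>_def using A_supp by (intro sum.neutral) force

lemma \<alpha>_ge [simp]: "j \<ge> N \<Longrightarrow> \<alpha> q j = 0"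
  unfolding \<alpha>_def using A_supp by (intro sum.neutral) force

lemma \<alpha>_cong: "(\<And>i. even i \<Longrightarrow> i < N \<Longrightarrow> q i = r i) \<Longrightarrow> \<alpha> q = \<alpha> r"
proof (rule ext)
  fix j assume *: "\<And>i. even i \<Longrightarrow> i < N \<Longrightarrow> q i = r i"
  show "\<alpha> q j = \<alpha> r j" unfolding \<alpha>_def
  proof (rule sum.cong)
    fix i assume "i \<in> {..<N}"
    then show "smult (A i j) (q i) = smult (A i j) (r i)"
      using * A_supp[of i j] by (cases "A i j = 0") auto
  qed auto
qed

lemma \<alpha>_unit: "i < N \<Longrightarrow> \<alpha> (unit_row i p) k = smult (A i k) p"
proof -
  assume i: "i < N"
  have "\<alpha> (unit_row i p) k = (\<Sum>i'<N. if i' = i then smult (A i k) p else 0)"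
    unfolding \<alpha>_def unit_row_def by (intro sum.cong) auto
  then show ?thesis using i by simp
qed

lemma \<alpha>_\<tau> [simp]: "\<alpha> (\<tau> q) = \<alpha> q" by (rule \<alpha>_cong) (simp add: \<tau>_def)
lemma \<alpha>_\<tau>i [simp]: "\<alpha> (\<tau>i q) = \<alpha> q" by (rule \<alpha>_cong) (simp add: \<tau>i_def)
lemma \<tau>_\<tau>i [simp]: "\<tau> (\<tau>i q) = q" using \<alpha>_\<tau>i[of q] by (auto simp: \<tau>_def \<tau>i_def fun_eq_iff)
lemma \<tau>i_\<tau> [simp]: "\<tau>i (\<tau> q) = q" using \<alpha>_\<tau>[of q] by (auto simp: \<tau>_def \<tau>i_def fun_eq_iff)
lemma \<tau>_even [simp]: "even j \<Longrightarrow> \<tau> q j = q j" by (simp add: \<tau>_def)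
lemma \<tau>i_even [simp]: "even j \<Longrightarrow> \<tau>i q j = q j" by (simp add: \<tau>i_def)

lemma \<alpha>_add: "\<alpha> (p + q) = \<alpha> p + \<alpha> q"
  by (auto simp: \<alpha>_def fun_eq_iff row_simps smult_add_right sum.distrib)
lemma \<alpha>_rsm: "\<alpha> (rsm c p) = rsm c (\<alpha> p)"
  by (auto simp: \<alpha>_def fun_eq_iff smult_sum2 row_simps mult.commute)
lemma \<tau>_add: "\<tau> (p + q) = \<tau> p + \<tau> q"
  by (auto simp: \<tau>_def fun_eq_iff row_simps \<alpha>_add pCons0_add simp del: add_pCons)
lemma \<tau>_rsm: "\<tau> (rsm c p) = rsm c (\<tau> p)"
  by (auto simp: \<tau>_def fun_eq_iff \<alpha>_rsm row_simps pCons0_smult smult_add_right simp del: smult_pCons)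
lemma \<tau>i_add: "\<tau>i (p + q) = \<tau>i p + \<tau>i q"
  by (auto simp: \<tau>i_def fun_eq_iff row_simps \<alpha>_add pCons0_add simp del: add_pCons)
lemma \<tau>i_rsm: "\<tau>i (rsm c p) = rsm c (\<tau>i p)"
  by (auto simp: \<tau>i_def fun_eq_iff \<alpha>_rsm row_simps pCons0_smult smult_diff_right simp del: smult_pCons)
lemma \<tau>_zero [simp]: "\<tau> 0 = 0" using \<tau>_rsm[of 0 0] unfolding rowvs.scale_zero_left .
lemma \<tau>_eq_0_iff [simp]: "\<tau> q = 0 \<longleftrightarrow> q = 0" by (metis \<tau>_zero \<tau>i_\<tau>)
lemma \<tau>_sum: "\<tau> (\<Sum>x\<in>I. f x) = (\<Sum>x\<in>I. \<tau> (f x))"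
  by (induction I rule: infinite_finite_induct) (simp_all add: \<tau>_add)

lemma \<tau>_rows [simp]: "\<tau> q \<in> rows \<longleftrightarrow> q \<in> rows"
  by (auto simp: \<tau>_def rows_def)
lemma \<tau>i_rows [simp]: "\<tau>i q \<in> rows \<longleftrightarrow> q \<in> rows"
  by (auto simp: \<tau>i_def rows_def)

lemma B_\<tau>_pos: "q \<in> rows \<Longrightarrow> B (\<tau> q) (\<tau> q) = 0 \<Longrightarrow> q = 0"
  using B_pos[of "\<tau> q"] by simp

lemma riesz_V:
  assumes "\<And>p q. L (p + q) = L p + L q" "\<And>c p. L (rsm c p) = c * L p"
  shows "\<exists>s\<in>V n. \<forall>p\<in>V n. B (\<tau> p) (\<tau> s) = L p"
proof -
  obtain F where F: "finite F" "F \<subseteq> rows" "rowvs.span F = V n" using V_finite_span by blast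
  have "\<exists>s\<in>rowvs.span F. \<forall>p\<in>rowvs.span F. B (\<tau> p) (\<tau> s) = L p"
    by (rule riesz_representation[OF rowvs.vector_space_axioms rows_subspace _ _ _ _ _ F(1,2)])
      (use assms B_\<tau>_pos in \<open>auto simp: \<tau>_add \<tau>_rsm B_add_left B_add_right B_smult_left B_smult_right\<close>)
  then show ?thesis using F(3) by simp
qed

end

subsection \<open>Compositional closure properties\<close>

definition dopE :: "(complex poly \<Rightarrow> complex poly) \<Rightarrow> bool" where
  "dopE f \<longleftrightarrow> (\<exists>m. dop m f)"

lemma dopE_lin: "dopE f \<Longrightarrow> lin f"
  by (auto simp: dopE_def dest: dop_lin)

lemma dopE_zero: "dopE (\<lambda>p. 0)"
  unfolding dopE_def by (intro exI[of _ 0]) simp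

lemma dopE_id: "dopE (\<lambda>p. p)"
  unfolding dopE_def using dop_mult[of 1] by (intro exI[of _ 1]) simp

lemma dopE_add: "dopE f \<Longrightarrow> dopE g \<Longrightarrow> dopE (\<lambda>p. f p + g p)"
proof -
  assume "dopE f" "dopE g"
  then obtain m k where "dop m f" "dop k g" by (auto simp: dopE_def)
  then have "dop (max m k) f" "dop (max m k) g" by (auto intro: dop_mono)
  then show ?thesis unfolding dopE_def by (intro exI) (rule dop_add)
qed

lemma dopE_comp: "dopE f \<Longrightarrow> dopE g \<Longrightarrow> dopE (\<lambda>p. f (g p))"
  unfolding dopE_def by (elim exE, intro exI) (rule dop_comp)

lemma dopE_mult_right: "dopE f \<Longrightarrow> dopE (\<lambda>p. f p * g)"
  unfolding dopE_def by (elim exE, intro exI) (rule dop_mult_right)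

lemma dopE_smult: "dopE f \<Longrightarrow> dopE (\<lambda>p. smult c (f p))"
  using dopE_mult_right[of f "[:c:]"] by simp

lemma dopE_diff: "dopE f \<Longrightarrow> dopE g \<Longrightarrow> dopE (\<lambda>p. f p - g p)"
  using dopE_add[OF _ dopE_smult[of g "-1"], of f] by simp

lemma dopE_pCons0: "dopE f \<Longrightarrow> dopE (\<lambda>p. pCons 0 (f p))"
  using dopE_mult_right[of f "[:0, 1:]"] by simp

lemma dopE_sum: "(\<And>i. i \<in> I \<Longrightarrow> dopE (f i)) \<Longrightarrow> dopE (\<lambda>p. \<Sum>i\<in>I. f i p)"
  by (induction I rule: infinite_finite_induct) (auto intro: dopE_zero dopE_add)

lemma dopE_higher_pderiv: "dopE (pderiv ^^ k)"
  unfolding dopE_def by (intro exI) (rule dop_higher_pderiv)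

lemma dopE_cancel: "dopE L \<Longrightarrow> g \<noteq> 0 \<Longrightarrow> (\<And>p. g * f p = L p) \<Longrightarrow> dopE f"
  unfolding dopE_def by (elim exE, intro exI) (rule dop_cancel)

lemma (in weight_system) dopE_\<alpha>: "(\<And>k. dopE (\<lambda>p. F p k)) \<Longrightarrow> dopE (\<lambda>p. \<alpha> (F p) j)"
  unfolding \<alpha>_def by (intro dopE_sum dopE_smult)

lemma (in weight_system) dopE_\<tau>: "(\<And>k. dopE (\<lambda>p. F p k)) \<Longrightarrow> dopE (\<lambda>p. \<tau> (F p) j)"
  unfolding \<tau>_def by (intro dopE_add dopE_pCons0 dopE_\<alpha>)

lemma (in weight_system) dopE_\<tau>i: "(\<And>k. dopE (\<lambda>p. F p k)) \<Longrightarrow> dopE (\<lambda>p. \<tau>i (F p) j)"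
  unfolding \<tau>i_def by (intro dopE_diff dopE_pCons0 dopE_\<alpha>)

subsection \<open>Formal adjoints and incompatible weights\<close>

context weight_system
begin

lemma pearson_by_parts:
  assumes "i < N"
  shows "l i (pderiv p * (\<rho> * g)) = - l i (p * (\<rho> * pderiv g + \<psi> i * g))"
proof -
  have "l i (\<rho> * pderiv (p * g) + \<psi> i * (p * g)) = 0" by (rule pearson[OF assms])
  then have "l i (pderiv p * (\<rho> * g) + p * (\<rho> * pderiv g + \<psi> i * g)) = 0"
    by (simp add: pderiv_mult algebra_simps)
  then show ?thesis by (simp only: l_add add_eq_0_iff2)
qed

lemma pderiv_power_mult_dvd: "\<rho> ^ m dvd \<rho> * pderiv (\<rho> ^ m * f)"
proof (cases m)
  case (Suc k)
  have "\<rho> * pderiv (\<rho> ^ Suc k * f) = \<rho> ^ Suc k * (\<rho> * pderiv f + smult (of_nat (Suc k)) (f * pderiv \<rho>))"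
    unfolding pderiv_mult pderiv_power_Suc by (simp add: algebra_simps smult_add_right del: of_nat_Suc)
  then show ?thesis unfolding Suc by (metis dvd_triv_left)
qed simp

text \<open>Each integration by parts uses up one factor rho. The remaining power is not spoiled by
  the derivative falling on it, since rho (rho^m f)' is again divisible by rho^m; hence m factors
  pay for up to m derivatives.\<close>

lemma adjoint_higher_pderiv:
  assumes "i < N" "k \<le> m"
  shows "\<exists>f'. \<forall>q. l i ((pderiv ^^ k) q * (\<rho> ^ m * f)) = l i (q * f')"
  using assms(2)
proof (induction k arbitrary: m f)
  case 0
  then show ?case by auto
next
  case (Suc k)
  then obtain m' where m: "m = Suc m'" "k \<le> m'" by (cases m) auto
  obtain f2 where f2: "\<rho> * pderiv (\<rho> ^ m' * f) = \<rho> ^ m' * f2"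
    using pderiv_power_mult_dvd by blast
  obtain f' where f': "\<And>q. l i ((pderiv ^^ k) q * (\<rho> ^ m' * (f2 + \<psi> i * f))) = l i (q * f')"
    using Suc.IH[OF m(2)] by blast
  have "l i ((pderiv ^^ Suc k) q * (\<rho> ^ m * f)) = l i (q * (- f'))" for q
  proof -
    have "l i ((pderiv ^^ Suc k) q * (\<rho> ^ m * f)) = l i (pderiv ((pderiv ^^ k) q) * (\<rho> * (\<rho> ^ m' * f)))"
      by (simp add: m mult.assoc)
    also have "\<dots> = - l i ((pderiv ^^ k) q * (\<rho> ^ m' * f2 + \<psi> i * (\<rho> ^ m' * f)))"
      unfolding pearson_by_parts[OF assms(1)] f2 ..
    also have "\<dots> = - l i ((pderiv ^^ k) q * (\<rho> ^ m' * (f2 + \<psi> i * f)))"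
      by (simp add: algebra_simps)
    also have "\<dots> = l i (q * (- f'))" by (simp add: f' l_minus)
    finally show ?thesis .
  qed
  then show ?case by blast
qed

lemma adjoint_dop:
  assumes "i < N" "dop m f"
  shows "\<exists>r'. \<forall>q. l i (f q * (\<rho> ^ m * r)) = l i (q * r')"
proof -
  obtain h where h: "\<And>q. f q = (\<Sum>k<m. (pderiv ^^ k) q * h k)"
    using dop_representation[OF assms(2)] by blast
  have "\<forall>k\<in>{..<m}. \<exists>f'. \<forall>q. l i ((pderiv ^^ k) q * (\<rho> ^ m * (h k * r))) = l i (q * f')"
    using adjoint_higher_pderiv[OF assms(1)] by auto
  then obtain f' where f': "\<And>k q. k < m \<Longrightarrow> l i ((pderiv ^^ k) q * (\<rho> ^ m * (h k * r))) = l i (q * f' k)"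
    unfolding bchoice_iff by blast
  have "l i (f q * (\<rho> ^ m * r)) = l i (q * (\<Sum>k<m. f' k))" for q
  proof -
    have "f q * (\<rho> ^ m * r) = (\<Sum>k<m. (pderiv ^^ k) q * (\<rho> ^ m * (h k * r)))"
      unfolding h sum_distrib_right by (simp add: mult_ac)
    then show ?thesis using f' by (simp add: l_sum sum_distrib_left)
  qed
  then show ?thesis by blast
qed

end

text \<open>By the Pearson equations (psi_j - psi_i) / rho is the logarithmic derivative of w_j /
  w_i, and (r s' - r' s) / (r s) is that of s / r. The assumption thus says that w_j / w_i is not a
  rational function.\<close>

locale incompatible_weights = weight_system +
  assumes incompat: "i < N \<Longrightarrow> j < N \<Longrightarrow> i \<noteq> j \<Longrightarrow>
    \<rho> * (r * pderiv s - pderiv r * s) = (\<psi> j - \<psi> i) * r * s \<Longrightarrow> r = 0 \<or> s = 0"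
begin

text \<open>If \<open>r w\<^sub>j\<close> and \<open>s w\<^sub>i\<close> have the same moments, then the two Pearson equations give the
  logarithmic derivative of \<open>s / r\<close>, which is excluded by \<open>incompat\<close>.\<close>

lemma moments_distinct:
  assumes ij: "i < N" "j < N" "i \<noteq> j" and eq: "\<And>q. l j (q * r) = l i (q * s)"
  shows "r = 0"
proof -
  define g where "g = \<rho> * (s * pderiv r - r * pderiv s) + (\<psi> j - \<psi> i) * r * s"
  have "l j (q * (g * r)) = 0" for q
  proof -
    \<comment> \<open>The Pearson equation of j is tested on q s r r and that of i on q s r s. The
      equality of moments moves the second to index j, where the terms with the derivative of q s r
      cancel.\<close>
    let ?a = "\<rho> * (pderiv (q * s * r) + q * s * pderiv r) + \<psi> j * (q * s * r)"
    let ?b = "\<rho> * (pderiv (q * s * r) + q * r * pderiv s) + \<psi> i * (q * s * r)"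
    have "l j (?a * r) = l j (\<rho> * pderiv (q * s * r * r) + \<psi> j * (q * s * r * r))"
      by (simp add: pderiv_mult algebra_simps)
    also have "\<dots> = 0" by (rule pearson[OF ij(2)])
    finally have a: "l j (?a * r) = 0" .
    have "l i (?b * s) = l i (\<rho> * pderiv (q * s * r * s) + \<psi> i * (q * s * r * s))"
      by (simp add: pderiv_mult algebra_simps)
    also have "\<dots> = 0" by (rule pearson[OF ij(1)])
    finally have b: "l j (?b * r) = 0" by (simp only: eq)
    have "q * (g * r) = ?a * r - ?b * r"
      unfolding g_def by (simp add: algebra_simps)
    then show ?thesis using a b by (simp only: l_diff diff_self)
  qed
  then have "g * r = 0" by (rule l_nondegenerate[OF ij(2)])
  then consider "r = 0" | "g = 0" by auto
  then show ?thesis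
  proof cases
    case 2
    then have "\<rho> * (r * pderiv s - pderiv r * s) = (\<psi> j - \<psi> i) * r * s"
      unfolding g_def by (simp add: algebra_simps)
    then have "r = 0 \<or> s = 0" by (rule incompat[OF ij])
    then show ?thesis
    proof
      assume "s = 0"
      then show ?thesis using eq l_nondegenerate[OF ij(2), of r] by simp
    qed
  qed
qed

text \<open>There are two ways to remove f from q: integration by parts inside weight j, possible
  after inserting rho^m, and \<open>adj\<close>, which lands in weight i. Both results have the same
  moments, so \<open>moments_distinct\<close> makes the first one zero, and nondegeneracy gives f =
  0.\<close>

lemma no_intertwiner:
  assumes ij: "i < N" "j < N" "i \<noteq> j" and f: "dopE f"
    and adj: "\<And>r. \<exists>s. \<forall>q. l j (f q * r) = l i (q * s)"
  shows "f p = 0"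
proof -
  obtain m where m: "dop m f" using f by (auto simp: dopE_def)
  have "l j (f p * (\<rho> ^ m * r)) = 0" for r
  proof -
    obtain r' where r': "\<And>q. l j (f q * (\<rho> ^ m * r)) = l j (q * r')"
      using adjoint_dop[OF ij(2) m] by blast
    obtain s where "\<And>q. l j (f q * (\<rho> ^ m * r)) = l i (q * s)" using adj by blast
    then have "r' = 0" using r' by (intro moments_distinct[OF ij, of r' s]) simp
    then show ?thesis using r' by simp
  qed
  then have "l j (r * (f p * \<rho> ^ m)) = 0" for r by (simp add: mult_ac)
  then have "f p * \<rho> ^ m = 0" by (rule l_nondegenerate[OF ij(2)])
  then show ?thesis using rho_nz by simp
qed

end

subsection \<open>Operators with rank one eigenvalues\<close>

lemma unit_row_sum: "(\<And>i. i \<ge> N \<Longrightarrow> q i = 0) \<Longrightarrow> (\<Sum>i<N. unit_row i (q i)) = q"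
proof (rule ext)
  fix j assume q: "\<And>i. i \<ge> N \<Longrightarrow> q i = 0"
  show "(\<Sum>i<N. unit_row i (q i)) j = q j"
    unfolding row_sum_apply unit_row_def using q[of j] by (cases "j < N") auto
qed

context incompatible_weights
begin

context
  fixes Q :: "nat \<Rightarrow> nat \<Rightarrow> row" and \<Phi> :: "nat \<Rightarrow> nat \<Rightarrow> complex poly \<Rightarrow> complex poly"
    and s t :: "nat \<Rightarrow> nat \<Rightarrow> complex" and n0 :: nat
  assumes monic: "monic_family Q"
    and orth: "\<And>n m i k. n \<noteq> m \<Longrightarrow> i < N \<Longrightarrow> k < N \<Longrightarrow> B (\<tau> (Q n i)) (\<tau> (Q m k)) = 0"
    and dop\<Phi>: "\<And>i j. i < N \<Longrightarrow> j < N \<Longrightarrow> dopE (\<Phi> i j)"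
    and act: "\<And>n i j. i < N \<Longrightarrow> j < N \<Longrightarrow>
      (\<Sum>k<N. \<Phi> k j (Q n i k)) = (\<Sum>k<N. smult (s n i * t n k) (Q n k j))"
    and nonzero: "\<And>n. n \<ge> n0 \<Longrightarrow> (\<exists>i<N. s n i \<noteq> 0) \<and> (\<exists>k<N. t n k \<noteq> 0)"
begin

definition \<Phi>r :: "row \<Rightarrow> row" where
  "\<Phi>r q = (\<lambda>j. if j < N then \<Sum>k<N. \<Phi> k j (q k) else 0)"

text \<open>Conjugation by T moves the operator to the side of the diagonal weight: the rows
  \<open>u n i\<close> are orthogonal for \<open>B\<close> itself, and adjoints can be read
  componentwise.\<close>

definition \<Psi> :: "row \<Rightarrow> row" where
  "\<Psi> q = \<tau> (\<Phi>r (\<tau>i q))"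

abbreviation u :: "nat \<Rightarrow> nat \<Rightarrow> row" where
  "u n i \<equiv> \<tau> (Q n i)"

lemma \<Phi>r_add: "\<Phi>r (p + q) = \<Phi>r p + \<Phi>r q"
  using dop\<Phi> by (auto simp: \<Phi>r_def fun_eq_iff row_simps sum.distrib[symmetric] intro!: sum.cong lin_add dopE_lin)

lemma \<Phi>r_rsm: "\<Phi>r (rsm c q) = rsm c (\<Phi>r q)"
  using dop\<Phi> by (auto simp: \<Phi>r_def fun_eq_iff row_simps smult_sum2 intro!: sum.cong lin_smult dopE_lin)

lemma \<Psi>_add: "\<Psi> (p + q) = \<Psi> p + \<Psi> q"
  by (simp add: \<Psi>_def \<tau>_add \<tau>i_add \<Phi>r_add)

lemma \<Psi>_rsm: "\<Psi> (rsm c q) = rsm c (\<Psi> q)"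
  by (simp add: \<Psi>_def \<tau>_rsm \<tau>i_rsm \<Phi>r_rsm)

lemma \<Psi>_zero: "\<Psi> 0 = 0"
  using \<Psi>_rsm[of 0 0] by simp

lemma \<Psi>_sum: "\<Psi> (\<Sum>x\<in>I. f x) = (\<Sum>x\<in>I. \<Psi> (f x))"
  by (induction I rule: infinite_finite_induct) (simp_all add: \<Psi>_add \<Psi>_zero)

lemma Q_V: "i < N \<Longrightarrow> Q n i \<in> V (Suc n)"
  using monic by (auto simp: monic_family_def)

lemma Q_rows: "i < N \<Longrightarrow> Q n i \<in> rows"
  using Q_V[of i n] V_rows[of "Suc n"] by blast

lemma \<Phi>r_Q: "i < N \<Longrightarrow> \<Phi>r (Q n i) = (\<Sum>k<N. rsm (s n i * t n k) (Q n k))"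
proof (rule ext)
  fix j assume i: "i < N"
  show "\<Phi>r (Q n i) j = (\<Sum>k<N. rsm (s n i * t n k) (Q n k)) j"
  proof (cases "j < N")
    case True
    then show ?thesis using act[OF i True] by (simp add: \<Phi>r_def row_sum_apply rsm_apply)
  next
    case False
    then show ?thesis using Q_rows by (simp add: \<Phi>r_def row_sum_apply rsm_apply rows_def)
  qed
qed

lemma \<Psi>_u: "i < N \<Longrightarrow> \<Psi> (u n i) = (\<Sum>k<N. rsm (s n i * t n k) (u n k))"
  by (simp add: \<Psi>_def \<Phi>r_Q \<tau>_sum \<tau>_rsm)

lemma u_orth:
  assumes "m \<ge> n" "i < N" "p \<in> V n"
  shows "B (u m i) (\<tau> p) = 0"
proof -
  have "V n \<subseteq> {p. B (u m i) (\<tau> p) = 0}"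
  proof (rule monic_family_span[OF monic])
    show "rowvs.subspace {p. B (u m i) (\<tau> p) = 0}"
      by (auto simp: rowvs.subspace_def \<tau>_add \<tau>_rsm B_add_right B_smult_right)
    show "Q k i' \<in> {p. B (u m i) (\<tau> p) = 0}" if "k < n" "i' < N" for k i'
      using orth[of m k i i'] that assms by simp
  qed
  then show ?thesis using assms(3) by auto
qed

text \<open>The N-dimensional space belonging to degree n: all v P_n T with a constant row v, where
  P_n is the polynomial with rows \<open>Q n i\<close>. It is invariant under \<open>\<Psi>\<close>
  and orthogonal to the image of \<open>V n\<close>.\<close>

definition U :: "nat \<Rightarrow> row set" where
  "U n = {q. \<exists>v. q = (\<Sum>i<N. rsm (v i) (u n i))}"

lemma u_in_U: "i < N \<Longrightarrow> u n i \<in> U n"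
proof -
  assume i: "i < N"
  have "(\<Sum>k<N. rsm (if k = i then 1 else 0) (u n k)) = (\<Sum>k<N. if k = i then u n i else 0)"
    by (intro sum.cong) auto
  then have "u n i = (\<Sum>k<N. rsm (if k = i then 1 else 0) (u n k))" using i by simp
  then show ?thesis unfolding U_def by (intro CollectI exI[of _ "\<lambda>k. if k = i then 1 else 0"])
qed

lemma \<Psi>_comb: "\<Psi> (\<Sum>i<N. rsm (v i) (u n i)) = (\<Sum>k<N. rsm ((\<Sum>i<N. v i * s n i) * t n k) (u n k))"
proof -
  have "\<Psi> (\<Sum>i<N. rsm (v i) (u n i)) = (\<Sum>i<N. \<Sum>k<N. rsm (v i * s n i * t n k) (u n k))"
    unfolding \<Psi>_sum \<Psi>_rsm by (intro sum.cong) (auto simp: \<Psi>_u rowvs.scale_sum_right mult.assoc)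
  also have "\<dots> = (\<Sum>k<N. \<Sum>i<N. rsm (v i * s n i * t n k) (u n k))" by (rule sum.swap)
  also have "\<dots> = (\<Sum>k<N. rsm ((\<Sum>i<N. v i * s n i) * t n k) (u n k))"
    by (simp add: rowvs.scale_sum_left[symmetric] sum_distrib_right)
  finally show ?thesis .
qed

lemma \<Psi>_U: "q \<in> U n \<Longrightarrow> \<Psi> q \<in> U n"
proof -
  assume "q \<in> U n"
  then obtain v where v: "q = (\<Sum>i<N. rsm (v i) (u n i))" by (auto simp: U_def)
  show ?thesis unfolding v \<Psi>_comb U_def by (intro CollectI exI[of _ "\<lambda>k. (\<Sum>i<N. v i * s n i) * t n k"] refl)
qed

lemma U_orth: "q \<in> U n \<Longrightarrow> p \<in> V n \<Longrightarrow> B q (\<tau> p) = 0"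
  using u_orth[of n n] by (auto simp: U_def B_sum_left B_smult_left)

lemma U_\<tau>V: "q \<in> U n \<Longrightarrow> \<exists>p\<in>V (Suc n). q = \<tau> p"
proof -
  assume "q \<in> U n"
  then obtain v where v: "q = (\<Sum>i<N. rsm (v i) (u n i))" by (auto simp: U_def)
  have "q = \<tau> (\<Sum>i<N. rsm (v i) (Q n i))" unfolding v by (simp add: \<tau>_sum \<tau>_rsm)
  moreover have "(\<Sum>i<N. rsm (v i) (Q n i)) \<in> V (Suc n)"
    using Q_V by (intro rowvs.subspace_sum[OF V_subspace] rowvs.subspace_scale[OF V_subspace]) auto
  ultimately show ?thesis by blast
qed

lemma comb_nonzero:
  assumes "k < N" "v k \<noteq> 0"
  shows "(\<Sum>i<N. rsm (v i) (u n i)) \<noteq> 0"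
proof
  assume "(\<Sum>i<N. rsm (v i) (u n i)) = 0"
  then have "\<tau> (\<Sum>i<N. rsm (v i) (Q n i)) = 0" by (simp add: \<tau>_sum \<tau>_rsm)
  then have "(\<Sum>i<N. rsm (v i) (Q n i)) = 0" by simp
  then have "coeff ((\<Sum>i<N. rsm (v i) (Q n i)) k) n = 0" by (simp add: row_simps)
  moreover have "coeff ((\<Sum>i<N. rsm (v i) (Q n i)) k) n = (\<Sum>i<N. if i = k then v i else 0)"
    unfolding row_sum_apply coeff_sum
    using monic assms(1) by (intro sum.cong) (auto simp: rsm_apply monic_family_def)
  ultimately show False using assms by simp
qed

lemma \<Phi>r_V: "p \<in> V (Suc n) \<Longrightarrow> \<Phi>r p \<in> V (Suc n)"
proof -
  have "V (Suc n) \<subseteq> {p. \<Phi>r p \<in> V (Suc n)}"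
  proof (rule monic_family_span[OF monic])
    show "rowvs.subspace {p. \<Phi>r p \<in> V (Suc n)}"
      unfolding rowvs.subspace_def using rowvs.subspace_0[OF V_subspace] \<Phi>r_rsm[of 0 0]
      by (auto simp: \<Phi>r_add \<Phi>r_rsm intro: rowvs.subspace_add[OF V_subspace] rowvs.subspace_scale[OF V_subspace])
    show "Q m i \<in> {p. \<Phi>r p \<in> V (Suc n)}" if "m < Suc n" "i < N" for m i
      using that Q_V V_mono[of "Suc m" "Suc n"]
      by (auto simp: \<Phi>r_Q intro!: rowvs.subspace_sum[OF V_subspace] rowvs.subspace_scale[OF V_subspace])
  qed
  then show "p \<in> V (Suc n) \<Longrightarrow> \<Phi>r p \<in> V (Suc n)" by auto
qed

section \<open>Adjoint and diagonality of the conjugated operator\<close>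

text \<open>Riesz representation yields a candidate that is correct against rows of degree below n,
  where r lies in the image of \<open>V n\<close>. Against higher rows both sides are zero:
  \<open>\<Psi>\<close> does not leave the space of degree m, and that space is orthogonal to the
  image of \<open>V n\<close>.\<close>

lemma \<Psi>_adjoint:
  assumes r: "r \<in> rows"
  shows "\<exists>s'\<in>rows. \<forall>q\<in>rows. B (\<Psi> q) r = B q s'"
proof -
  obtain n where n: "\<tau>i r \<in> V n" using r rows_in_V[of "\<tau>i r"] by auto
  obtain s' where s': "s' \<in> V n" "\<And>p. p \<in> V n \<Longrightarrow> B (\<tau> p) (\<tau> s') = B (\<Psi> (\<tau> p)) r"
    using riesz_V[of "\<lambda>p. B (\<Psi> (\<tau> p)) r" n]
    by (auto simp: \<tau>_add \<tau>_rsm \<Psi>_add \<Psi>_rsm B_add_left B_smult_left)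
  define Z where "Z = {p. B (\<tau> p) (\<tau> s') = B (\<Psi> (\<tau> p)) r}"
  have Z: "rowvs.subspace Z"
    by (auto simp: Z_def rowvs.subspace_def \<tau>_add \<tau>_rsm \<Psi>_add \<Psi>_rsm B_add_left B_smult_left \<Psi>_zero)
  have QZ: "Q m i \<in> Z" if i: "i < N" for m i
  proof (cases "m < n")
    case True
    then have "Q m i \<in> V n" using Q_V[OF i] V_mono[of "Suc m" n] by auto
    then show ?thesis using s' by (simp add: Z_def)
  next
    case False
    have "B (u m k) r = 0" if "k < N" for k
      using u_orth[of n m k "\<tau>i r"] False n that by simp
    then have "B (\<Psi> (u m i)) r = 0" by (simp add: \<Psi>_u i B_sum_left B_smult_left)
    moreover have "B (u m i) (\<tau> s') = 0" using u_orth[of n m i s'] False i s' by simp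
    ultimately show ?thesis by (simp add: Z_def)
  qed
  have pZ: "p \<in> Z" if p: "p \<in> rows" for p
  proof -
    obtain k where "p \<in> V k" using rows_in_V[OF p] by blast
    moreover have "V k \<subseteq> Z" using QZ by (intro monic_family_span[OF monic Z])
    ultimately show ?thesis by blast
  qed
  have "B (\<Psi> q) r = B q (\<tau> s')" if "q \<in> rows" for q
    using pZ[of "\<tau>i q"] that by (simp add: Z_def)
  moreover have "\<tau> s' \<in> rows" using s'(1) V_rows by auto
  ultimately show ?thesis by blast
qed

lemma \<Psi>_entry_dopE:
  assumes "i < N"
  shows "dopE (\<lambda>p. \<Psi> (unit_row i p) j)"
proof -
  have "dopE (\<lambda>p. unit_row i p k)" for k
    unfolding unit_row_def by (cases "k = i") (auto intro: dopE_zero dopE_id)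
  then have 1: "dopE (\<lambda>p. \<tau>i (unit_row i p) k)" for k by (rule dopE_\<tau>i)
  have "dopE (\<lambda>p. \<Phi>r (\<tau>i (unit_row i p)) k)" for k
  proof (cases "k < N")
    case True
    have "dopE (\<lambda>p. \<Sum>k'<N. \<Phi> k' k (\<tau>i (unit_row i p) k'))"
      by (rule dopE_sum, rule dopE_comp[OF dop\<Phi> 1]) (use True in auto)
    then show ?thesis using True by (simp add: \<Phi>r_def)
  qed (simp add: \<Phi>r_def dopE_zero)
  then show ?thesis unfolding \<Psi>_def by (rule dopE_\<tau>)
qed

text \<open>Restricting the adjoint identity to rows supported at i and test rows supported at j
  shows that the entry intertwines the functionals \<open>l j\<close> and
  \<open>l i\<close>.\<close>

lemma \<Psi>_offdiag:
  assumes ij: "i < N" "j < N" "i \<noteq> j"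
  shows "\<Psi> (unit_row i p) j = 0"
proof (rule no_intertwiner[OF ij \<Psi>_entry_dopE[OF ij(1)]])
  fix r
  obtain s' where s': "\<And>q. q \<in> rows \<Longrightarrow> B (\<Psi> q) (unit_row j (cj r)) = B q s'"
    using \<Psi>_adjoint[of "unit_row j (cj r)"] ij by auto
  have "l j (\<Psi> (unit_row i q) j * r) = l i (q * cj (s' i))" for q
    using s'[of "unit_row i q"] ij by (simp add: B_unit_left B_unit_right)
  then show "\<exists>s. \<forall>q. l j (\<Psi> (unit_row i q) j * r) = l i (q * s)" by blast
qed

definition \<phi> :: "nat \<Rightarrow> complex poly \<Rightarrow> complex poly" where
  "\<phi> i p = \<Psi> (unit_row i p) i"

lemma \<phi>_dopE: "i < N \<Longrightarrow> dopE (\<phi> i)"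
  using \<Psi>_entry_dopE[of i i] unfolding \<phi>_def .

lemma \<Psi>_diag:
  assumes "q \<in> rows" "j < N"
  shows "\<Psi> q j = \<phi> j (q j)"
proof -
  have "\<Psi> q = (\<Sum>i<N. \<Psi> (unit_row i (q i)))"
    using assms(1) unit_row_sum[of N q] by (simp add: \<Psi>_sum[symmetric] rows_def)
  then have "\<Psi> q j = (\<Sum>i<N. \<Psi> (unit_row i (q i)) j)" by (simp add: row_sum_apply)
  also have "\<dots> = (\<Sum>i<N. if i = j then \<phi> j (q j) else 0)"
    using assms(2) \<Psi>_offdiag by (intro sum.cong) (auto simp: \<phi>_def)
  finally show ?thesis using assms(2) by simp
qed

lemma \<tau>i_unit: "i < N \<Longrightarrow> \<tau>i (unit_row i p) k = unit_row i p k - pCons 0 (smult (A i k) p)"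
  by (simp add: \<tau>i_def \<alpha>_unit)

section \<open>Degree windows\<close>

text \<open>If the degree of q_j were smaller, the row with the single entry q_j would be the image
  under \<open>\<tau>\<close> of a row in \<open>V n\<close>, hence orthogonal to q, and q_j would
  have norm zero. For even j the inverse of \<open>\<tau>\<close> multiplies by x once, which costs
  one degree.\<close>

lemma U_degree_lower:
  assumes q: "q \<in> U n" and j: "j < N" and nz: "q j \<noteq> 0"
  shows "(if even j then n \<le> Suc (degree (q j)) else n \<le> degree (q j))"
proof (rule ccontr)
  assume c: "\<not> ?thesis"
  let ?p = "\<tau>i (unit_row j (q j))"
  have "?p \<in> V n"
  proof -
    have "coeff (?p k) d = 0" if "d \<ge> n" for k d
    proof -
      have d1: "degree (q j) < d" using c that by (auto split: if_splits)
      then have "coeff (unit_row j (q j) k) d = 0" by (auto simp: unit_row_def coeff_eq_0)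
      moreover have "coeff (pCons 0 (smult (A j k) (q j))) d = 0"
      proof (cases "even j")
        case True
        then have "degree (q j) < d - 1" using c that by auto
        then show ?thesis by (auto simp: coeff_pCons coeff_eq_0 split: nat.splits)
      next
        case False
        then have "A j k = 0" using A_supp by blast
        then show ?thesis by simp
      qed
      ultimately show ?thesis by (simp add: \<tau>i_unit[OF j])
    qed
    moreover have "?p \<in> rows" using j by simp
    ultimately show ?thesis by (simp add: V_def)
  qed
  then have "B q (\<tau> ?p) = 0" by (rule U_orth[OF q])
  then have "l j (q j * cj (q j)) = 0" using j by (simp add: B_unit_right)
  then show False using l_eq_0[OF j] nz by blast
qed

lemma \<tau>V_degree:
  assumes "p \<in> V (Suc n)"
  shows "degree (\<tau> p j) \<le> (if even j then n else Suc n)"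
proof (cases "even j")
  case True
  then show ?thesis using V_degree[OF assms] by simp
next
  case False
  have "degree (\<alpha> p j) \<le> n" unfolding \<alpha>_def using V_degree[OF assms]
    by (intro degree_sum_le) (auto intro: order.trans[OF degree_smult_le])
  then have "degree (pCons 0 (\<alpha> p j)) \<le> Suc n"
    by (metis Suc_le_mono degree_pCons_le order.trans)
  moreover have "degree (p j) \<le> Suc n" using V_degree[OF assms, of j] by simp
  ultimately show ?thesis using False by (auto simp: \<tau>_def intro: degree_add_le)
qed

lemma U_degree_upper: "q \<in> U n \<Longrightarrow> degree (q j) \<le> (if even j then n else Suc n)"
  using U_\<tau>V[of q n] \<tau>V_degree by blast

lemma U_rows: "q \<in> U n \<Longrightarrow> q \<in> rows"
  using U_\<tau>V[of q n] V_rows[of "Suc n"] by auto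

lemma kernel_vector: "\<exists>q\<in>U n. q \<noteq> 0 \<and> \<Psi> q = 0"
proof -
  \<comment> \<open>A nonzero vector annihilated by the column \<open>s n\<close>, supported on the
    first two coordinates; this is where N >= 2 enters.\<close>
  define v where "v i = (if s n 0 = 0 then if i = 0 then 1 else 0
     else if i = 0 then s n 1 else if i = 1 then - s n 0 else 0)" for i :: nat
  have "(\<Sum>i<N. v i * s n i) = (\<Sum>i\<in>{0, 1}. v i * s n i)"
    using N2 by (intro sum.mono_neutral_right) (auto simp: v_def)
  also have "\<dots> = 0" by (simp add: v_def)
  finally have "\<Psi> (\<Sum>i<N. rsm (v i) (u n i)) = 0" by (simp add: \<Psi>_comb)
  moreover have "v (if s n 0 = 0 then 0 else 1) \<noteq> 0" "(if s n 0 = 0 then 0 else 1) < N"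
    using N2 by (auto simp: v_def)
  then have "(\<Sum>i<N. rsm (v i) (u n i)) \<noteq> 0" using comb_nonzero by blast
  moreover have "(\<Sum>i<N. rsm (v i) (u n i)) \<in> U n" by (auto simp: U_def)
  ultimately show ?thesis by blast
qed

lemma \<phi>_shift:
  assumes "i < N" "\<exists>p. \<phi> i p \<noteq> 0"
  shows "\<exists>e d0. \<forall>q. degree q \<ge> d0 \<longrightarrow> q \<noteq> 0 \<longrightarrow> \<phi> i q \<noteq> 0 \<and> int (degree (\<phi> i q)) = int (degree q) + e"
proof -
  obtain m where m: "dop m (\<phi> i)" using \<phi>_dopE[OF assms(1)] by (auto simp: dopE_def)
  obtain p0 where "\<phi> i p0 \<noteq> 0" using assms(2) by blast
  from dop_degree_shift[OF m this] obtain M d0 where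
    M: "\<And>q. degree q \<ge> d0 \<Longrightarrow> q \<noteq> 0 \<Longrightarrow> \<phi> i q \<noteq> 0 \<and> degree (\<phi> i q) + m = degree q + M" by blast
  show ?thesis
  proof (intro exI allI impI)
    fix q :: "complex poly" assume "degree q \<ge> d0" "q \<noteq> 0"
    from M[OF this] show "\<phi> i q \<noteq> 0 \<and> int (degree (\<phi> i q)) = int (degree q) + (int M - int m)" by auto
  qed
qed

section \<open>Leading eigenvalues along the path\<close>

text \<open>The coefficient of x^n in \<open>\<phi> i\<close> applied to x^n is the leading
  eigenvalue at degree n. Only large n count, because moving along an edge of the path shifts n by
  one.\<close>

definition vanishing :: "nat \<Rightarrow> bool" where
  "vanishing i \<longleftrightarrow> (\<exists>m. \<forall>n\<ge>m. coeff (\<phi> i (monom 1 n)) n = 0)"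

lemma unit_monom_V: "i < N \<Longrightarrow> unit_row i (monom 1 n) \<in> V (Suc n)"
  by (auto simp: V_def unit_row_def rows_def)

text \<open>The unconjugated operator keeps degrees at most n. Even components are untouched by T;
  for odd i the row x^n e_i is fixed by T, and its image has zero even components, so T does not
  alter the image either.\<close>

lemma \<phi>_degree_le:
  assumes "i < N"
  shows "degree (\<phi> i (monom 1 n)) \<le> n"
proof -
  let ?p = "unit_row i (monom 1 n)"
  have V: "\<Phi>r ?p \<in> V (Suc n)" by (intro \<Phi>r_V unit_monom_V assms)
  have e: "\<Psi> (\<tau> ?p) = \<tau> (\<Phi>r ?p)" by (simp add: \<Psi>_def)
  have d: "\<tau> (\<Phi>r ?p) k = \<phi> k (\<tau> ?p k)" if "k < N" for k
    using \<Psi>_diag[of "\<tau> ?p" k] that assms e by simp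
  show ?thesis
  proof (cases "even i")
    case True
    then have "\<Phi>r ?p i = \<phi> i (monom 1 n)" using d[OF assms] by (simp add: unit_row_def)
    then show ?thesis using V_degree[OF V, of i] by simp
  next
    case False
    have ev: "\<Phi>r ?p k = 0" if "even k" "k < N" for k
      using d[OF that(2)] that False lin_zero[OF dopE_lin[OF \<phi>_dopE[OF that(2)]]]
      by (auto simp: unit_row_def)
    have "\<alpha> (\<Phi>r ?p) = \<alpha> 0" by (rule \<alpha>_cong) (simp add: ev row_simps)
    then have "\<alpha> (\<Phi>r ?p) i = 0" by (simp add: \<alpha>_def row_simps)
    then have 1: "\<tau> (\<Phi>r ?p) i = \<Phi>r ?p i" by (simp add: \<tau>_def)
    have "A i i = 0" using A_supp[of i i] by auto
    then have "\<tau> ?p i = monom 1 n" using \<alpha>_unit[OF assms, of "monom 1 n" i] by (simp add: \<tau>_def unit_row_def)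
    then have "\<Phi>r ?p i = \<phi> i (monom 1 n)" using d[OF assms] 1 by simp
    then show ?thesis using V_degree[OF V, of i] by simp
  qed
qed

text \<open>The row x^n e_i T has A_ij x^(n+1) as its j-th component. Its image is again a row of
  degree at most n multiplied by T, so the coefficient of x^(n+1) there comes only from A x acting
  on component i, where \<open>\<phi> i\<close> has been applied to x^n.\<close>

lemma eigenvalue_link:
  assumes ij: "i < N" "j < N" and A: "A i j \<noteq> 0"
  shows "coeff (\<phi> j (monom 1 (Suc n))) (Suc n) = coeff (\<phi> i (monom 1 n)) n"
proof -
  have ev: "even i" "odd j" using A_supp[OF A] by auto
  let ?p = "unit_row i (monom 1 n)"
  have V: "\<Phi>r ?p \<in> V (Suc n)" by (intro \<Phi>r_V unit_monom_V ij)
  have e: "\<Psi> (\<tau> ?p) = \<tau> (\<Phi>r ?p)" by (simp add: \<Psi>_def)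
  have d: "\<tau> (\<Phi>r ?p) k = \<phi> k (\<tau> ?p k)" if "k < N" for k
    using \<Psi>_diag[of "\<tau> ?p" k] that ij e by simp
  have lin: "lin (\<phi> k)" if "k < N" for k using dopE_lin[OF \<phi>_dopE[OF that]] .
  have "\<Phi>r ?p k = unit_row i (\<phi> i (monom 1 n)) k" if "even k" "k < N" for k
    using d[OF that(2)] that lin_zero[OF lin[OF that(2)]] by (auto simp: unit_row_def)
  then have "\<alpha> (\<Phi>r ?p) = \<alpha> (unit_row i (\<phi> i (monom 1 n)))" by (intro \<alpha>_cong) auto
  then have 1: "\<tau> (\<Phi>r ?p) j = \<Phi>r ?p j + pCons 0 (smult (A i j) (\<phi> i (monom 1 n)))"
    using ij by (simp add: \<tau>_def \<alpha>_unit)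
  have "?p j = 0" using ev by (auto simp: unit_row_def)
  then have "\<tau> ?p j = pCons 0 (smult (A i j) (monom 1 n))"
    using ij by (simp add: \<tau>_def \<alpha>_unit)
  also have "\<dots> = smult (A i j) (monom 1 (Suc n))" by (simp add: monom_Suc)
  finally have "\<phi> j (\<tau> ?p j) = smult (A i j) (\<phi> j (monom 1 (Suc n)))"
    by (simp only: lin_smult[OF lin[OF ij(2)]])
  then have "smult (A i j) (\<phi> j (monom 1 (Suc n))) = \<Phi>r ?p j + pCons 0 (smult (A i j) (\<phi> i (monom 1 n)))"
    using d[OF ij(2)] 1 by simp
  then have "coeff (smult (A i j) (\<phi> j (monom 1 (Suc n)))) (Suc n) = coeff (\<Phi>r ?p j + pCons 0 (smult (A i j) (\<phi> i (monom 1 n)))) (Suc n)"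
    by simp
  moreover have "coeff (\<Phi>r ?p j) (Suc n) = 0" using V by (auto simp: V_def)
  ultimately show ?thesis using A by simp
qed

lemma vanishing_link:
  assumes ij: "i < N" "j < N" and A: "A i j \<noteq> 0"
  shows "vanishing i \<longleftrightarrow> vanishing j"
proof
  assume "vanishing i"
  then obtain m where m: "\<And>n. n \<ge> m \<Longrightarrow> coeff (\<phi> i (monom 1 n)) n = 0" by (auto simp: vanishing_def)
  have "coeff (\<phi> j (monom 1 n)) n = 0" if n: "n \<ge> Suc m" for n
  proof -
    from n obtain n' where "n = Suc n'" "n' \<ge> m" by (cases n) auto
    then show ?thesis using m[of n'] eigenvalue_link[OF assms, of n'] by simp
  qed
  then show "vanishing j" unfolding vanishing_def by blast
next
  assume "vanishing j"
  then obtain m where m: "\<And>n. n \<ge> m \<Longrightarrow> coeff (\<phi> j (monom 1 n)) n = 0" by (auto simp: vanishing_def)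
  have "coeff (\<phi> i (monom 1 n)) n = 0" if n: "n \<ge> m" for n
    using m[of "Suc n"] n eigenvalue_link[OF assms, of n] by simp
  then show "vanishing i" unfolding vanishing_def by blast
qed

lemma vanishing_all:
  assumes "i < N" "vanishing i" "k < N"
  shows "vanishing k"
proof -
  have step: "vanishing k \<longleftrightarrow> vanishing (Suc k)" if "Suc k < N" for k
    using vanishing_link[of k "Suc k"] vanishing_link[of "Suc k" k] A_adj_even[of k] A_adj_odd[of k] that
    by (cases "even k") auto
  have "vanishing k \<longleftrightarrow> vanishing 0" if "k < N" for k
    using that by (induction k) (use step in auto)
  then show ?thesis using assms by blast
qed

lemma darboux_contradiction: False
proof -
  define nz where "nz i \<longleftrightarrow> (\<exists>p. \<phi> i p \<noteq> 0)" for i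
  have "\<forall>i\<in>{i. i < N \<and> nz i}. \<exists>ed. \<forall>q. degree q \<ge> snd ed \<longrightarrow> q \<noteq> 0 \<longrightarrow> \<phi> i q \<noteq> 0 \<and> int (degree (\<phi> i q)) = int (degree q) + fst ed"
    using \<phi>_shift by (auto simp: nz_def)
  from bchoice[OF this] obtain ed where ed: "\<forall>i\<in>{i. i < N \<and> nz i}. \<forall>q. degree q \<ge> snd (ed i) \<longrightarrow> q \<noteq> 0 \<longrightarrow>
      \<phi> i q \<noteq> 0 \<and> int (degree (\<phi> i q)) = int (degree q) + fst (ed i)"
    by (rule exE)
  define e where "e i = fst (ed i)" for i
  define D where "D = (\<Sum>i<N. snd (ed i)) + n0"
  have Dge: "snd (ed i) \<le> D" if "i < N" for i
    unfolding D_def using that by (intro trans_le_add1 member_le_sum) auto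
  have shift: "\<phi> i q \<noteq> 0 \<and> int (degree (\<phi> i q)) = int (degree q) + e i"
    if "i < N" "nz i" "degree q \<ge> D" "q \<noteq> 0" for i q
    using ed that Dge[of i] unfolding e_def by auto
  \<comment> \<open>One above \<open>D\<close>, because the lower degree bound in an even component
    is n - 1.\<close>
  define n where "n = Suc D"
  have low: "degree (q j) \<ge> D" if "q \<in> U n" "j < N" "q j \<noteq> 0" for q j
    using U_degree_lower[OF that] by (auto simp: n_def split: if_splits)
  obtain q where q: "q \<in> U n" "q \<noteq> 0" "\<Psi> q = 0" using kernel_vector by blast
  obtain j where j: "q j \<noteq> 0" "j < N"
    using q(2) U_rows[OF q(1)] by (auto simp: rows_def fun_eq_iff row_simps not_le[symmetric])
  have "\<phi> j (q j) = 0" using \<Psi>_diag[OF U_rows[OF q(1)] j(2)] q(3) by (simp add: row_simps)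
  then have "\<not> nz j" using shift[of j "q j"] j low[OF q(1)] by blast
  then have "vanishing j" by (simp add: nz_def vanishing_def)
  then have van: "vanishing k" if "k < N" for k using vanishing_all[OF j(2) _ that] by blast
  \<comment> \<open>Degrees of x^d cannot grow, and keeping degree d would require a nonzero leading
    eigenvalue; so the constant shift is negative.\<close>
  have eneg: "e k \<le> -1" if k: "k < N" "nz k" for k
  proof -
    obtain m where m: "\<And>n. n \<ge> m \<Longrightarrow> coeff (\<phi> k (monom 1 n)) n = 0"
      using van[OF k(1)] by (auto simp: vanishing_def)
    define d where "d = max m D"
    have dm: "degree (monom (1 :: complex) d) = d" by (simp add: degree_monom_eq)
    have f: "\<phi> k (monom 1 d) \<noteq> 0" "int (degree (\<phi> k (monom 1 d))) = int d + e k"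
      using shift[OF k, of "monom 1 d"] dm by (auto simp: d_def)
    have "coeff (\<phi> k (monom 1 d)) d = 0" using m[of d] by (simp add: d_def)
    then have "degree (\<phi> k (monom 1 d)) \<noteq> d" using f(1) by (metis leading_coeff_0_iff)
    moreover have "degree (\<phi> k (monom 1 d)) \<le> d" by (rule \<phi>_degree_le[OF k(1)])
    ultimately show ?thesis using f(2) by linarith
  qed
  obtain i where i: "i < N" "s n i \<noteq> 0" using nonzero[of n] by (auto simp: n_def D_def)
  obtain k where k: "k < N" "t n k \<noteq> 0" using nonzero[of n] by (auto simp: n_def D_def)
  define y where "y = \<Psi> (u n i)"
  have uU: "u n i \<in> U n" by (rule u_in_U[OF i(1)])
  have yU: "y \<in> U n" unfolding y_def by (rule \<Psi>_U[OF uU])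
  have "y \<noteq> 0" unfolding y_def \<Psi>_u[OF i(1)]
    using comb_nonzero[of k "\<lambda>k. s n i * t n k" n] i k by simp
  then obtain a where a: "y a \<noteq> 0" "a < N"
    using U_rows[OF yU] by (auto simp: rows_def fun_eq_iff row_simps not_le[symmetric])
  have ya: "y a = \<phi> a (u n i a)" unfolding y_def by (rule \<Psi>_diag[OF U_rows[OF uU] a(2)])
  have nza: "nz a" using a ya by (auto simp: nz_def)
  have una: "u n i a \<noteq> 0" using a(1) ya lin_zero[OF dopE_lin[OF \<phi>_dopE[OF a(2)]]] by auto
  have zU: "\<Psi> y \<in> U n" by (rule \<Psi>_U[OF yU])
  have za: "\<Psi> y a = \<phi> a (y a)" by (rule \<Psi>_diag[OF U_rows[OF yU] a(2)])
  have 1: "int (degree (y a)) = int (degree (u n i a)) + e a"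
    using shift[OF a(2) nza low[OF uU a(2) una] una] ya by simp
  have 2: "\<Psi> y a \<noteq> 0" "int (degree (\<Psi> y a)) = int (degree (y a)) + e a"
    using shift[OF a(2) nza low[OF yU a(2) a(1)] a(1)] za by auto
  \<comment> \<open>Two applications lose at least two degrees, whereas a nonzero component has
    degree n - 1 or n at an even index and n or n + 1 at an odd one.\<close>
  have "int (degree (\<Psi> y a)) \<le> int (degree (u n i a)) - 2"
    using 1 2 eneg[OF a(2) nza] by linarith
  then show False
    using U_degree_lower[OF zU a(2) 2(1)] U_degree_upper[OF uU, of a] by (auto split: if_splits)
qed

end

end

subsection \<open>A symmetric operator of order two\<close>

lemma pderiv_cj: "pderiv (cj p) = cj (pderiv p)"
  by (rule poly_eqI) (simp add: cj_def coeff_pderiv coeff_map_poly)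

text \<open>The two sides of \<open>eigenvalues_match\<close> are the eigenvalues of the classical
  operators at degree n + 1 in component j and at degree n in component i. Since T couples exactly
  these coefficients, the coupling survives the operator. The reality assumptions are needed for
  symmetry.\<close>

locale bochner_weights = weight_system +
  fixes c :: "nat \<Rightarrow> complex"
  assumes deg_rho: "degree \<rho> \<le> 2" and deg_psi: "i < N \<Longrightarrow> degree (\<psi> i) \<le> 1"
    and cj_rho: "cj \<rho> = \<rho>" and cj_psi: "i < N \<Longrightarrow> cj (\<psi> i) = \<psi> i" and cnj_c: "i < N \<Longrightarrow> cnj (c i) = c i"
    and eigenvalues_match: "i < N \<Longrightarrow> j < N \<Longrightarrow> even i \<Longrightarrow> odd j \<Longrightarrow>
      of_nat (Suc n) * of_nat n * coeff \<rho> 2 + of_nat (Suc n) * coeff (\<psi> j) 1 + c j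
      = of_nat n * (of_nat n - 1) * coeff \<rho> 2 + of_nat n * coeff (\<psi> i) 1 + c i"
begin

definition \<delta> :: "nat \<Rightarrow> complex poly \<Rightarrow> complex poly" where
  "\<delta> i p = \<rho> * pderiv (pderiv p) + \<psi> i * pderiv p + smult (c i) p"

definition \<delta>r :: "row \<Rightarrow> row" where
  "\<delta>r q = (\<lambda>i. if i < N then \<delta> i (q i) else 0)"

definition \<Delta> :: "row \<Rightarrow> row" where
  "\<Delta> q = \<tau>i (\<delta>r (\<tau> q))"

definition ev :: "nat \<Rightarrow> nat \<Rightarrow> complex" where
  "ev i n = of_nat n * (of_nat n - 1) * coeff \<rho> 2 + of_nat n * coeff (\<psi> i) 1 + c i"

lemma ev_match: "i < N \<Longrightarrow> j < N \<Longrightarrow> even i \<Longrightarrow> odd j \<Longrightarrow> ev j (Suc n) = ev i n"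
  using eigenvalues_match[of i j n] by (simp add: ev_def)

lemma \<delta>_leading:
  assumes i: "i < N" and p: "degree p \<le> n"
  shows "degree (\<delta> i p) \<le> n" "coeff (\<delta> i p) n = ev i n * coeff p n"
proof -
  have 1: "degree (\<psi> i * pderiv p) \<le> n \<and> coeff (\<psi> i * pderiv p) n = of_nat n * coeff (\<psi> i) 1 * coeff p n"
  proof (cases n)
    case 0
    then have "pderiv p = 0" using p by (simp add: pderiv_eq_0_iff)
    then show ?thesis using 0 by simp
  next
    case (Suc m)
    have d: "degree (pderiv p) \<le> m" using p Suc by (simp add: degree_pderiv)
    have "degree (\<psi> i * pderiv p) \<le> 1 + m"
      using degree_mult_le[of "\<psi> i" "pderiv p"] deg_psi[OF i] d by linarith
    then show ?thesis using coeff_mult_degree_le[OF deg_psi[OF i] d] Suc by (simp add: coeff_pderiv)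
  qed
  have 2: "degree (\<rho> * pderiv (pderiv p)) \<le> n \<and>
    coeff (\<rho> * pderiv (pderiv p)) n = of_nat n * (of_nat n - 1) * coeff \<rho> 2 * coeff p n"
  proof (cases "n < 2")
    case True
    then have "degree (pderiv p) = 0" using p by (simp add: degree_pderiv)
    then have "pderiv (pderiv p) = 0" by (simp add: pderiv_eq_0_iff)
    moreover have "n = 0 \<or> n = 1" using True by auto
    ultimately show ?thesis by auto
  next
    case False
    then obtain m where m: "n = 2 + m" by (metis le_add_diff_inverse not_less)
    have d: "degree (pderiv (pderiv p)) \<le> m" using p m by (simp add: degree_pderiv)
    have "degree (\<rho> * pderiv (pderiv p)) \<le> 2 + m"
      using degree_mult_le[of \<rho> "pderiv (pderiv p)"] deg_rho d by linarith
    then show ?thesis using coeff_mult_degree_le[OF deg_rho d] m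
      by (simp add: coeff_pderiv algebra_simps)
  qed
  show "degree (\<delta> i p) \<le> n"
    unfolding \<delta>_def using 1 2 p by (intro degree_add_le) (auto intro: order.trans[OF degree_smult_le])
  show "coeff (\<delta> i p) n = ev i n * coeff p n"
    unfolding \<delta>_def using 1 2 by (simp add: ev_def algebra_simps)
qed

lemma \<delta>_lin: "\<delta> i (p + q) = \<delta> i p + \<delta> i q" "\<delta> i (smult a p) = smult a (\<delta> i p)"
  by (simp_all add: \<delta>_def pderiv_add pderiv_smult algebra_simps smult_add_right)

lemma \<Delta>_add: "\<Delta> (p + q) = \<Delta> p + \<Delta> q"
proof -
  have "\<delta>r (p + q) = \<delta>r p + \<delta>r q" for p q
    by (auto simp: \<delta>r_def fun_eq_iff row_simps \<delta>_lin)
  then show ?thesis by (simp add: \<Delta>_def \<tau>_add \<tau>i_add)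
qed

lemma \<Delta>_rsm: "\<Delta> (rsm a p) = rsm a (\<Delta> p)"
proof -
  have "\<delta>r (rsm a p) = rsm a (\<delta>r p)" for p
    by (auto simp: \<delta>r_def fun_eq_iff row_simps \<delta>_lin)
  then show ?thesis by (simp add: \<Delta>_def \<tau>_rsm \<tau>i_rsm)
qed

lemma \<Delta>_sum: "\<Delta> (\<Sum>x\<in>I. f x) = (\<Sum>x\<in>I. \<Delta> (f x))"
proof -
  have "\<Delta> 0 = 0" using \<Delta>_rsm[of 0 0] by simp
  then show ?thesis by (induction I rule: infinite_finite_induct) (simp_all add: \<Delta>_add)
qed

text \<open>Only the coefficient of x^(n+1) in odd components is in danger. There
  \<open>\<delta> j\<close> scales the sum of A_ij times the coefficient of x^n in p_i by
  \<open>ev j (Suc n)\<close>, and the correction by the inverse of T subtracts the same sum with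
  each term scaled by \<open>ev i n\<close>; these factors agree.\<close>

lemma \<Delta>_V: 
  assumes p: "p \<in> V (Suc n)"
  shows "\<Delta> p \<in> V (Suc n)"
proof -
  have pn: "degree (p i) \<le> n" for i by (rule V_degree[OF p])
  have "\<delta>r (\<tau> p) \<in> rows" by (simp add: \<delta>r_def rows_def)
  then have "\<Delta> p \<in> rows" by (simp add: \<Delta>_def)
  moreover have "coeff (\<Delta> p j) k = 0" if k: "k \<ge> Suc n" for j k
  proof (cases "j < N \<and> odd j")
    case False
    show ?thesis
    proof (cases "j < N")
      case True
      then have "\<Delta> p j = \<delta> j (p j)" using False by (simp add: \<Delta>_def \<delta>r_def)
      then show ?thesis using \<delta>_leading(1)[OF True pn[of j]] k by (simp add: coeff_eq_0)
    next
      case False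
      then show ?thesis using \<open>\<Delta> p \<in> rows\<close> by (simp add: rows_def)
    qed
  next
    case True
    then have j: "j < N" "odd j" by auto
    have al: "\<alpha> (\<delta>r (\<tau> p)) j = (\<Sum>i<N. smult (A i j) (\<delta> i (p i)))"
      unfolding \<alpha>_def
    proof (rule sum.cong)
      fix i assume "i \<in> {..<N}"
      then show "smult (A i j) (\<delta>r (\<tau> p) i) = smult (A i j) (\<delta> i (p i))"
        using A_supp[of i j] by (cases "A i j = 0") (auto simp: \<delta>r_def)
    qed simp
    have cp: "coeff (\<tau> p j) (Suc n) = (\<Sum>i<N. A i j * coeff (p i) n)"
      using p by (simp add: \<tau>_def \<alpha>_def coeff_sum V_def)
    have dp: "degree (\<tau> p j) \<le> Suc n"
    proof (rule degree_le, intro allI impI)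
      fix d assume d: "Suc n < d"
      then obtain d' where d': "d = Suc d'" "n < d'" by (cases d) auto
      have "coeff (p i) d' = 0" "coeff (p i) d = 0" for i using pn[of i] d' by (simp_all add: coeff_eq_0)
      then show "coeff (\<tau> p j) d = 0" using d' by (simp add: \<tau>_def \<alpha>_def coeff_sum)
    qed
    have e: "\<Delta> p j = \<delta> j (\<tau> p j) - pCons 0 (\<Sum>i<N. smult (A i j) (\<delta> i (p i)))"
      unfolding \<Delta>_def \<tau>i_def al using j by (simp add: \<delta>r_def)
    obtain k' where k': "k = Suc k'" "k' \<ge> n" using k by (cases k) auto
    have c: "coeff (\<Delta> p j) k = coeff (\<delta> j (\<tau> p j)) k - (\<Sum>i<N. A i j * coeff (\<delta> i (p i)) k')"
      by (simp add: e k' coeff_sum)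
    show ?thesis
    proof (cases "k' = n")
      case True
      have "A i j * coeff (\<delta> i (p i)) n = ev j (Suc n) * (A i j * coeff (p i) n)" if i: "i < N" for i
        using \<delta>_leading(2)[OF i pn] ev_match[OF i j(1) _ j(2), of n] A_supp[of i j]
        by (cases "A i j = 0") auto
      then have "(\<Sum>i<N. A i j * coeff (\<delta> i (p i)) n) = ev j (Suc n) * (\<Sum>i<N. A i j * coeff (p i) n)"
        unfolding sum_distrib_left by (intro sum.cong) auto
      then show ?thesis using c True k' \<delta>_leading(2)[OF j(1) dp] cp by simp
    next
      case False
      then have "coeff (\<delta> i (p i)) k' = 0" if "i < N" for i
        using \<delta>_leading(1)[OF that pn[of i]] k' by (intro coeff_eq_0) simp
      moreover have "coeff (\<delta> j (\<tau> p j)) k = 0"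
        using \<delta>_leading(1)[OF j(1) dp] k' False by (intro coeff_eq_0) simp
      ultimately show ?thesis using c by simp
    qed
  qed
  ultimately show ?thesis by (simp add: V_def)
qed

text \<open>By the Pearson equation the second and first order terms tested against g collapse to
  minus the functional of rho p' g', which is symmetric in p and g.\<close>

lemma \<delta>_symmetric:
  assumes i: "i < N"
  shows "l i (\<delta> i p * cj q) = l i (p * cj (\<delta> i q))"
proof -
  have *: "l i ((\<rho> * pderiv (pderiv p) + \<psi> i * pderiv p) * g) = - l i (\<rho> * pderiv p * pderiv g)" for p g
  proof -
    have "(\<rho> * pderiv (pderiv p) + \<psi> i * pderiv p) * g = pderiv (pderiv p) * (\<rho> * g) + pderiv p * (\<psi> i * g)"
      by (simp add: algebra_simps)
    then have "l i ((\<rho> * pderiv (pderiv p) + \<psi> i * pderiv p) * g) =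
      l i (pderiv p * (\<psi> i * g)) - l i (pderiv p * (\<rho> * pderiv g + \<psi> i * g))"
      using pearson_by_parts[OF i, of "pderiv p" g] by (simp add: l_add)
    also have "\<dots> = l i (pderiv p * (\<psi> i * g) - pderiv p * (\<rho> * pderiv g + \<psi> i * g))" by (simp only: l_diff)
    also have "pderiv p * (\<psi> i * g) - pderiv p * (\<rho> * pderiv g + \<psi> i * g) = - (\<rho> * pderiv p * pderiv g)"
      by (simp add: algebra_simps)
    finally show ?thesis by (simp only: l_minus)
  qed
  have "l i (\<delta> i p * cj q) = - l i (\<rho> * pderiv p * pderiv (cj q)) + c i * l i (p * cj q)"
    unfolding \<delta>_def distrib_right[of _ "smult (c i) p"] l_add * by (simp add: l_smult)
  moreover have "p * cj (\<delta> i q) = (\<rho> * pderiv (pderiv (cj q)) + \<psi> i * pderiv (cj q)) * p + smult (c i) (p * cj q)"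
    using i by (simp add: \<delta>_def cj_rho cj_psi cnj_c pderiv_cj algebra_simps)
  then have "l i (p * cj (\<delta> i q)) = - l i (\<rho> * pderiv (cj q) * pderiv p) + c i * l i (p * cj q)"
    by (simp only: l_add * l_smult)
  ultimately show ?thesis by (simp add: mult_ac)
qed

lemma \<Delta>_symmetric: "B (\<tau> (\<Delta> p)) (\<tau> q) = B (\<tau> p) (\<tau> (\<Delta> q))"
  by (simp add: \<Delta>_def B_def \<delta>r_def \<delta>_symmetric)

text \<open>The monomial x^n e_i minus its Riesz representative in \<open>V n\<close>, that is,
  minus its orthogonal projection for the form transported by \<open>\<tau>\<close>.\<close>

lemma monic_OPS_exists:
  "\<exists>Q. monic_family Q \<and> (\<forall>n. \<forall>i<N. \<forall>p\<in>V n. B (\<tau> p) (\<tau> (Q n i)) = 0)"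
proof -
  have ex: "\<exists>s. s \<in> V n \<and> (\<forall>p\<in>V n. B (\<tau> p) (\<tau> s) = B (\<tau> p) (\<tau> (unit_row i (monom 1 n))))" for n i
    using riesz_V[of "\<lambda>p. B (\<tau> p) (\<tau> (unit_row i (monom 1 n)))" n]
    by (auto simp: \<tau>_add \<tau>_rsm B_add_left B_smult_left)
  define s where "s n i = (SOME s. s \<in> V n \<and>
    (\<forall>p\<in>V n. B (\<tau> p) (\<tau> s) = B (\<tau> p) (\<tau> (unit_row i (monom 1 n)))))" for n i
  have s: "s n i \<in> V n"
    "p \<in> V n \<Longrightarrow> B (\<tau> p) (\<tau> (s n i)) = B (\<tau> p) (\<tau> (unit_row i (monom 1 n)))" for n i p
    using someI_ex[OF ex[of n i]] unfolding s_def by auto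
  define Q where "Q n i = unit_row i (monom 1 n) + rsm (-1) (s n i)" for n i
  have "monic_family Q"
    unfolding monic_family_def
  proof (intro allI impI conjI)
    fix n i assume i: "i < N"
    have "unit_row i (monom 1 n) \<in> V (Suc n)" using i by (auto simp: V_def unit_row_def rows_def)
    moreover have "s n i \<in> V (Suc n)" using s(1)[of n i] V_mono[of n "Suc n"] by auto
    ultimately show "Q n i \<in> V (Suc n)" unfolding Q_def
      by (intro rowvs.subspace_add[OF V_subspace] rowvs.subspace_scale[OF V_subspace])
    fix k assume "k < N"
    have "coeff (s n i k) n = 0" using s(1)[of n i] by (simp add: V_def)
    then show "coeff (Q n i k) n = (if i = k then 1 else 0)"
      by (simp add: Q_def row_simps unit_row_def)
  qed
  moreover have "B (\<tau> p) (\<tau> (Q n i)) = 0" if "p \<in> V n" for n i p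
    unfolding Q_def \<tau>_add \<tau>_rsm B_add_right B_smult_right using s(2)[OF that, of i] by simp
  ultimately show ?thesis by blast
qed

text \<open>Removing the leading coefficients leaves a remainder R of degree below n. Symmetry moves
  \<open>\<Delta>\<close> onto R, whose image is still of degree below n and so orthogonal to
  \<open>Q n i\<close>; hence R is orthogonal to itself.\<close>

lemma \<Delta>_eigen:
  assumes Q: "monic_family Q" and orth: "\<And>n i p. i < N \<Longrightarrow> p \<in> V n \<Longrightarrow> B (\<tau> p) (\<tau> (Q n i)) = 0"
    and i: "i < N"
  shows "\<Delta> (Q n i) = (\<Sum>k<N. rsm (coeff (\<Delta> (Q n i) k) n) (Q n k))"
proof -
  have QV: "Q n i \<in> V (Suc n)" using Q i by (simp add: monic_family_def)
  define R where "R = \<Delta> (Q n i) - (\<Sum>k<N. rsm (coeff (\<Delta> (Q n i) k) n) (Q n k))"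
  have RV: "R \<in> V n" unfolding R_def by (rule monic_reduce[OF Q \<Delta>_V[OF QV]])
  have o: "B (\<tau> (Q n k)) (\<tau> p) = 0" if "k < N" "p \<in> V n" for k p
    using orth[OF that] B_cnj[of "\<tau> (Q n k)" "\<tau> p"] by simp
  have "\<Delta> R \<in> V n"
  proof (cases n)
    case 0
    then have "R = 0" using RV V_0 by simp
    then show ?thesis using \<Delta>_rsm[of 0 0] rowvs.subspace_0[OF V_subspace] by simp
  next
    case (Suc m)
    then show ?thesis using \<Delta>_V RV by simp
  qed
  then have "B (\<tau> (\<Delta> (Q n i))) (\<tau> R) = 0" using o[OF i] by (simp add: \<Delta>_symmetric)
  moreover have "B (\<tau> (\<Sum>k<N. rsm (coeff (\<Delta> (Q n i) k) n) (Q n k))) (\<tau> R) = 0"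
    using o RV by (simp add: \<tau>_sum \<tau>_rsm B_sum_left B_smult_left)
  moreover have "\<tau> (\<Delta> (Q n i)) = \<tau> R + \<tau> (\<Sum>k<N. rsm (coeff (\<Delta> (Q n i) k) n) (Q n k))"
    unfolding \<tau>_add[symmetric] R_def by simp
  ultimately have "B (\<tau> R) (\<tau> R) = 0" by (simp add: B_add_left)
  moreover have "R \<in> rows" using RV V_rows[of n] by auto
  ultimately have "R = 0" by (rule B_\<tau>_pos[rotated])
  then show ?thesis by (simp add: R_def)
qed

lemma \<Delta>_entry_dop:
  assumes "m < N"
  shows "dop 3 (\<lambda>p. \<Delta> (unit_row m p) j)"
proof -
  have d: "dop 3 (\<delta> i)" for i
  proof -
    have "dop 3 (\<lambda>p. (pderiv ^^ 2) p * \<rho> + (pderiv ^^ 1) p * \<psi> i + smult (c i) ((pderiv ^^ 0) p))"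
      by (intro dop_add dop_mult_right dop_smult dop_mono[OF dop_higher_pderiv]) auto
    then show ?thesis
      by (simp add: \<delta>_def[abs_def] numeral_2_eq_2 mult.commute del: dop.simps)
  qed
  define g where "g k = (if k = m then 1 else 0) + [:0, A m k:]" for k
  have t: "\<tau> (unit_row m p) k = p * g k" for p k
    unfolding \<tau>_def \<alpha>_unit[OF assms] by (simp add: g_def unit_row_def algebra_simps)
  have r: "dop 3 (\<lambda>p. \<delta>r (\<tau> (unit_row m p)) k)" for k
  proof (cases "k < N")
    case True
    have "dop 3 (\<lambda>p. \<delta> k (p * g k))" by (rule dop_mult_left[OF d])
    then show ?thesis using True by (simp only: \<delta>r_def t if_True)
  qed (simp add: \<delta>r_def dop_zero del: dop.simps)
  show ?thesis unfolding \<Delta>_def \<tau>i_def \<alpha>_def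
    by (intro dop_diff dop_pCons0 dop_sum dop_smult r)
qed

lemma bochner_operator:
  "\<exists>Q \<Lambda> h. monic_family Q \<and>
     (\<forall>n m. n \<noteq> m \<longrightarrow> (\<forall>i<N. \<forall>k<N. B (\<tau> (Q n i)) (\<tau> (Q m k)) = 0)) \<and>
     (\<forall>n. \<forall>i<N. \<forall>j<N. (\<Sum>d<3. \<Sum>m<N. (pderiv ^^ d) (Q n i m) * h d m j) = (\<Sum>k<N. smult (\<Lambda> n i k) (Q n k j))) \<and>
     h 2 0 0 \<noteq> 0"
proof -
  obtain Q where Q: "monic_family Q" and "\<forall>n. \<forall>i<N. \<forall>p\<in>V n. B (\<tau> p) (\<tau> (Q n i)) = 0"
    using monic_OPS_exists by blast
  then have orth: "\<And>n i p. i < N \<Longrightarrow> p \<in> V n \<Longrightarrow> B (\<tau> p) (\<tau> (Q n i)) = 0" by blast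
  have QV: "Q n i \<in> V (Suc n)" if "i < N" for n i using Q that by (simp add: monic_family_def)
  have lt: "B (\<tau> (Q n i)) (\<tau> (Q m k)) = 0" if "n < m" "i < N" "k < N" for n m i k
  proof -
    have "Q n i \<in> V m" using QV[OF that(2), of n] V_mono[of "Suc n" m] that(1) by auto
    then show ?thesis by (rule orth[OF that(3)])
  qed
  have o: "B (\<tau> (Q n i)) (\<tau> (Q m k)) = 0" if "n \<noteq> m" "i < N" "k < N" for n m i k
    using lt[of n m i k] lt[of m n k i] B_cnj[of "\<tau> (Q n i)" "\<tau> (Q m k)"] that
    by (cases "n < m") auto
  define h where "h m j = (SOME h. \<forall>p. \<Delta> (unit_row m p) j = (\<Sum>d<3. (pderiv ^^ d) p * h d))" for m j
  have h: "\<Delta> (unit_row m p) j = (\<Sum>d<3. (pderiv ^^ d) p * h m j d)" if "m < N" for m j p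
    unfolding h_def by (rule someI_ex[OF dop_representation[OF \<Delta>_entry_dop[OF that, of j]], THEN spec])
  have op: "(\<Sum>d<3. \<Sum>m<N. (pderiv ^^ d) (Q n i m) * h m j d) = (\<Sum>k<N. smult (coeff (\<Delta> (Q n i) k) n) (Q n k j))"
    if "i < N" for n i j
  proof -
    have "(\<Sum>d<3. \<Sum>m<N. (pderiv ^^ d) (Q n i m) * h m j d) = (\<Sum>m<N. \<Delta> (unit_row m (Q n i m)) j)"
      by (subst sum.swap) (simp add: h)
    also have "\<dots> = \<Delta> (\<Sum>m<N. unit_row m (Q n i m)) j" by (simp add: \<Delta>_sum row_sum_apply)
    also have "(\<Sum>m<N. unit_row m (Q n i m)) = Q n i"
      using QV[OF that, of n] by (intro unit_row_sum) (auto simp: V_def rows_def)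
    also have "\<Delta> (Q n i) j = (\<Sum>k<N. smult (coeff (\<Delta> (Q n i) k) n) (Q n k j))"
      by (subst \<Delta>_eigen[OF Q orth that]) (simp_all add: row_sum_apply rsm_apply)
    finally show ?thesis .
  qed
  \<comment> \<open>T leaves component 0 alone, so the (0, 0) entry is the classical operator
    itself; the test polynomials 1, x and x^2 recover its coefficients, the last being rho.\<close>
  have nz: "h 0 0 2 \<noteq> 0"
  proof -
    have "0 < N" using N2 by simp
    then have "\<delta> 0 p = (\<Sum>d<3. (pderiv ^^ d) p * h 0 0 d)" for p
      using h[of 0 p 0] by (simp add: \<Delta>_def \<delta>r_def unit_row_def)
    then have e: "\<delta> 0 p = p * h 0 0 0 + pderiv p * h 0 0 1 + pderiv (pderiv p) * h 0 0 2" for p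
      by (simp add: numeral_3_eq_3 numeral_2_eq_2)
    have e0: "h 0 0 0 = [:c 0:]" using e[of 1] by (simp add: \<delta>_def one_pCons)
    have e1: "h 0 0 1 = \<psi> 0" using e[of "[:0, 1:]"] by (simp add: \<delta>_def e0 pderiv_pCons)
    have "[:2:] * h 0 0 2 = [:2:] * \<rho>"
      using e[of "[:0, 0, 1:]"] by (simp add: \<delta>_def e0 e1[unfolded One_nat_def] pderiv_pCons algebra_simps)
    then show ?thesis using rho_nz by auto
  qed
  show ?thesis
  proof (rule exI[of _ Q], rule exI[of _ "\<lambda>n i k. coeff (\<Delta> (Q n i) k) n"],
      rule exI[of _ "\<lambda>d m j. h m j d"], intro conjI allI impI)
  qed (simp_all only: Q o op nz not_False_eq_True)
qed

end

subsection \<open>Matrices as families of rows\<close>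

lemma mat_mult_entry:
  assumes "A \<in> carrier_mat n n" "B \<in> carrier_mat n n" "i < n" "j < n"
  shows "(A * B) $$ (i, j) = (\<Sum>k<n. A $$ (i, k) * B $$ (k, j))"
  using assms by (auto simp: scalar_prod_def lessThan_atLeast0 intro!: sum.cong)

lemma cadj_carrier [simp]: "A \<in> carrier_mat n n \<Longrightarrow> cadj A \<in> carrier_mat n n"
  by (auto simp: cadj_def)

lemma cadj_entry: "A \<in> carrier_mat n n \<Longrightarrow> i < n \<Longrightarrow> j < n \<Longrightarrow> cadj A $$ (i, j) = cnj (A $$ (j, i))"
  by (auto simp: cadj_def)

lemma cadj_mult:
  assumes "A \<in> carrier_mat n n" "B \<in> carrier_mat n n"
  shows "cadj (A * B) = cadj B * cadj A"
proof (rule eq_matI)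
  fix i j assume ij: "i < dim_row (cadj B * cadj A)" "j < dim_col (cadj B * cadj A)"
  then have ij': "i < n" "j < n" using assms by (auto simp: cadj_def)
  have "cadj (A * B) $$ (i, j) = cnj ((A * B) $$ (j, i))"
    using assms ij' by (intro cadj_entry[of _ n]) auto
  also have "\<dots> = (\<Sum>k<n. cnj (A $$ (j, k)) * cnj (B $$ (k, i)))"
    using assms ij' by (simp add: mat_mult_entry[of A n B] del: index_mult_mat)
  also have "\<dots> = (cadj B * cadj A) $$ (i, j)"
    using assms ij' by (subst mat_mult_entry[of _ n]) (auto simp: cadj_entry mult.commute)
  finally show "cadj (A * B) $$ (i, j) = (cadj B * cadj A) $$ (i, j)" .
qed (use assms in \<open>auto simp: cadj_def\<close>)

lemma evalM_carrier [simp]: "P \<in> carrier_mat n m \<Longrightarrow> evalM P z \<in> carrier_mat n m"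
  by (auto simp: evalM_def)

lemma evalM_entry: "P \<in> carrier_mat n m \<Longrightarrow> i < n \<Longrightarrow> j < m \<Longrightarrow> evalM P z $$ (i, j) = poly (P $$ (i, j)) z"
  by (auto simp: evalM_def)

lemma diagW_carrier [simp]: "diagW N f x \<in> carrier_mat N N"
  by (simp add: diagW_def)

lemma sandwich_entry:
  assumes "X \<in> carrier_mat N N" "Y \<in> carrier_mat N N" "i < N" "k < N"
  shows "(X * diagW N f x * cadj Y) $$ (i, k) = (\<Sum>j<N. X $$ (i, j) * of_real (f j x) * cnj (Y $$ (k, j)))"
proof -
  have 1: "(X * diagW N f x) $$ (i, j) = X $$ (i, j) * of_real (f j x)" if "j < N" for j
  proof -
    have "(X * diagW N f x) $$ (i, j) = (\<Sum>l<N. X $$ (i, l) * diagW N f x $$ (l, j))"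
      using assms that by (intro mat_mult_entry) auto
    also have "\<dots> = (\<Sum>l<N. if l = j then X $$ (i, j) * of_real (f j x) else 0)"
      using that by (intro sum.cong) (auto simp: diagW_def)
    finally show ?thesis using that by simp
  qed
  have "(X * diagW N f x * cadj Y) $$ (i, k) = (\<Sum>j<N. (X * diagW N f x) $$ (i, j) * cadj Y $$ (j, k))"
    using assms by (intro mat_mult_entry) auto
  then show ?thesis using assms 1 by (simp add: cadj_entry)
qed

definition rowof :: "nat \<Rightarrow> complex poly mat \<Rightarrow> nat \<Rightarrow> row" where
  "rowof N P i = (\<lambda>j. if j < N then P $$ (i, j) else 0)"

text \<open>For both kinds of matrix units the index of \<open>a\<close> is the larger of the two
  0-based positions.\<close>

definition Acoef :: "nat \<Rightarrow> (nat \<Rightarrow> real) \<Rightarrow> nat \<Rightarrow> nat \<Rightarrow> complex" where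
  "Acoef N a i j = (if i < N \<and> j < N \<and> even i then
     (if j = Suc i then of_real (a j) else if i = Suc j then of_real (a i) else 0) else 0)"

lemma Amat_carrier [simp]: "Amat N a \<in> carrier_mat N N"
  by (simp add: Amat_def msum_def)

lemma Amat_entry:
  assumes "i < N" "j < N"
  shows "Amat N a $$ (i, j) = Acoef N a i j"
proof -
  have 1: "(\<Sum>m\<in>{1..N div 2}. (complex_of_real (a (2*m-1)) \<cdot>\<^sub>m Eunit N (2*m-1) (2*m)) $$ (i, j))
     = (if even i \<and> j = Suc i then of_real (a j) else 0)"
  proof -
    have "(\<Sum>m\<in>{1..N div 2}. (complex_of_real (a (2*m-1)) \<cdot>\<^sub>m Eunit N (2*m-1) (2*m)) $$ (i, j))
      = (\<Sum>m\<in>{1..N div 2}. if m = Suc (i div 2) then (if even i \<and> j = Suc i then of_real (a j) else 0) else 0)"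
      using assms by (intro sum.cong refl) (auto simp: Eunit_def)
    also have "\<dots> = (if even i \<and> j = Suc i then of_real (a j) else 0)"
      using assms by (auto elim!: evenE)
    finally show ?thesis .
  qed
  have 2: "(\<Sum>m\<in>{1..(N-1) div 2}. (complex_of_real (a (2*m)) \<cdot>\<^sub>m Eunit N (2*m+1) (2*m)) $$ (i, j))
     = (if even i \<and> i = Suc j then of_real (a i) else 0)"
  proof -
    have "(\<Sum>m\<in>{1..(N-1) div 2}. (complex_of_real (a (2*m)) \<cdot>\<^sub>m Eunit N (2*m+1) (2*m)) $$ (i, j))
      = (\<Sum>m\<in>{1..(N-1) div 2}. if m = i div 2 then (if even i \<and> i = Suc j then of_real (a i) else 0) else 0)"
      using assms by (intro sum.cong refl) (auto simp: Eunit_def)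
    also have "\<dots> = (if even i \<and> i = Suc j then of_real (a i) else 0)"
      using assms by (auto elim!: evenE)
    finally show ?thesis .
  qed
  show ?thesis using assms 1 2 by (auto simp: Amat_def msum_def Acoef_def)
qed

lemma Tmat_carrier [simp]: "Tmat N a x \<in> carrier_mat N N"
  by (simp add: Tmat_def)

lemma Tmat_entry:
  "i < N \<Longrightarrow> j < N \<Longrightarrow> Tmat N a x $$ (i, j) = (if i = j then 1 else 0) + of_real x * Acoef N a i j"
  using Amat_entry[of i N j a] carrier_matD[OF Amat_carrier[of N a]] by (auto simp: Tmat_def)

lemma (in weight_system) evalM_Tmat_entry:
  assumes A: "A = Acoef N a" and P: "P \<in> carrier_mat N N" and ij: "i < N" "j < N"
  shows "(evalM P (of_real x) * Tmat N a x) $$ (i, j) = poly (\<tau> (rowof N P i) j) (of_real x)"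
proof -
  have "(evalM P (of_real x) * Tmat N a x) $$ (i, j)
    = (\<Sum>k<N. evalM P (of_real x) $$ (i, k) * Tmat N a x $$ (k, j))"
    using P ij by (intro mat_mult_entry) auto
  also have "\<dots> = (\<Sum>k<N. (if k = j then poly (P $$ (i, j)) (of_real x) else 0)
      + of_real x * (A k j * poly (P $$ (i, k)) (of_real x)))"
    using P ij by (intro sum.cong) (auto simp: evalM_entry[of P N N] Tmat_entry A algebra_simps)
  also have "\<dots> = poly (\<tau> (rowof N P i) j) (of_real x)"
    using ij by (simp add: sum.distrib \<tau>_def \<alpha>_def rowof_def poly_sum sum_distrib_left)
  finally show ?thesis .
qed

lemma (in weight_system) ip_entry:
  assumes A: "A = Acoef N a" and PQ: "P \<in> carrier_mat N N" "Q \<in> carrier_mat N N" and ik: "i < N" "k < N"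
    and l: "\<And>j p. j < N \<Longrightarrow> l j p = (LINT x:S|lborel. poly p (of_real x) * complex_of_real (w j x))"
    and int: "\<And>j p. j < N \<Longrightarrow> set_integrable lborel S (\<lambda>x. poly p (of_real x) * complex_of_real (w j x))"
  shows "ip N S (\<lambda>x. Tmat N a x * diagW N w x * cadj (Tmat N a x)) P Q $$ (i, k)
    = B (\<tau> (rowof N P i)) (\<tau> (rowof N Q k))"
proof -
  have e: "(evalM P (of_real x) * (Tmat N a x * diagW N w x * cadj (Tmat N a x)) * cadj (evalM Q (of_real x))) $$ (i, k)
    = (\<Sum>j<N. poly (\<tau> (rowof N P i) j * cj (\<tau> (rowof N Q k) j)) (of_real x) * complex_of_real (w j x))" for x
  proof -
    let ?T = "Tmat N a x" and ?D = "diagW N w x" and ?P = "evalM P (of_real x)" and ?Q = "evalM Q (of_real x)"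
    have c: "?T \<in> carrier_mat N N" "?D \<in> carrier_mat N N" "?P \<in> carrier_mat N N" "?Q \<in> carrier_mat N N"
      "cadj ?T \<in> carrier_mat N N" "cadj ?Q \<in> carrier_mat N N"
      using PQ by auto
    have TD: "?T * ?D \<in> carrier_mat N N" and PTD: "?P * ?T * ?D \<in> carrier_mat N N"
      by (rule mult_carrier_mat[OF c(1,2)], rule mult_carrier_mat[OF mult_carrier_mat[OF c(3,1)] c(2)])
    have "?P * (?T * ?D * cadj ?T) * cadj ?Q = (?P * ?T) * ?D * (cadj ?T * cadj ?Q)"
      unfolding assoc_mult_mat[symmetric, OF c(3) TD c(5)] assoc_mult_mat[symmetric, OF c(3,1,2)]
        assoc_mult_mat[OF PTD c(5,6)] ..
    also have "cadj ?T * cadj ?Q = cadj (?Q * ?T)" using cadj_mult[OF c(4,1)] by simp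
    finally have "(?P * (?T * ?D * cadj ?T) * cadj ?Q) $$ (i, k)
      = (\<Sum>j<N. (?P * ?T) $$ (i, j) * of_real (w j x) * cnj ((?Q * ?T) $$ (k, j)))"
      using c ik by (simp only: sandwich_entry mult_carrier_mat)
    also have "\<dots> = (\<Sum>j<N. poly (\<tau> (rowof N P i) j * cj (\<tau> (rowof N Q k) j)) (of_real x) * complex_of_real (w j x))"
      using ik PQ by (intro sum.cong) (auto simp: evalM_Tmat_entry[OF A] simp del: index_mult_mat)
    finally show ?thesis .
  qed
  have "ip N S (\<lambda>x. Tmat N a x * diagW N w x * cadj (Tmat N a x)) P Q $$ (i, k) =
    (LINT x:S|lborel. (\<Sum>j<N. poly (\<tau> (rowof N P i) j * cj (\<tau> (rowof N Q k) j)) (of_real x) * complex_of_real (w j x)))"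
    using ik by (simp only: ip_def index_mat(1) case_prod_conv e)
  also have "\<dots> = (\<Sum>j<N. LINT x:S|lborel. poly (\<tau> (rowof N P i) j * cj (\<tau> (rowof N Q k) j)) (of_real x) * complex_of_real (w j x))"
    unfolding set_lebesgue_integral_def scaleR_sum_right
    by (intro Bochner_Integration.integral_sum int[unfolded set_integrable_def]) simp
  also have "\<dots> = B (\<tau> (rowof N P i)) (\<tau> (rowof N Q k))"
    unfolding B_def by (intro sum.cong) (simp_all add: l)
  finally show ?thesis .
qed

subsection \<open>Moment functionals\<close>

lemma not_AE_notin_open:
  assumes "open (S :: real set)" "S \<noteq> {}"
  shows "\<not> (AE x in lborel. x \<notin> S)"
proof
  assume "AE x in lborel. x \<notin> S"
  moreover have "S \<in> sets lborel" using assms(1) by simp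
  ultimately have "S \<in> null_sets lborel" using AE_iff_null_sets by blast
  then have "S \<in> null_sets lebesgue" by (rule null_sets_completionI)
  then have "negligible S" by (simp add: negligible_iff_null_sets)
  then show False using open_not_negligible[OF assms] by blast
qed

locale positive_weights =
  fixes N :: nat and S :: "real set" and w :: "nat \<Rightarrow> real \<Rightarrow> real"
  assumes S_open: "open S" and S_ne: "S \<noteq> {}"
    and w_pos: "i < N \<Longrightarrow> AE x in lborel. x \<in> S \<longrightarrow> w i x > 0"
    and moments: "i < N \<Longrightarrow> set_integrable lborel S (\<lambda>x. x ^ k * w i x)"
begin

text \<open>The value zero from N on provides linearity for all indices, as \<open>row_form\<close>
  demands, although integrability is known below N only.\<close>

definition L :: "nat \<Rightarrow> complex poly \<Rightarrow> complex" where
  "L i p = (if i < N then LINT x:S|lborel. poly p (of_real x) * complex_of_real (w i x) else 0)"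

lemma integrable_poly:
  assumes "i < N"
  shows "set_integrable lborel S (\<lambda>x. poly p (of_real x) * complex_of_real (w i x))"
proof -
  have "(\<lambda>x. indicator S x *\<^sub>R (poly p (of_real x) * complex_of_real (w i x))) =
    (\<lambda>x. \<Sum>k\<le>degree p. coeff p k * complex_of_real (indicator S x *\<^sub>R (x ^ k * w i x)))"
    by (auto simp: poly_altdef sum_distrib_right sum_distrib_left fun_eq_iff indicator_def mult_ac)
  then show ?thesis
    using moments[OF assms] unfolding set_integrable_def
    by (auto intro!: integrable_mult_right integrable_of_real simp del: of_real_mult of_real_power)
qed

lemma L_add: "L i (p + q) = L i p + L i q"
  using integrable_poly[of i p] integrable_poly[of i q] by (simp add: L_def distrib_right)

lemma L_smult: "L i (smult c p) = c * L i p"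
  by (simp add: L_def mult.assoc)

lemma L_cj: "L i (cj p) = cnj (L i p)"
proof -
  have e: "(\<lambda>x. indicator S x *\<^sub>R (poly (cj p) (of_real x) * complex_of_real (w i x)))
    = (\<lambda>x. cnj (indicator S x *\<^sub>R (poly p (of_real x) * complex_of_real (w i x))))"
    by (auto simp: fun_eq_iff indicator_def)
  show ?thesis
  proof (cases "i < N")
    case True
    have "L i (cj p) = (CLBINT x. indicator S x *\<^sub>R (poly (cj p) (of_real x) * complex_of_real (w i x)))"
      using True by (simp only: L_def set_lebesgue_integral_def if_True)
    also have "\<dots> = cnj (CLBINT x. indicator S x *\<^sub>R (poly p (of_real x) * complex_of_real (w i x)))"
      unfolding e by (rule Bochner_Integration.integral_cnj)
    also have "\<dots> = cnj (L i p)"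
      using True by (simp only: L_def set_lebesgue_integral_def if_True)
    finally show ?thesis .
  qed (simp add: L_def)
qed

text \<open>On the real line the integrand is |p|^2 w. A zero integral would make it vanish almost
  everywhere on S, but p has finitely many roots, w is positive almost everywhere on S, and S has
  positive measure.\<close>

lemma L_pos:
  assumes i: "i < N" and p: "p \<noteq> 0"
  shows "Re (L i (p * cj p)) > 0"
proof -
  define g where "g x = (cmod (poly p (of_real x)))\<^sup>2 * w i x" for x :: real
  have e: "poly (p * cj p) (of_real x) * complex_of_real (w i x) = complex_of_real (g x)" for x
    by (simp add: g_def complex_norm_square[symmetric] del: of_real_power)
  have int: "set_integrable lborel S g"
    using integrable_poly[OF i, of "p * cj p"] unfolding e set_integrable_def
    by (simp add: scaleR_conv_of_real of_real_mult[symmetric] complex_of_real_integrable_eq del: of_real_mult)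
  have Lg: "L i (p * cj p) = of_real (LINT x:S|lborel. g x)"
    using i unfolding L_def e by (simp add: set_integral_complex_of_real)
  have nn: "AE x in lborel. 0 \<le> indicator S x *\<^sub>R g x"
    using w_pos[OF i] by eventually_elim (auto simp: g_def indicator_def)
  have "(LINT x:S|lborel. g x) \<ge> 0"
    unfolding set_lebesgue_integral_def by (rule integral_nonneg_AE[OF nn])
  moreover have "(LINT x:S|lborel. g x) \<noteq> 0"
  proof
    assume "(LINT x:S|lborel. g x) = 0"
    then have z: "AE x in lborel. indicator S x *\<^sub>R g x = 0"
      unfolding set_lebesgue_integral_def
      using integral_nonneg_eq_0_iff_AE[OF _ nn] int by (simp add: set_integrable_def)
    have "finite (complex_of_real -` {z. poly p z = 0})"
      by (rule finite_vimageI[OF poly_roots_finite[OF p]]) (simp add: inj_of_real)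
    then have "AE x in lborel. x \<notin> complex_of_real -` {z. poly p z = 0}"
      by (intro AE_not_in finite_imp_null_set_lborel)
    with z w_pos[OF i] have "AE x in lborel. x \<notin> S"
      by eventually_elim (auto simp: g_def indicator_def split: if_splits)
    then show False using not_AE_notin_open[OF S_open S_ne] by blast
  qed
  ultimately show ?thesis using Lg by simp
qed

sublocale row_form N L
  by standard (auto simp: L_add L_smult L_cj L_pos)

lemma ip_diag_entry:
  assumes PQ: "P \<in> carrier_mat N N" "Q \<in> carrier_mat N N" and ik: "i < N" "k < N"
  shows "ip N S (diagW N w) P Q $$ (i, k) = B (rowof N P i) (rowof N Q k)"
proof -
  have e: "(evalM P (of_real x) * diagW N w x * cadj (evalM Q (of_real x))) $$ (i, k)
    = (\<Sum>j<N. poly (rowof N P i j * cj (rowof N Q k j)) (of_real x) * complex_of_real (w j x))" for x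
    using PQ ik by (subst sandwich_entry) (auto intro!: sum.cong simp: evalM_entry[of _ N N] rowof_def mult_ac)
  have "ip N S (diagW N w) P Q $$ (i, k) =
    (LINT x:S|lborel. (\<Sum>j<N. poly (rowof N P i j * cj (rowof N Q k j)) (of_real x) * complex_of_real (w j x)))"
    using ik by (simp only: ip_def index_mat(1) case_prod_conv e)
  also have "\<dots> = (\<Sum>j<N. LINT x:S|lborel. poly (rowof N P i j * cj (rowof N Q k j)) (of_real x) * complex_of_real (w j x))"
    unfolding set_lebesgue_integral_def scaleR_sum_right
    by (intro Bochner_Integration.integral_sum integrable_poly[unfolded set_integrable_def]) simp
  also have "\<dots> = B (rowof N P i) (rowof N Q k)"
    unfolding B_def by (intro sum.cong) (simp_all add: L_def)
  finally show ?thesis .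
qed

end

lemma (in row_form) monic_deg_family:
  assumes "\<And>n. monic_deg N (P n) n"
  shows "monic_family (\<lambda>n. rowof N (P n))"
  unfolding monic_family_def
proof (intro allI impI conjI)
  fix n i assume i: "i < N"
  have d: "degree (P n $$ (i, j)) \<le> n" if "j < N" for j
    using assms[of n] i that by (simp add: monic_deg_def)
  have "coeff (rowof N (P n) i j) k = 0" if "k \<ge> Suc n" for j k
    using d[of j] that by (cases "j < N") (auto simp: rowof_def intro!: coeff_eq_0)
  then show "rowof N (P n) i \<in> V (Suc n)" by (simp add: V_def rows_def rowof_def)
  fix k assume "k < N"
  then show "coeff (rowof N (P n) i k) n = (if i = k then 1 else 0)"
    using assms[of n] i by (simp add: monic_deg_def rowof_def)
qed

text \<open>Monicity gives an off-diagonal entry degree below n, so the row with that single entry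
  is orthogonal to row i of P_n; for a diagonal weight this inner product is the norm of the
  entry.\<close>

lemma (in positive_weights) diagonal_OPS:
  assumes P: "monic_OPS N S (diagW N w) P" and ij: "i < N" "j < N" "i \<noteq> j"
  shows "P n $$ (i, j) = 0"
proof -
  have md: "monic_deg N (P n) n" for n using P by (simp add: monic_OPS_def)
  have car: "P n \<in> carrier_mat N N" for n using md by (simp add: monic_deg_def)
  have mon: "monic_family (\<lambda>n. rowof N (P n))" by (rule monic_deg_family[OF md])
  have o: "B (rowof N (P n) i) (rowof N (P m) k) = 0" if "m < n" "k < N" for m k
  proof -
    have "ip N S (diagW N w) (P n) (P m) = 0\<^sub>m N N" using P that by (auto simp: monic_OPS_def)
    then show ?thesis using ip_diag_entry[OF car car ij(1) that(2), of n m] ij that by simp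
  qed
  have "V n \<subseteq> {p. B (rowof N (P n) i) p = 0}"
    by (rule monic_family_span[OF mon]) (use o in \<open>auto simp: rowvs.subspace_def B_add_right B_smult_right\<close>)
  moreover have "unit_row j (P n $$ (i, j)) \<in> V n"
  proof -
    have "coeff (P n $$ (i, j)) k = 0" if "k \<ge> n" for k
    proof (cases "k = n")
      case True
      then show ?thesis using md[of n] ij by (simp add: monic_deg_def)
    next
      case False
      have "degree (P n $$ (i, j)) \<le> n" using md[of n] ij by (simp add: monic_deg_def)
      then show ?thesis using that False by (intro coeff_eq_0) simp
    qed
    then show ?thesis using ij by (auto simp: V_def unit_row_def rows_def)
  qed
  ultimately have "B (rowof N (P n) i) (unit_row j (P n $$ (i, j))) = 0" by blast
  then have "L j (P n $$ (i, j) * cj (P n $$ (i, j))) = 0"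
    using ij by (simp add: B_unit_right rowof_def)
  then show ?thesis using l_eq_0[OF ij(2)] by blast
qed

lemma diag_weight_positive:
  assumes W: "weight_matrix N S (diagW N f)"
  shows "positive_weights N S f"
proof
  show "open S" "S \<noteq> {}" using W by (auto simp: weight_matrix_def)
  fix i assume i: "i < N"
  have "AE x in lborel. x \<in> S \<longrightarrow> pos_def_mat N (diagW N f x)" using W by (simp add: weight_matrix_def)
  then show "AE x in lborel. x \<in> S \<longrightarrow> 0 < f i x"
  proof eventually_elim
    case (elim x)
    show ?case
    proof
      assume "x \<in> S"
      then have pd: "pos_def_mat N (diagW N f x)" using elim by blast
      define v where "v k = (if k = i then 1 else 0 :: complex)" for k
      have "(\<Sum>k<N. \<Sum>j<N. cnj (v k) * diagW N f x $$ (k, j) * v j) = (\<Sum>k<N. if k = i then of_real (f i x) else 0)"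
      proof (rule sum.cong)
        fix k assume "k \<in> {..<N}"
        then have "(\<Sum>j<N. cnj (v k) * diagW N f x $$ (k, j) * v j) = (\<Sum>j<N. if j = i then (if k = i then of_real (f i x) else 0) else 0)"
          by (intro sum.cong) (auto simp: v_def diagW_def)
        then show "(\<Sum>j<N. cnj (v k) * diagW N f x $$ (k, j) * v j) = (if k = i then of_real (f i x) else 0)"
          using i by simp
      qed simp
      then have "(\<Sum>k<N. \<Sum>j<N. cnj (v k) * diagW N f x $$ (k, j) * v j) = of_real (f i x)" using i by simp
      moreover have "\<exists>k<N. v k \<noteq> 0" using i by (auto simp: v_def)
      then have "Re (\<Sum>k<N. \<Sum>j<N. cnj (v k) * diagW N f x $$ (k, j) * v j) > 0"
        using pd unfolding pos_def_mat_def Let_def by blast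
      ultimately show "0 < f i x" by simp
    qed
  qed
  fix k
  have "set_integrable lborel S (\<lambda>x. complex_of_real (x ^ k) * diagW N f x $$ (i, i))"
    using W i by (simp add: weight_matrix_def)
  then have "set_integrable lborel S (\<lambda>x. complex_of_real (x ^ k * f i x))"
    using i by (simp add: diagW_def)
  then show "set_integrable lborel S (\<lambda>x. x ^ k * f i x)"
    unfolding set_integrable_def
    by (simp add: scaleR_conv_of_real of_real_mult[symmetric] of_real_power[symmetric] complex_of_real_integrable_eq
        del: of_real_mult of_real_power)
qed

subsection \<open>Darboux data in terms of rows\<close>

text \<open>Numerator of the \<open>j\<close>-th derivative of \<open>p / d\<close> over the denominator \<open>d\<^sup>j\<^sup>+\<^sup>1\<close>.\<close>

fun quot_num :: "complex poly \<Rightarrow> nat \<Rightarrow> complex poly \<Rightarrow> complex poly" where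
  "quot_num d 0 p = p"
| "quot_num d (Suc j) p = pderiv (quot_num d j p) * d - smult (of_nat (Suc j)) (quot_num d j p * pderiv d)"

lemma quot_num_dopE: "dopE (quot_num d j)"
proof (induction j)
  case 0
  have "quot_num d 0 = (\<lambda>p. p)" by auto
  then show ?case using dopE_id by simp
next
  case (Suc j)
  have "dopE (\<lambda>p. (pderiv ^^ 1) (quot_num d j p) * d - smult (of_nat (Suc j)) (quot_num d j p * pderiv d))"
    by (intro dopE_diff dopE_mult_right dopE_smult Suc dopE_comp[OF dopE_higher_pderiv])
  moreover have "quot_num d (Suc j) = (\<lambda>p. (pderiv ^^ 1) (quot_num d j p) * d - smult (of_nat (Suc j)) (quot_num d j p * pderiv d))"
    by (rule ext) simp
  ultimately show ?case by (simp only:)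
qed

lemma higher_deriv_quotient:
  assumes "poly d z \<noteq> 0"
  shows "(deriv ^^ j) (\<lambda>w. poly p w / poly d w) z = poly (quot_num d j p) z / poly d z ^ Suc j"
  using assms
proof (induction j arbitrary: z)
  case (Suc j)
  have op: "open {w. poly d w \<noteq> 0}"
    by (intro open_Collect_neq continuous_intros)
  have "((\<lambda>w. poly (quot_num d j p) w / poly d w ^ Suc j) has_field_derivative
     poly (quot_num d (Suc j) p) z / poly d z ^ Suc (Suc j)) (at z)"
    using Suc.prems
    by (auto intro!: derivative_eq_intros simp: divide_simps; cases j; simp add: algebra_simps)
  then have "((deriv ^^ j) (\<lambda>w. poly p w / poly d w) has_field_derivative
     poly (quot_num d (Suc j) p) z / poly d z ^ Suc (Suc j)) (at z)"
    by (rule has_field_derivative_transform_within_open[OF _ op]) (use Suc in auto)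
  then show ?case by (simp add: DERIV_imp_deriv)
qed simp

lemma poly_eq_off_roots:
  assumes "d \<noteq> 0" "\<And>z. poly d z \<noteq> 0 \<Longrightarrow> poly p z = poly q (z :: complex)"
  shows "p = q"
proof -
  have "poly (d * p) z = poly (d * q) z" for z using assms(2)[of z] by (cases "poly d z = 0") auto
  then have "d * p = d * q" by (rule poly_ext)
  then show ?thesis using assms(1) by simp
qed

text \<open>Right division by \<open>F\<close> after \<open>D\<close>, and application of \<open>Dt\<close> to \<open>R Ft\<^sup>-\<^sup>1\<close>, both with
  denominators cleared.\<close>

definition apply_num :: "nat \<Rightarrow> complex poly mat list \<Rightarrow> complex poly mat \<Rightarrow> nat \<Rightarrow> nat \<Rightarrow> complex poly \<Rightarrow> complex poly" where
  "apply_num N D F i k p = (\<Sum>m<N. (\<Sum>j<length D. (pderiv ^^ j) p * D ! j $$ (i, m)) * adj_mat F $$ (m, k))"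

definition rat_num :: "nat \<Rightarrow> complex poly mat list \<Rightarrow> complex poly mat \<Rightarrow> nat \<Rightarrow> nat \<Rightarrow> complex poly \<Rightarrow> complex poly" where
  "rat_num N D F i k p = (\<Sum>j<length D. \<Sum>m<N.
     quot_num (det F) j (p * adj_mat F $$ (i, m)) * (D ! j $$ (m, k) * det F ^ (length D - j)))"

lemma apply_num_dopE: "dopE (apply_num N D F i k)"
  unfolding apply_num_def[abs_def]
  by (intro dopE_sum dopE_mult_right dopE_higher_pderiv)

lemma rat_num_dopE: "dopE (rat_num N D F i k)"
proof -
  have "dopE (\<lambda>p. quot_num d j (p * g))" for d j g
    by (rule dopE_comp[OF quot_num_dopE]) (rule dopE_mult_right[OF dopE_id])
  then show ?thesis unfolding rat_num_def[abs_def] by (intro dopE_sum dopE_mult_right)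
qed

lemma apply_op_entry:
  assumes P: "P \<in> carrier_mat N N" and D: "op_coeffs N D" and ik: "i < N" "k < N"
  shows "apply_op N P D $$ (i, k) = (\<Sum>j<length D. \<Sum>m<N. (pderiv ^^ j) (P $$ (i, m)) * D ! j $$ (m, k))"
proof -
  have "(mderiv j P * D ! j) $$ (i, k) = (\<Sum>m<N. (pderiv ^^ j) (P $$ (i, m)) * D ! j $$ (m, k))" if "j < length D" for j
  proof -
    have "(mderiv j P * D ! j) $$ (i, k) = (\<Sum>m<N. mderiv j P $$ (i, m) * D ! j $$ (m, k))"
      using P D that ik by (intro mat_mult_entry) (auto simp: mderiv_def op_coeffs_def)
    then show ?thesis using P ik by (simp add: mderiv_def)
  qed
  then show ?thesis using ik by (simp add: apply_op_def msum_def)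
qed

lemma apply_op_carrier [simp]: "apply_op N P D \<in> carrier_mat N N"
  by (simp add: apply_op_def msum_def)

lemma apply_num_sum:
  assumes P: "P \<in> carrier_mat N N" and D: "op_coeffs N D" and F: "F \<in> carrier_mat N N" and ik: "i < N" "k < N"
  shows "(apply_op N P D * adj_mat F) $$ (i, k) = (\<Sum>m<N. apply_num N D F m k (P $$ (i, m)))"
proof -
  have "(apply_op N P D * adj_mat F) $$ (i, k) = (\<Sum>r<N. apply_op N P D $$ (i, r) * adj_mat F $$ (r, k))"
    using F ik adj_mat(1)[OF F] by (intro mat_mult_entry) auto
  also have "\<dots> = (\<Sum>r<N. (\<Sum>j<length D. \<Sum>m<N. (pderiv ^^ j) (P $$ (i, m)) * D ! j $$ (m, r)) * adj_mat F $$ (r, k))"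
    using apply_op_entry[OF P D ik(1)] by (intro sum.cong) auto
  also have "\<dots> = (\<Sum>r<N. \<Sum>m<N. (\<Sum>j<length D. (pderiv ^^ j) (P $$ (i, m)) * D ! j $$ (m, r)) * adj_mat F $$ (r, k))"
    unfolding sum_distrib_right by (subst sum.swap) simp
  also have "\<dots> = (\<Sum>m<N. apply_num N D F m k (P $$ (i, m)))"
    unfolding apply_num_def by (rule sum.swap)
  finally show ?thesis .
qed

lemma rat_num_sum:
  assumes R: "R \<in> carrier_mat N N" and F: "F \<in> carrier_mat N N" and ik: "i < N" "k < N"
    and z: "poly (det F) z \<noteq> 0"
  shows "poly (det F) z ^ Suc (length D) * rat_apply N (R * adj_mat F) (det F) D z $$ (i, k)
    = poly (\<Sum>m<N. rat_num N D F m k (R $$ (i, m))) z"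
proof -
  let ?d = "det F"
  have lin: "lin (quot_num ?d j)" for j by (rule dopE_lin[OF quot_num_dopE])
  have q: "quot_num ?d j ((R * adj_mat F) $$ (i, r)) = (\<Sum>m<N. quot_num ?d j (R $$ (i, m) * adj_mat F $$ (m, r)))"
    if "r < N" for j r
  proof -
    have "(R * adj_mat F) $$ (i, r) = (\<Sum>m<N. R $$ (i, m) * adj_mat F $$ (m, r))"
      using R adj_mat(1)[OF F] ik that by (intro mat_mult_entry) auto
    moreover have "quot_num ?d j (\<Sum>m\<in>M. f m) = (\<Sum>m\<in>M. quot_num ?d j (f m))" for M :: "nat set" and f
      by (induction M rule: infinite_finite_induct) (simp_all add: lin_zero[OF lin] lin_add[OF lin])
    ultimately show ?thesis by simp
  qed
  have "poly ?d z ^ Suc (length D) * rat_apply N (R * adj_mat F) ?d D z $$ (i, k)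
    = (\<Sum>j<length D. \<Sum>r<N. poly ?d z ^ Suc (length D) *
        ((deriv ^^ j) (\<lambda>w. poly ((R * adj_mat F) $$ (i, r)) w / poly ?d w) z * poly (D ! j $$ (r, k)) z))"
    using ik by (simp add: rat_apply_def sum_distrib_left del: index_mult_mat power_Suc)
  also have "\<dots> = (\<Sum>j<length D. \<Sum>r<N. \<Sum>m<N. poly (quot_num ?d j (R $$ (i, m) * adj_mat F $$ (m, r)) * (D ! j $$ (r, k) * ?d ^ (length D - j))) z)"
  proof (intro sum.cong refl)
    fix j r assume j: "j \<in> {..<length D}" and r: "r \<in> {..<N}"
    \<comment> \<open>The j-th derivative has denominator d^(j+1); the other factor raises all terms
      to one common power.\<close>
    have "poly ?d z ^ Suc (length D) = poly ?d z ^ Suc j * poly ?d z ^ (length D - j)"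
      using j by (simp add: power_add[symmetric])
    then have e: "poly ?d z ^ Suc (length D) *
        ((deriv ^^ j) (\<lambda>w. poly ((R * adj_mat F) $$ (i, r)) w / poly ?d w) z * poly (D ! j $$ (r, k)) z)
      = poly (quot_num ?d j ((R * adj_mat F) $$ (i, r))) z * (poly (D ! j $$ (r, k)) z * poly ?d z ^ (length D - j))"
      using z by (simp add: higher_deriv_quotient[OF z] del: index_mult_mat power_Suc)
    show "poly ?d z ^ Suc (length D) *
        ((deriv ^^ j) (\<lambda>w. poly ((R * adj_mat F) $$ (i, r)) w / poly ?d w) z * poly (D ! j $$ (r, k)) z)
      = (\<Sum>m<N. poly (quot_num ?d j (R $$ (i, m) * adj_mat F $$ (m, r)) * (D ! j $$ (r, k) * ?d ^ (length D - j))) z)"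
      unfolding e using r by (simp add: q poly_sum sum_distrib_right del: index_mult_mat)
  qed
  also have "\<dots> = (\<Sum>j<length D. \<Sum>m<N. \<Sum>r<N. poly (quot_num ?d j (R $$ (i, m) * adj_mat F $$ (m, r)) * (D ! j $$ (r, k) * ?d ^ (length D - j))) z)"
    by (rule sum.cong[OF refl], rule sum.swap)
  also have "\<dots> = (\<Sum>m<N. \<Sum>j<length D. \<Sum>r<N. poly (quot_num ?d j (R $$ (i, m) * adj_mat F $$ (m, r)) * (D ! j $$ (r, k) * ?d ^ (length D - j))) z)"
    by (rule sum.swap)
  also have "\<dots> = poly (\<Sum>m<N. rat_num N D F m k (R $$ (i, m))) z"
    by (simp add: rat_num_def poly_sum)
  finally show ?thesis .
qed

section \<open>Rank one operator from Darboux data\<close>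

text \<open>Divisibility by g is known on a monic family only, but it is a linear condition and so
  holds on all rows. Rows with a single entry then make every K_m divisible by g separately, and the
  quotients are differential operators by \<open>dop_cancel\<close>.\<close>

lemma (in row_form) operator_division:
  assumes R: "monic_family R" and g: "g \<noteq> 0" and K: "\<And>m. m < N \<Longrightarrow> dopE (K m)"
    and e: "\<And>n i. i < N \<Longrightarrow> (\<Sum>m<N. K m (R n i m)) = g * e n i"
  shows "\<exists>H. (\<forall>m<N. dopE (H m)) \<and> (\<forall>n. \<forall>i<N. (\<Sum>m<N. H m (R n i m)) = e n i)"
proof -
  have lin: "lin (K m)" if "m < N" for m using dopE_lin[OF K[OF that]] .
  define Z where "Z = {q :: row. g dvd (\<Sum>m<N. K m (q m))}"
  have Z: "rowvs.subspace Z"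
  proof -
    have "(\<Sum>m<N. K m (0 :: complex poly)) = 0" by (intro sum.neutral) (auto simp: lin_zero[OF lin])
    moreover have "(\<Sum>m<N. K m (p m + q m)) = (\<Sum>m<N. K m (p m)) + (\<Sum>m<N. K m (q m))" for p q :: row
      by (simp add: sum.distrib[symmetric] lin_add[OF lin])
    moreover have "(\<Sum>m<N. K m (smult c (p m))) = smult c (\<Sum>m<N. K m (p m))" for c and p :: row
      by (simp add: smult_sum2 lin_smult[OF lin])
    ultimately show ?thesis
      by (auto simp: Z_def rowvs.subspace_def row_simps intro: dvd_smult)
  qed
  have "V k \<subseteq> Z" for k by (rule monic_family_span[OF R Z]) (simp add: Z_def e)
  then have inZ: "unit_row m p \<in> Z" if "m < N" for m p
    using rows_in_V[OF unit_rows[OF that, of p]] by auto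
  have dv: "g dvd K m p" if m: "m < N" for m p
  proof -
    have "(\<Sum>k<N. K k (unit_row m p k)) = (\<Sum>k<N. if k = m then K m p else 0)"
      by (intro sum.cong) (auto simp: unit_row_def lin_zero[OF lin])
    then show ?thesis using inZ[OF m, of p] m by (simp add: Z_def)
  qed
  define H where "H m p = K m p div g" for m p
  have H: "g * H m p = K m p" if "m < N" for m p using dv[OF that] by (simp add: H_def)
  have "dopE (H m)" if "m < N" for m by (rule dopE_cancel[OF K[OF that] g H[OF that]])
  moreover have "(\<Sum>m<N. H m (R n i m)) = e n i" if i: "i < N" for n i
  proof -
    have "g * (\<Sum>m<N. H m (R n i m)) = g * e n i" unfolding sum_distrib_left e[OF i, symmetric] using H by simp
    then show ?thesis using g by simp
  qed
  ultimately show ?thesis by blast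
qed

lemma constant_combination_entry:
  assumes "C \<in> carrier_mat N N" "Q \<in> carrier_mat N N" "i < N" "k < N"
  shows "(C * evalM Q z) $$ (i, k) = poly (\<Sum>m<N. smult (C $$ (i, m)) (Q $$ (m, k))) z"
proof -
  have "(C * evalM Q z) $$ (i, k) = (\<Sum>m<N. C $$ (i, m) * evalM Q z $$ (m, k))"
    using assms by (intro mat_mult_entry) auto
  then show ?thesis using assms by (simp add: evalM_entry[of Q N N] poly_sum)
qed

lemma det_nonzero_row:
  assumes "C \<in> carrier_mat N N" "det C \<noteq> 0" "i < N"
  shows "\<exists>k<N. C $$ (i, k) \<noteq> (0 :: complex)"
proof (rule ccontr)
  assume "\<not> ?thesis"
  then have "det C = 0" using laplace_expansion_row[OF assms(1,3)] by simp
  then show False using assms by simp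
qed

lemma det_nonzero_col:
  assumes "C \<in> carrier_mat N N" "det C \<noteq> 0" "j < N"
  shows "\<exists>i<N. C $$ (i, j) \<noteq> (0 :: complex)"
proof (rule ccontr)
  assume "\<not> ?thesis"
  then have "det C = 0" using laplace_expansion_column[OF assms(1,3)] by simp
  then show False using assms by simp
qed

text \<open>\<open>G\<close> sends the rows of Q_n to the column Ct_n e_0 times the (0, 0) entry of
  P_n, and \<open>H\<close> sends this entry to the row e_0^T C_n Q_n. The composition acts on Q_n
  by the eigenvalue Ct_n e_0 e_0^T C_n.\<close>

lemma (in incompatible_weights) not_darboux_diagonal:
  assumes A: "A = Acoef N a"
    and l: "\<And>j p. j < N \<Longrightarrow> l j p = (LINT x:S|lborel. poly p (of_real x) * complex_of_real (w j x))"
    and int: "\<And>j p. j < N \<Longrightarrow> set_integrable lborel S (\<lambda>x. poly p (of_real x) * complex_of_real (w j x))"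
    and dar: "darboux N S0 (diagW N f) S (\<lambda>x. Tmat N a x * diagW N w x * cadj (Tmat N a x))"
  shows False
proof -
  let ?W = "\<lambda>x. Tmat N a x * diagW N w x * cadj (Tmat N a x)"
  obtain P Q D Dt F Ft C Ct where W0: "weight_matrix N S0 (diagW N f)"
    and P: "monic_OPS N S0 (diagW N f) P" and Q: "monic_OPS N S ?W Q"
    and D: "in_FR N P D" and Dt: "in_FR N P Dt"
    and F: "F \<in> carrier_mat N N" "det F \<noteq> 0" and Ft: "Ft \<in> carrier_mat N N" "det Ft \<noteq> 0"
    and CCt: "\<forall>n. C n \<in> carrier_mat N N \<and> Ct n \<in> carrier_mat N N"
    and fC: "finite {n. det (C n) = 0}" and fCt: "finite {n. det (Ct n) = 0}"
    and dC': "\<forall>n z. poly (det F) z \<noteq> 0 \<longrightarrow>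
            C n * evalM (Q n) z = (1 / poly (det F) z) \<cdot>\<^sub>m evalM (apply_op N (P n) D * adj_mat F) z"
    and dCt': "\<forall>n z. poly (det Ft) z \<noteq> 0 \<longrightarrow>
            Ct n * evalM (P n) z = rat_apply N (Q n * adj_mat Ft) (det Ft) Dt z"
    using dar unfolding darboux_def by (elim conjE exE) (rule that; assumption)
  have C: "C n \<in> carrier_mat N N" and Ct: "Ct n \<in> carrier_mat N N" for n using CCt by auto
  note dC = dC'[rule_format] and dCt = dCt'[rule_format]
  interpret W0: positive_weights N S0 f by (rule diag_weight_positive[OF W0])
  have Pm: "monic_deg N (P n) n" for n using P by (simp add: monic_OPS_def)
  have Qm: "monic_deg N (Q n) n" for n using Q by (simp add: monic_OPS_def)
  have Pc: "P n \<in> carrier_mat N N" for n using Pm by (simp add: monic_deg_def)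
  have Qc: "Q n \<in> carrier_mat N N" for n using Qm by (simp add: monic_deg_def)
  have Pd: "P n $$ (i, j) = 0" if "i < N" "j < N" "i \<noteq> j" for n i j by (rule W0.diagonal_OPS[OF P that])
  have N0: "0 < N" using N2 by simp
  have monP: "monic_family (\<lambda>n. rowof N (P n))" by (rule monic_deg_family[OF Pm])
  have monQ: "monic_family (\<lambda>n. rowof N (Q n))" by (rule monic_deg_family[OF Qm])
  have opD: "op_coeffs N D" using D by (simp add: in_FR_def)

  have G: "\<exists>H. (\<forall>m<N. dopE (H m)) \<and>
      (\<forall>n. \<forall>i<N. (\<Sum>m<N. H m (rowof N (Q n) i m)) = smult (Ct n $$ (i, 0)) (P n $$ (0, 0)))"
  proof (rule operator_division[OF monQ])
    show "det Ft ^ Suc (length Dt) \<noteq> 0" using Ft by simp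
    show "dopE (rat_num N Dt Ft m 0)" for m by (rule rat_num_dopE)
    fix n i assume i: "i < N"
    show "(\<Sum>m<N. rat_num N Dt Ft m 0 (rowof N (Q n) i m)) = det Ft ^ Suc (length Dt) * smult (Ct n $$ (i, 0)) (P n $$ (0, 0))"
    proof (rule poly_eq_off_roots[OF Ft(2)])
      fix z assume z: "poly (det Ft) z \<noteq> 0"
      have "poly (\<Sum>m<N. rat_num N Dt Ft m 0 (rowof N (Q n) i m)) z
        = poly (det Ft) z ^ Suc (length Dt) * (Ct n * evalM (P n) z) $$ (i, 0)"
        unfolding dCt[OF z] rat_num_sum[OF Qc Ft(1) i N0 z] by (simp add: rowof_def)
      also have "(Ct n * evalM (P n) z) $$ (i, 0) = poly (\<Sum>m<N. smult (Ct n $$ (i, m)) (P n $$ (m, 0))) z"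
        by (rule constant_combination_entry[OF Ct Pc i N0])
      also have "(\<Sum>m<N. smult (Ct n $$ (i, m)) (P n $$ (m, 0))) = (\<Sum>m<N. if m = 0 then smult (Ct n $$ (i, 0)) (P n $$ (0, 0)) else 0)"
        using Pd N0 by (intro sum.cong) auto
      finally show "poly (\<Sum>m<N. rat_num N Dt Ft m 0 (rowof N (Q n) i m)) z
        = poly (det Ft ^ Suc (length Dt) * smult (Ct n $$ (i, 0)) (P n $$ (0, 0))) z"
        using N0 by simp
    qed
  qed
  then obtain G where G: "\<And>m. m < N \<Longrightarrow> dopE (G m)"
    "\<And>n i. i < N \<Longrightarrow> (\<Sum>m<N. G m (rowof N (Q n) i m)) = smult (Ct n $$ (i, 0)) (P n $$ (0, 0))" by auto

  have M: "\<exists>H. (\<forall>m<N. dopE (H m)) \<and>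
      (\<forall>n. \<forall>i<N. (\<Sum>m<N. H m (rowof N (P n) i m)) = (\<Sum>m<N. smult (C n $$ (i, m)) (Q n $$ (m, k))))"
    if k: "k < N" for k
  proof (rule operator_division[OF monP F(2)])
    show "dopE (apply_num N D F m k)" for m by (rule apply_num_dopE)
    fix n i assume i: "i < N"
    show "(\<Sum>m<N. apply_num N D F m k (rowof N (P n) i m)) = det F * (\<Sum>m<N. smult (C n $$ (i, m)) (Q n $$ (m, k)))"
    proof (rule poly_eq_off_roots[OF F(2)])
      fix z assume z: "poly (det F) z \<noteq> 0"
      have c: "apply_op N (P n) D * adj_mat F \<in> carrier_mat N N"
        using adj_mat(1)[OF F(1)] by (intro mult_carrier_mat) auto
      have "poly (\<Sum>m<N. smult (C n $$ (i, m)) (Q n $$ (m, k))) z = (C n * evalM (Q n) z) $$ (i, k)"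
        by (rule constant_combination_entry[OF C Qc i k, symmetric])
      also have "\<dots> = (1 / poly (det F) z) * poly ((apply_op N (P n) D * adj_mat F) $$ (i, k)) z"
        unfolding dC[OF z] using evalM_carrier[OF c, of z] evalM_entry[OF c i k, of z] i k by simp
      also have "(apply_op N (P n) D * adj_mat F) $$ (i, k) = (\<Sum>m<N. apply_num N D F m k (rowof N (P n) i m))"
        unfolding apply_num_sum[OF Pc opD F(1) i k] by (simp add: rowof_def)
      finally show "poly (\<Sum>m<N. apply_num N D F m k (rowof N (P n) i m)) z
        = poly (det F * (\<Sum>m<N. smult (C n $$ (i, m)) (Q n $$ (m, k)))) z"
        using z by simp
    qed
  qed
  define H where "H k = (SOME H. (\<forall>m<N. dopE (H m)) \<and>
      (\<forall>n. \<forall>i<N. (\<Sum>m<N. H m (rowof N (P n) i m)) = (\<Sum>m<N. smult (C n $$ (i, m)) (Q n $$ (m, k)))))" for k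
  have H: "(\<forall>m<N. dopE (H k m)) \<and>
      (\<forall>n. \<forall>i<N. (\<Sum>m<N. H k m (rowof N (P n) i m)) = (\<Sum>m<N. smult (C n $$ (i, m)) (Q n $$ (m, k))))"
    if "k < N" for k
    unfolding H_def by (rule someI_ex[OF M[OF that]])
  have H0: "dopE (H k 0)" if "k < N" for k using H[OF that] N0 by blast
  have HP: "H k 0 (P n $$ (0, 0)) = (\<Sum>m<N. smult (C n $$ (0, m)) (Q n $$ (m, k)))" if k: "k < N" for n k
  proof -
    \<comment> \<open>Row 0 of the diagonal P_n has one nonzero entry, so a single scalar operator
      does the work.\<close>
    have "(\<Sum>m<N. H k m (rowof N (P n) 0 m)) = (\<Sum>m<N. if m = 0 then H k 0 (P n $$ (0, 0)) else 0)"
      using H[OF k] Pd N0 by (intro sum.cong) (auto simp: rowof_def lin_zero[OF dopE_lin])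
    then show ?thesis using H[OF k] N0 by simp
  qed
  obtain n0 where n0: "\<And>n. n \<ge> n0 \<Longrightarrow> det (C n) \<noteq> 0 \<and> det (Ct n) \<noteq> 0"
  proof -
    have "finite ({n. det (C n) = 0} \<union> {n. det (Ct n) = 0})" using fC fCt by simp
    then obtain b where "\<forall>n\<in>{n. det (C n) = 0} \<union> {n. det (Ct n) = 0}. n < b"
      using finite_nat_set_iff_bounded by blast
    then show ?thesis by (intro that[of b]) (auto simp: not_less[symmetric])
  qed
  show False
  proof (rule darboux_contradiction[of "\<lambda>n. rowof N (Q n)" "\<lambda>i j p. H j 0 (G i p)"
        "\<lambda>n i. Ct n $$ (i, 0)" "\<lambda>n m. C n $$ (0, m)" n0])
    show "monic_family (\<lambda>n. rowof N (Q n))" by (rule monQ)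
    show "B (\<tau> (rowof N (Q n) i)) (\<tau> (rowof N (Q m) k)) = 0" if "n \<noteq> m" "i < N" "k < N" for n m i k
    proof -
      have "ip N S ?W (Q n) (Q m) = 0\<^sub>m N N" using Q that(1) by (simp add: monic_OPS_def)
      then show ?thesis using ip_entry[OF A Qc Qc that(2,3) l int, of n m] that by simp
    qed
    show "dopE (\<lambda>p. H j 0 (G i p))" if "i < N" "j < N" for i j
      by (rule dopE_comp[OF H0[OF that(2)] G(1)[OF that(1)]])
    show "(\<Sum>k<N. H j 0 (G k (rowof N (Q n) i k))) = (\<Sum>k<N. smult (Ct n $$ (i, 0) * C n $$ (0, k)) (rowof N (Q n) k j))"
      if ij: "i < N" "j < N" for n i j
    proof -
      have lin: "lin (H j 0)" by (rule dopE_lin[OF H0[OF ij(2)]])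
      have "H j 0 (\<Sum>m\<in>I. f m) = (\<Sum>m\<in>I. H j 0 (f m))" for I :: "nat set" and f
        by (induction I rule: infinite_finite_induct) (simp_all add: lin_zero[OF lin] lin_add[OF lin])
      then have "(\<Sum>k<N. H j 0 (G k (rowof N (Q n) i k))) = H j 0 (\<Sum>k<N. G k (rowof N (Q n) i k))" by simp
      also have "\<dots> = smult (Ct n $$ (i, 0)) (\<Sum>m<N. smult (C n $$ (0, m)) (Q n $$ (m, j)))"
        unfolding G(2)[OF ij(1)] lin_smult[OF lin] HP[OF ij(2)] ..
      also have "\<dots> = (\<Sum>k<N. smult (Ct n $$ (i, 0) * C n $$ (0, k)) (rowof N (Q n) k j))"
        using ij by (simp add: smult_sum2 rowof_def)
      finally show ?thesis .
    qed
    show "(\<exists>i<N. Ct n $$ (i, 0) \<noteq> 0) \<and> (\<exists>k<N. C n $$ (0, k) \<noteq> 0)" if "n \<ge> n0" for n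
      using n0[OF that] det_nonzero_row[OF C _ N0] det_nonzero_col[OF Ct _ N0] by blast
  qed
qed

subsection \<open>Pearson equations of the classical weights\<close>

text \<open>The integrand is the derivative of p R w. Boundary limits are requested for monomials
  only, since p is a finite combination of them, and extended real endpoints cover bounded and
  unbounded intervals alike.\<close>

lemma (in positive_weights) pearson_FTC:
  fixes a b :: ereal and R \<Psi> :: "real \<Rightarrow> real"
  assumes i: "i < N" and S: "S = einterval a b" and ab: "a < b"
    and r: "\<And>x. poly r (of_real x) = complex_of_real (R x)" and s: "\<And>x. poly s (of_real x) = complex_of_real (\<Psi> x)"
    and deriv: "\<And>x. x \<in> S \<Longrightarrow> ((\<lambda>x. R x * w i x) has_real_derivative \<Psi> x * w i x) (at x)"
    and cont: "\<And>x. x \<in> S \<Longrightarrow> isCont (w i) x"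
    and lim_a: "\<And>k. (((\<lambda>x. x ^ k * (R x * w i x)) \<circ> real_of_ereal) \<longlongrightarrow> 0) (at_right a)"
    and lim_b: "\<And>k. (((\<lambda>x. x ^ k * (R x * w i x)) \<circ> real_of_ereal) \<longlongrightarrow> 0) (at_left b)"
  shows "L i (r * pderiv p + s * p) = 0"
proof -
  define G where "G x = poly p (of_real x) * complex_of_real (R x * w i x)" for x
  define g where "g x = poly (r * pderiv p + s * p) (of_real x) * complex_of_real (w i x)" for x
  have G_sum: "G x = (\<Sum>k\<le>degree p. coeff p k * complex_of_real (x ^ k * (R x * w i x)))" for x
    by (simp add: G_def poly_altdef sum_distrib_right mult.assoc)
  have lim: "((G \<circ> real_of_ereal) \<longlongrightarrow> 0) F"
    if "\<And>k. (((\<lambda>x. x ^ k * (R x * w i x)) \<circ> real_of_ereal) \<longlongrightarrow> 0) F" for F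
  proof -
    have "((\<lambda>y. \<Sum>k\<le>degree p. coeff p k * complex_of_real (((\<lambda>x. x ^ k * (R x * w i x)) \<circ> real_of_ereal) y))
      \<longlongrightarrow> (\<Sum>k\<le>degree p. coeff p k * complex_of_real 0)) F"
      by (intro tendsto_sum tendsto_mult_left tendsto_of_real that)
    then show ?thesis by (simp add: G_sum o_def)
  qed
  have "(LBINT x=a..b. g x) = 0 - 0"
  proof (rule interval_integral_FTC_integrable[OF ab])
    fix x assume "a < ereal x" "ereal x < b"
    then have x: "x \<in> S" by (simp add: S einterval_iff)
    have "((\<lambda>x. poly p (of_real x)) has_vector_derivative poly (pderiv p) (of_real x)) (at x)"
      by (intro has_vector_derivative_real_field poly_DERIV)
    moreover have "((\<lambda>x. complex_of_real (R x * w i x)) has_vector_derivative complex_of_real (\<Psi> x * w i x)) (at x)"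
      using deriv[OF x] by (intro has_vector_derivative_of_real) (simp add: has_real_derivative_iff_has_vector_derivative)
    ultimately have "(G has_vector_derivative
      (poly p (of_real x) * complex_of_real (\<Psi> x * w i x) + poly (pderiv p) (of_real x) * complex_of_real (R x * w i x))) (at x)"
      unfolding G_def by (rule has_vector_derivative_mult)
    then show "(G has_vector_derivative g x) (at x)"
      by (simp add: g_def r s algebra_simps)
    show "isCont g x" unfolding g_def
      by (intro continuous_intros cont[OF x])
  next
    show "set_integrable lborel (einterval a b) g"
      unfolding g_def S[symmetric] by (rule integrable_poly[OF i])
  qed (intro lim lim_a lim_b)+
  then have "(LINT x:S|lborel. g x) = 0"
    using ab by (simp add: S interval_lebesgue_integral_def less_imp_le)
  then show ?thesis using i by (simp only: L_def g_def if_True)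
qed

lemma set_borel_measurable_continuous:
  assumes "open (S :: real set)" "\<And>x. x \<in> S \<Longrightarrow> isCont (f :: real \<Rightarrow> real) x"
  shows "set_borel_measurable lborel S f"
proof -
  have "continuous_on S f" using assms(2) by (intro continuous_at_imp_continuous_on) auto
  then show ?thesis using assms(1) borel_measurable_continuous_on_indicator[of S f]
    by (simp add: set_borel_measurable_def)
qed

subsubsection \<open>Hermite\<close>

lemma power_le_fact_exp:
  assumes "(x :: real) \<ge> 0"
  shows "x ^ k \<le> fact k * exp x"
proof -
  have "(\<Sum>n\<in>{k}. x ^ n /\<^sub>R fact n) \<le> exp x"
    unfolding sums_unique[OF exp_converges[of x]]
    using assms summable_exp_generic[of x] by (intro sum_le_suminf) (auto simp: divide_inverse mult.commute)
  then show ?thesis by (simp add: field_simps)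
qed

text \<open>One factor exp |x| dominates x^k and another dominates 1 + x^2; completing the square in
  2 |x| - x^2 + 2 b x bounds what is left. The same estimate serves the moments and the boundary
  limits.\<close>

lemma hermite_bound:
  "\<bar>x ^ k * hermite_w b x\<bar> \<le> 2 * fact k * exp ((1 + \<bar>b\<bar>)\<^sup>2) * inverse (1 + x\<^sup>2)"
proof -
  have e2: "1 + x\<^sup>2 \<le> 2 * exp \<bar>x\<bar>"
    using exp_lower_Taylor_quadratic[of "\<bar>x\<bar>"] by (simp add: field_simps)
  have q: "2 * \<bar>x\<bar> + (- x\<^sup>2 + 2 * b * x) \<le> (1 + \<bar>b\<bar>)\<^sup>2"
  proof -
    have "b * x \<le> \<bar>b\<bar> * \<bar>x\<bar>" by (metis abs_ge_self abs_mult)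
    moreover have "0 \<le> (\<bar>x\<bar> - (1 + \<bar>b\<bar>))\<^sup>2" by simp
    moreover have "(\<bar>x\<bar> - (1 + \<bar>b\<bar>))\<^sup>2 = x\<^sup>2 - 2 * \<bar>x\<bar> - 2 * (\<bar>b\<bar> * \<bar>x\<bar>) + (1 + \<bar>b\<bar>)\<^sup>2"
      by (simp add: power2_eq_square algebra_simps)
    ultimately show ?thesis by linarith
  qed
  have "\<bar>x ^ k * hermite_w b x\<bar> * (1 + x\<^sup>2) \<le> (fact k * exp \<bar>x\<bar> * hermite_w b x) * (2 * exp \<bar>x\<bar>)"
    using power_le_fact_exp[of "\<bar>x\<bar>" k] e2
    by (intro mult_mono) (auto simp: abs_mult power_abs hermite_w_def)
  also have "\<dots> = 2 * fact k * exp (2 * \<bar>x\<bar> + (- x\<^sup>2 + 2 * b * x))"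
    by (simp add: hermite_w_def exp_add[symmetric] flip: mult.assoc)
  also have "\<dots> \<le> 2 * fact k * exp ((1 + \<bar>b\<bar>)\<^sup>2)" using q by simp
  finally show ?thesis by (simp add: field_simps add_pos_nonneg)
qed

lemma hermite_moments: "set_integrable lborel UNIV (\<lambda>x. x ^ k * hermite_w b x)"
proof (rule set_integrable_bound)
  show "set_integrable lborel UNIV (\<lambda>x. 2 * fact k * exp ((1 + \<bar>b\<bar>)\<^sup>2) * inverse (1 + x\<^sup>2))"
    using integrable_inverse_1_plus_square by (intro set_integrable_mult_right) simp
  show "set_borel_measurable lborel UNIV (\<lambda>x. x ^ k * hermite_w b x)"
    by (rule set_borel_measurable_continuous) (auto simp: hermite_w_def intro!: continuous_intros)
  show "AE x in lborel. x \<in> UNIV \<longrightarrow> norm (x ^ k * hermite_w b x) \<le> norm (2 * fact k * exp ((1 + \<bar>b\<bar>)\<^sup>2) * inverse (1 + x\<^sup>2))"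
    using hermite_bound by (auto simp: abs_mult)
qed

lemma hermite_limit:
  assumes "((\<lambda>x :: real. inverse (1 + x\<^sup>2)) \<longlongrightarrow> 0) F"
  shows "((\<lambda>x. x ^ k * (1 * hermite_w b x)) \<longlongrightarrow> 0) F"
proof (rule Lim_null_comparison)
  show "\<forall>\<^sub>F x in F. norm (x ^ k * (1 * hermite_w b x)) \<le> 2 * fact k * exp ((1 + \<bar>b\<bar>)\<^sup>2) * inverse (1 + x\<^sup>2)"
    using hermite_bound by simp
  show "((\<lambda>x. 2 * fact k * exp ((1 + \<bar>b\<bar>)\<^sup>2) * inverse (1 + x\<^sup>2)) \<longlongrightarrow> 0) F"
    using tendsto_mult_left[OF assms, of "2 * fact k * exp ((1 + \<bar>b\<bar>)\<^sup>2)"] by simp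
qed

lemma hermite_positive: "positive_weights N UNIV (\<lambda>i. hermite_w (b i))"
  by (standard; (rule hermite_moments)?; auto simp: hermite_w_def)

lemma hermite_pearson:
  assumes "i < N"
  shows "positive_weights.L N UNIV (\<lambda>i. hermite_w (b i)) i (1 * pderiv p + [:of_real (2 * b i), -2:] * p) = 0"
proof (rule positive_weights.pearson_FTC[OF hermite_positive assms, of "-\<infinity>" \<infinity> _ "\<lambda>x. 1" _ "\<lambda>x. 2 * b i - 2 * x"])
  have "((\<lambda>x :: real. inverse (1 + x\<^sup>2)) \<longlongrightarrow> 0) at_bot" by real_asymp
  from hermite_limit[OF this] show "(((\<lambda>x. x ^ k * (1 * hermite_w (b i) x)) \<circ> real_of_ereal) \<longlongrightarrow> 0) (at_right (-\<infinity>))" for k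
    unfolding ereal_tendsto_simps .
  have "((\<lambda>x :: real. inverse (1 + x\<^sup>2)) \<longlongrightarrow> 0) at_top" by real_asymp
  from hermite_limit[OF this] show "(((\<lambda>x. x ^ k * (1 * hermite_w (b i) x)) \<circ> real_of_ereal) \<longlongrightarrow> 0) (at_left \<infinity>)" for k
    unfolding ereal_tendsto_simps .
  show "((\<lambda>x. 1 * hermite_w (b i) x) has_real_derivative (2 * b i - 2 * x) * hermite_w (b i) x) (at x)" for x
    unfolding hermite_w_def by (auto intro!: derivative_eq_intros simp: algebra_simps)
  show "isCont (hermite_w (b i)) x" for x
    unfolding hermite_w_def by (intro continuous_intros)
qed auto

subsubsection \<open>Laguerre\<close>

lemma laguerre_moments:
  assumes "\<alpha> > -1"
  shows "set_integrable lborel {0<..} (\<lambda>x. x ^ k * laguerre_w \<alpha> x)"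
proof -
  define c where "c = real k + \<alpha> + 1"
  have c: "c > 0" using assms by (simp add: c_def)
  have "(\<lambda>t. t powr (c - 1) / exp t) absolutely_integrable_on {0..}"
    using Gamma_integral_real[OF c] by (intro nonnegative_absolutely_integrable_1) auto
  then have "(\<lambda>t. t powr (c - 1) / exp t) absolutely_integrable_on {0<..}"
    by (rule set_integrable_subset) auto
  \<comment> \<open>The Gamma integral gives integrability for the completed measure; Borel
    measurability brings it back to \<open>lborel\<close>.\<close>
  moreover have "(\<lambda>x. indicator {0<..} x *\<^sub>R (x powr (c - 1) / exp x)) \<in> borel_measurable lborel"
    by measurable
  ultimately have "set_integrable lborel {0<..} (\<lambda>t. t powr (c - 1) / exp t)"
    unfolding set_integrable_def by (simp add: integrable_completion)
  moreover have "x powr (c - 1) / exp x = x ^ k * laguerre_w \<alpha> x" if "x > 0" for x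
    using that by (simp add: laguerre_w_def c_def powr_add powr_realpow exp_minus field_simps)
  ultimately show ?thesis by (subst set_integrable_cong[OF refl refl]) auto
qed

lemma laguerre_positive:
  assumes "\<And>i. i < N \<Longrightarrow> \<alpha> i > -1"
  shows "positive_weights N {0<..} (\<lambda>i. laguerre_w (\<alpha> i))"
  by (standard; (rule laguerre_moments)?; use assms in \<open>auto simp: laguerre_w_def\<close>)

lemma laguerre_pearson:
  assumes a: "\<And>i. i < N \<Longrightarrow> \<alpha> i > -1" and i: "i < N"
  shows "positive_weights.L N {0<..} (\<lambda>i. laguerre_w (\<alpha> i)) i ([:0, 1:] * pderiv p + [:of_real (\<alpha> i + 1), -1:] * p) = 0"
proof (rule positive_weights.pearson_FTC[OF laguerre_positive[of N \<alpha>, OF a] i, of "ereal 0" \<infinity> _ "\<lambda>x. x" _ "\<lambda>x. \<alpha> i + 1 - x"])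
  have e: "x ^ k * (x * laguerre_w (\<alpha> i) x) = exp (- x) * x powr (real k + 1 + \<alpha> i)" if "x > 0" for x k
    using that by (simp add: laguerre_w_def powr_add powr_realpow)
  have p: "real k + 1 + \<alpha> i > 0" for k using a[OF i] by simp
  show "(((\<lambda>x. x ^ k * (x * laguerre_w (\<alpha> i) x)) \<circ> real_of_ereal) \<longlongrightarrow> 0) (at_right (ereal 0))" for k
  proof -
    have "((\<lambda>x. exp (- x) * x powr (real k + 1 + \<alpha> i)) \<longlongrightarrow> exp (- 0) * 0) (at_right 0)"
      using p[of k] by (intro tendsto_intros tendsto_zero_powrI[of _ _ _ "real k + 1 + \<alpha> i"])
        (auto simp: eventually_at_filter)
    then have "((\<lambda>x. exp (- x) * x powr (real k + 1 + \<alpha> i)) \<longlongrightarrow> 0) (at_right 0)" by simp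
    moreover have "\<forall>\<^sub>F x in at_right 0. exp (- x) * x powr (real k + 1 + \<alpha> i) = x ^ k * (x * laguerre_w (\<alpha> i) x)"
      by (auto simp: e eventually_at_filter)
    ultimately have "((\<lambda>x. x ^ k * (x * laguerre_w (\<alpha> i) x)) \<longlongrightarrow> 0) (at_right 0)"
      by (rule Lim_transform_eventually)
    then show ?thesis unfolding ereal_tendsto_simps .
  qed
  show "(((\<lambda>x. x ^ k * (x * laguerre_w (\<alpha> i) x)) \<circ> real_of_ereal) \<longlongrightarrow> 0) (at_left \<infinity>)" for k
  proof -
    have "((\<lambda>x :: real. exp (- x) * x powr c) \<longlongrightarrow> 0) at_top" for c by real_asymp
    moreover have "\<forall>\<^sub>F x in at_top. exp (- x) * x powr (real k + 1 + \<alpha> i) = x ^ k * (x * laguerre_w (\<alpha> i) x)"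
      using eventually_gt_at_top[of "0 :: real"] by eventually_elim (simp only: e)
    ultimately have "((\<lambda>x. x ^ k * (x * laguerre_w (\<alpha> i) x)) \<longlongrightarrow> 0) at_top"
      by (rule Lim_transform_eventually)
    then show ?thesis unfolding ereal_tendsto_simps .
  qed
  show "((\<lambda>x. x * laguerre_w (\<alpha> i) x) has_real_derivative (\<alpha> i + 1 - x) * laguerre_w (\<alpha> i) x) (at x)"
    if "x \<in> {0<..}" for x
    using that unfolding laguerre_w_def
    by (auto intro!: derivative_eq_intros simp: algebra_simps powr_diff)
  show "isCont (laguerre_w (\<alpha> i)) x" if "x \<in> {0<..}" for x
    using that unfolding laguerre_w_def by (intro continuous_intros) auto
qed auto

subsubsection \<open>Jacobi\<close>

lemma powr_le_two_powr_abs: "1 \<le> y \<Longrightarrow> y \<le> 2 \<Longrightarrow> y powr a \<le> (2 :: real) powr \<bar>a\<bar>"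
proof -
  assume y: "1 \<le> y" "y \<le> 2"
  have "y powr a \<le> y powr \<bar>a\<bar>" using y by (intro powr_mono) auto
  also have "\<dots> \<le> 2 powr \<bar>a\<bar>" using y by (intro powr_mono2) auto
  finally show ?thesis .
qed

text \<open>On each side of 0 only one factor can be singular; the base of the other lies between 1
  and 2.\<close>

lemma jacobi_bound:
  assumes "x \<in> {-1<..<1}"
  shows "\<bar>x ^ k * jacobi_w \<alpha> \<beta> x\<bar> \<le> 2 powr \<bar>\<beta>\<bar> * (1 - x) powr \<alpha> + 2 powr \<bar>\<alpha>\<bar> * (1 + x) powr \<beta>"
proof -
  have "\<bar>x\<bar> ^ k \<le> 1" using assms by (intro power_le_one) auto
  then have 1: "\<bar>x ^ k * jacobi_w \<alpha> \<beta> x\<bar> \<le> (1 - x) powr \<alpha> * (1 + x) powr \<beta>"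
    by (simp add: jacobi_w_def abs_mult power_abs mult_left_le_one_le)
  show ?thesis
  proof (cases "x \<ge> 0")
    case True
    have "(1 - x) powr \<alpha> * (1 + x) powr \<beta> \<le> 2 powr \<bar>\<beta>\<bar> * (1 - x) powr \<alpha>"
      using True assms unfolding mult.commute[of "2 powr \<bar>\<beta>\<bar>"]
      by (intro mult_left_mono powr_le_two_powr_abs) auto
    moreover have "0 \<le> 2 powr \<bar>\<alpha>\<bar> * (1 + x) powr \<beta>" by simp
    ultimately show ?thesis using 1 by linarith
  next
    case False
    have "(1 - x) powr \<alpha> * (1 + x) powr \<beta> \<le> 2 powr \<bar>\<alpha>\<bar> * (1 + x) powr \<beta>"
      using False assms by (intro mult_right_mono powr_le_two_powr_abs) auto
    moreover have "0 \<le> 2 powr \<bar>\<beta>\<bar> * (1 - x) powr \<alpha>" by simp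
    ultimately show ?thesis using 1 by linarith
  qed
qed

lemma powr_endpoint_limit:
  assumes "(f \<longlongrightarrow> 0) F" "eventually (\<lambda>x. 0 \<le> f x) F" "(c :: real) > 0"
  shows "((\<lambda>x. f x powr c) \<longlongrightarrow> 0) F"
  using assms by (intro tendsto_zero_powrI[of _ _ _ c]) auto

lemma integrable_one_minus_powr:
  assumes "\<alpha> > -1"
  shows "set_integrable lborel {-1<..<1} (\<lambda>x :: real. (1 - x) powr \<alpha>)"
proof -
  have "set_integrable lborel (einterval (ereal (-1)) (ereal 1)) (\<lambda>x :: real. (1 - x) powr \<alpha>)"
  proof (rule interval_integral_FTC_nonneg)
    show "((\<lambda>x. - ((1 - x) powr (\<alpha> + 1)) / (\<alpha> + 1)) has_real_derivative (1 - x) powr \<alpha>) (at x)"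
      if "ereal (-1) < ereal x" "ereal x < ereal 1" for x
      using that assms by (auto intro!: derivative_eq_intros simp: powr_diff)
    have "((\<lambda>x. - ((1 - x) powr (\<alpha> + 1)) / (\<alpha> + 1)) \<longlongrightarrow> - ((1 - (-1)) powr (\<alpha> + 1)) / (\<alpha> + 1)) (at_right (-1))"
      using assms by (intro tendsto_intros) auto
    then show "(((\<lambda>x. - ((1 - x) powr (\<alpha> + 1)) / (\<alpha> + 1)) \<circ> real_of_ereal) \<longlongrightarrow> - ((1 - (-1)) powr (\<alpha> + 1)) / (\<alpha> + 1)) (at_right (ereal (-1)))"
      unfolding ereal_tendsto_simps .
    have "((\<lambda>x :: real. 1 - x) \<longlongrightarrow> 1 - 1) (at_left 1)" by (intro tendsto_intros)
    then have "((\<lambda>x :: real. (1 - x) powr (\<alpha> + 1)) \<longlongrightarrow> 0) (at_left 1)"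
      using assms by (intro powr_endpoint_limit) (auto simp: eventually_at_filter)
    then have "((\<lambda>x. - ((1 - x) powr (\<alpha> + 1)) / (\<alpha> + 1)) \<longlongrightarrow> - 0 / (\<alpha> + 1)) (at_left 1)"
      using assms by (intro tendsto_intros) auto
    then show "(((\<lambda>x. - ((1 - x) powr (\<alpha> + 1)) / (\<alpha> + 1)) \<circ> real_of_ereal) \<longlongrightarrow> - 0 / (\<alpha> + 1)) (at_left (ereal 1))"
      unfolding ereal_tendsto_simps .
    show "isCont (\<lambda>x. (1 - x) powr \<alpha>) x" if "ereal (-1) < ereal x" "ereal x < ereal 1" for x
      using that by (intro continuous_intros) auto
  qed auto
  then show ?thesis by simp
qed

lemma integrable_one_plus_powr:
  assumes "\<alpha> > -1"
  shows "set_integrable lborel {-1<..<1} (\<lambda>x :: real. (1 + x) powr \<alpha>)"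
proof -
  have "set_integrable lborel (einterval (ereal (-1)) (ereal 1)) (\<lambda>x :: real. (1 + x) powr \<alpha>)"
  proof (rule interval_integral_FTC_nonneg)
    show "((\<lambda>x. (1 + x) powr (\<alpha> + 1) / (\<alpha> + 1)) has_real_derivative (1 + x) powr \<alpha>) (at x)"
      if "ereal (-1) < ereal x" "ereal x < ereal 1" for x
      using that assms by (auto intro!: derivative_eq_intros simp: powr_diff)
    have "((\<lambda>x. (1 + x) powr (\<alpha> + 1) / (\<alpha> + 1)) \<longlongrightarrow> (1 + 1) powr (\<alpha> + 1) / (\<alpha> + 1)) (at_left 1)"
      using assms by (intro tendsto_intros) auto
    then show "(((\<lambda>x. (1 + x) powr (\<alpha> + 1) / (\<alpha> + 1)) \<circ> real_of_ereal) \<longlongrightarrow> (1 + 1) powr (\<alpha> + 1) / (\<alpha> + 1)) (at_left (ereal 1))"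
      unfolding ereal_tendsto_simps .
    have "((\<lambda>x :: real. 1 + x) \<longlongrightarrow> 1 + (-1)) (at_right (-1))" by (intro tendsto_intros)
    then have "((\<lambda>x :: real. (1 + x) powr (\<alpha> + 1)) \<longlongrightarrow> 0) (at_right (-1))"
      using assms by (intro powr_endpoint_limit) (auto simp: eventually_at_filter)
    then have "((\<lambda>x. (1 + x) powr (\<alpha> + 1) / (\<alpha> + 1)) \<longlongrightarrow> 0 / (\<alpha> + 1)) (at_right (-1))"
      using assms by (intro tendsto_intros) auto
    then show "(((\<lambda>x. (1 + x) powr (\<alpha> + 1) / (\<alpha> + 1)) \<circ> real_of_ereal) \<longlongrightarrow> 0 / (\<alpha> + 1)) (at_right (ereal (-1)))"
      unfolding ereal_tendsto_simps .
    show "isCont (\<lambda>x. (1 + x) powr \<alpha>) x" if "ereal (-1) < ereal x" "ereal x < ereal 1" for x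
      using that by (intro continuous_intros) auto
  qed auto
  then show ?thesis by simp
qed

lemma jacobi_moments:
  assumes "\<alpha> > -1" "\<beta> > -1"
  shows "set_integrable lborel {-1<..<1} (\<lambda>x. x ^ k * jacobi_w \<alpha> \<beta> x)"
proof (rule set_integrable_bound)
  show "set_integrable lborel {-1<..<1} (\<lambda>x. 2 powr \<bar>\<beta>\<bar> * (1 - x) powr \<alpha> + 2 powr \<bar>\<alpha>\<bar> * (1 + x) powr \<beta>)"
    using assms by (intro set_integral_add set_integrable_mult_right integrable_one_minus_powr integrable_one_plus_powr)
  show "set_borel_measurable lborel {-1<..<1} (\<lambda>x. x ^ k * jacobi_w \<alpha> \<beta> x)"
    by (rule set_borel_measurable_continuous) (auto simp: jacobi_w_def intro!: continuous_intros)
  show "AE x in lborel. x \<in> {-1<..<1} \<longrightarrow> norm (x ^ k * jacobi_w \<alpha> \<beta> x)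
      \<le> norm (2 powr \<bar>\<beta>\<bar> * (1 - x) powr \<alpha> + 2 powr \<bar>\<alpha>\<bar> * (1 + x) powr \<beta>)"
    using jacobi_bound[of _ k \<alpha> \<beta>] by (intro AE_I2 impI) (auto intro: order.trans)
qed

lemma jacobi_positive:
  assumes "\<And>i. i < N \<Longrightarrow> \<alpha> i > -1 \<and> \<beta> i > -1"
  shows "positive_weights N {-1<..<1} (\<lambda>i. jacobi_w (\<alpha> i) (\<beta> i))"
  by (standard; (rule jacobi_moments)?; use assms in \<open>auto simp: jacobi_w_def\<close>)

lemma jacobi_pearson:
  assumes a: "\<And>i. i < N \<Longrightarrow> \<alpha> i > -1 \<and> \<beta> i > -1" and i: "i < N"
  shows "positive_weights.L N {-1<..<1} (\<lambda>i. jacobi_w (\<alpha> i) (\<beta> i)) i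
    ([:1, 0, -1:] * pderiv p + [:of_real (\<beta> i - \<alpha> i), - of_real (\<alpha> i + \<beta> i + 2):] * p) = 0"
proof (rule positive_weights.pearson_FTC[OF jacobi_positive[of N \<alpha> \<beta>, OF a] i, of "ereal (-1)" "ereal 1" _ "\<lambda>x. (1 - x) * (1 + x)"
      _ "\<lambda>x. \<beta> i - \<alpha> i - (\<alpha> i + \<beta> i + 2) * x"])
  have e: "x ^ k * ((1 - x) * (1 + x) * jacobi_w (\<alpha> i) (\<beta> i) x) = x ^ k * ((1 - x) powr (\<alpha> i + 1) * (1 + x) powr (\<beta> i + 1))"
    if "-1 < x" "x < 1" for x k
    using that by (simp add: jacobi_w_def powr_add)
  have p: "\<alpha> i + 1 > 0" "\<beta> i + 1 > 0" using a[OF i] by auto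
  show "(((\<lambda>x. x ^ k * ((1 - x) * (1 + x) * jacobi_w (\<alpha> i) (\<beta> i) x)) \<circ> real_of_ereal) \<longlongrightarrow> 0) (at_right (ereal (-1)))" for k
  proof -
    have "((\<lambda>x :: real. 1 + x) \<longlongrightarrow> 1 + (-1)) (at_right (-1))" by (intro tendsto_intros)
    then have "((\<lambda>x :: real. (1 + x) powr (\<beta> i + 1)) \<longlongrightarrow> 0) (at_right (-1))"
      using p by (intro powr_endpoint_limit) (auto simp: eventually_at_filter)
    then have "((\<lambda>x. x ^ k * ((1 - x) powr (\<alpha> i + 1) * (1 + x) powr (\<beta> i + 1))) \<longlongrightarrow>
       (-1) ^ k * ((1 - (-1)) powr (\<alpha> i + 1) * 0)) (at_right (-1))"
      by (intro tendsto_intros) auto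
    then have "((\<lambda>x. x ^ k * ((1 - x) powr (\<alpha> i + 1) * (1 + x) powr (\<beta> i + 1))) \<longlongrightarrow> 0) (at_right (-1))" by simp
    moreover have "\<forall>\<^sub>F x in at_right (-1). x ^ k * ((1 - x) powr (\<alpha> i + 1) * (1 + x) powr (\<beta> i + 1)) = x ^ k * ((1 - x) * (1 + x) * jacobi_w (\<alpha> i) (\<beta> i) x)"
      using eventually_at_right_real[of "-1" "1 :: real", OF less_minus_one_simps(2)] by eventually_elim (simp_all add: e)
    ultimately have "((\<lambda>x. x ^ k * ((1 - x) * (1 + x) * jacobi_w (\<alpha> i) (\<beta> i) x)) \<longlongrightarrow> 0) (at_right (-1))"
      by (rule Lim_transform_eventually)
    then show ?thesis unfolding ereal_tendsto_simps .
  qed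
  show "(((\<lambda>x. x ^ k * ((1 - x) * (1 + x) * jacobi_w (\<alpha> i) (\<beta> i) x)) \<circ> real_of_ereal) \<longlongrightarrow> 0) (at_left (ereal 1))" for k
  proof -
    have "((\<lambda>x :: real. 1 - x) \<longlongrightarrow> 1 - 1) (at_left 1)" by (intro tendsto_intros)
    then have "((\<lambda>x :: real. (1 - x) powr (\<alpha> i + 1)) \<longlongrightarrow> 0) (at_left 1)"
      using p by (intro powr_endpoint_limit) (auto simp: eventually_at_filter)
    then have "((\<lambda>x. x ^ k * ((1 - x) powr (\<alpha> i + 1) * (1 + x) powr (\<beta> i + 1))) \<longlongrightarrow>
       1 ^ k * (0 * (1 + 1) powr (\<beta> i + 1))) (at_left 1)"
      by (intro tendsto_intros) auto
    then have "((\<lambda>x. x ^ k * ((1 - x) powr (\<alpha> i + 1) * (1 + x) powr (\<beta> i + 1))) \<longlongrightarrow> 0) (at_left 1)" by simp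
    moreover have "\<forall>\<^sub>F x in at_left 1. x ^ k * ((1 - x) powr (\<alpha> i + 1) * (1 + x) powr (\<beta> i + 1)) = x ^ k * ((1 - x) * (1 + x) * jacobi_w (\<alpha> i) (\<beta> i) x)"
      using eventually_at_left_real[of "-1" "1 :: real", OF less_minus_one_simps(2)] by eventually_elim (simp_all add: e)
    ultimately have "((\<lambda>x. x ^ k * ((1 - x) * (1 + x) * jacobi_w (\<alpha> i) (\<beta> i) x)) \<longlongrightarrow> 0) (at_left 1)"
      by (rule Lim_transform_eventually)
    then show ?thesis unfolding ereal_tendsto_simps .
  qed
  show "((\<lambda>x. (1 - x) * (1 + x) * jacobi_w (\<alpha> i) (\<beta> i) x) has_real_derivative
      (\<beta> i - \<alpha> i - (\<alpha> i + \<beta> i + 2) * x) * jacobi_w (\<alpha> i) (\<beta> i) x) (at x)" if "x \<in> {-1<..<1}" for x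
  proof -
    have "((\<lambda>x. (1 - x) powr (\<alpha> i + 1) * (1 + x) powr (\<beta> i + 1)) has_real_derivative
      (1 - x) powr (\<alpha> i + 1) * ((\<beta> i + 1) * (1 + x) powr \<beta> i) - (\<alpha> i + 1) * (1 - x) powr \<alpha> i * (1 + x) powr (\<beta> i + 1)) (at x)"
      using that p by (auto intro!: derivative_eq_intros simp: powr_diff field_simps)
    also have "(1 - x) powr (\<alpha> i + 1) * ((\<beta> i + 1) * (1 + x) powr \<beta> i) - (\<alpha> i + 1) * (1 - x) powr \<alpha> i * (1 + x) powr (\<beta> i + 1)
      = (\<beta> i - \<alpha> i - (\<alpha> i + \<beta> i + 2) * x) * jacobi_w (\<alpha> i) (\<beta> i) x"
      using that by (simp add: jacobi_w_def powr_add algebra_simps)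
    finally show ?thesis
      by (rule has_field_derivative_transform_within_open[of _ _ _ "{-1<..<1}"])
        (use that in \<open>auto simp: jacobi_w_def powr_add\<close>)
  qed
  show "isCont (jacobi_w (\<alpha> i) (\<beta> i)) x" if "x \<in> {-1<..<1}" for x
    using that unfolding jacobi_w_def by (intro continuous_intros) auto
qed (auto simp: algebra_simps)

subsection \<open>Logarithmic derivatives of rational functions\<close>

lemma linear_power_pderiv:
  fixes y :: "complex poly"
  assumes "pderiv y = 1"
  shows "y * pderiv (y ^ a * q) = y ^ a * (smult (of_nat a) q + y * pderiv q)"
proof (cases a)
  case (Suc k)
  show ?thesis unfolding Suc pderiv_mult pderiv_power_Suc assms by (simp add: algebra_simps del: of_nat_Suc)
qed simp

text \<open>At a simple root z of rho, the function psi / rho has residue psi(z) / rho'(z), whereas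
  the logarithmic derivative of s / r has the integer residue \<open>order z s - order z r\<close>.
  The proof removes the powers of x - z and evaluates at z.\<close>

lemma log_derivative_residue:
  fixes \<rho> \<psi> r s :: "complex poly"
  assumes eq: "\<rho> * (r * pderiv s - pderiv r * s) = \<psi> * r * s" and rs: "r \<noteq> 0" "s \<noteq> 0"
    and z: "poly \<rho> z = 0"
  shows "\<exists>k :: int. poly \<psi> z = poly (pderiv \<rho>) z * of_int k"
proof -
  define y where "y = [:-z, 1:]"
  define a b where "a = order z r" and "b = order z s"
  obtain r1 where r: "r = y ^ a * r1" and r1: "\<not> y dvd r1"
    using order_decomp[OF rs(1)] unfolding y_def a_def by blast
  obtain s1 where s: "s = y ^ b * s1" and s1: "\<not> y dvd s1"
    using order_decomp[OF rs(2)] unfolding y_def b_def by blast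
  obtain \<rho>1 where \<rho>1: "\<rho> = y * \<rho>1" using z unfolding poly_eq_0_iff_dvd y_def by (elim dvdE)
  have dy: "pderiv y = 1" and yz: "poly y z = 0" and y0: "y \<noteq> 0" by (simp_all add: y_def pderiv_pCons)
  define e where "e = smult (of_nat b) (r1 * s1) - smult (of_nat a) (r1 * s1) + y * (r1 * pderiv s1 - pderiv r1 * s1)"
  have hr: "y * pderiv r = y ^ a * (smult (of_nat a) r1 + y * pderiv r1)"
    and hs: "y * pderiv s = y ^ b * (smult (of_nat b) s1 + y * pderiv s1)"
    unfolding r s by (rule linear_power_pderiv[OF dy])+
  have "y ^ (a + b) * (\<rho>1 * e) = \<rho>1 * (r * (y * pderiv s) - (y * pderiv r) * s)"
    unfolding hr hs e_def unfolding r s by (simp add: algebra_simps power_add)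
  also have "\<dots> = \<rho> * (r * pderiv s - pderiv r * s)" unfolding \<rho>1 by (simp add: algebra_simps)
  also have "\<dots> = \<psi> * r * s" by (rule eq)
  also have "\<dots> = y ^ (a + b) * (\<psi> * (r1 * s1))" unfolding r s by (simp add: power_add mult_ac)
  finally have "\<rho>1 * e = \<psi> * (r1 * s1)" using y0 by simp
  then have "poly (\<rho>1 * e) z = poly (\<psi> * (r1 * s1)) z" by simp
  then have "poly \<rho>1 z * (of_nat b - of_nat a) * (poly r1 z * poly s1 z) = poly \<psi> z * (poly r1 z * poly s1 z)"
    by (simp add: e_def yz algebra_simps)
  moreover have "poly r1 z * poly s1 z \<noteq> 0" using r1 s1 by (simp add: poly_eq_0_iff_dvd y_def)
  ultimately have "poly \<psi> z = poly \<rho>1 z * (of_nat b - of_nat a)" by simp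
  moreover have "poly (pderiv \<rho>) z = poly \<rho>1 z" unfolding \<rho>1 pderiv_mult by (simp add: dy yz)
  ultimately show ?thesis by (intro exI[of _ "int b - int a"]) simp
qed

text \<open>A derivative loses a degree, so the left side has no term in degree r + degree s, while
  c r s has one. In other words, exp(c x) is not rational.\<close>

lemma log_derivative_not_constant:
  fixes r s :: "complex poly"
  assumes eq: "r * pderiv s - pderiv r * s = [:c:] * r * s" and c: "c \<noteq> 0"
  shows "r = 0 \<or> s = 0"
proof (rule ccontr)
  assume "\<not> ?thesis"
  then have rs: "r \<noteq> 0" "s \<noteq> 0" by auto
  have low: "coeff (p * pderiv q) (degree p + degree q) = 0" for p q :: "complex poly"
  proof (cases "degree q = 0")
    case True
    then have "pderiv q = 0" by (simp add: pderiv_eq_0_iff)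
    then show ?thesis by simp
  next
    case False
    then have "degree (p * pderiv q) < degree p + degree q"
      using degree_mult_le[of p "pderiv q"] by (simp add: degree_pderiv)
    then show ?thesis by (rule coeff_eq_0)
  qed
  have "coeff (r * pderiv s - pderiv r * s) (degree r + degree s) = 0"
    using low[of r s] low[of s r] by (simp add: mult.commute add.commute)
  moreover have "coeff ([:c:] * r * s) (degree r + degree s) = c * (lead_coeff r * lead_coeff s)"
    by (simp add: coeff_mult_degree_sum)
  ultimately show False using eq c rs by simp
qed

subsection \<open>The matrix weights\<close>

lemma (in bochner_weights) bochner_solution:
  assumes A: "A = Acoef N a"
    and l: "\<And>j p. j < N \<Longrightarrow> l j p = (LINT x:S|lborel. poly p (of_real x) * complex_of_real (w j x))"
    and int: "\<And>j p. j < N \<Longrightarrow> set_integrable lborel S (\<lambda>x. poly p (of_real x) * complex_of_real (w j x))"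
  shows "\<exists>D. in_DW N S (\<lambda>x. Tmat N a x * diagW N w x * cadj (Tmat N a x)) D \<and> length D = 3 \<and> D ! 2 \<noteq> 0\<^sub>m N N"
proof -
  let ?W = "\<lambda>x. Tmat N a x * diagW N w x * cadj (Tmat N a x)"
  obtain Q \<Lambda> h where Q: "monic_family Q"
    and orth: "\<forall>n m. n \<noteq> m \<longrightarrow> (\<forall>i<N. \<forall>k<N. B (\<tau> (Q n i)) (\<tau> (Q m k)) = 0)"
    and eig: "\<forall>n. \<forall>i<N. \<forall>j<N. (\<Sum>d<3. \<Sum>m<N. (pderiv ^^ d) (Q n i m) * h d m j) = (\<Sum>k<N. smult (\<Lambda> n i k) (Q n k j))"
    and nz: "h 2 0 0 \<noteq> (0 :: complex poly)"
    using bochner_operator by (elim exE conjE) (rule that; assumption)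
  define P where "P n = mat N N (\<lambda>(i, j). Q n i j)" for n
  define D where "D = map (\<lambda>d. mat N N (\<lambda>(m, j). h d m j)) [0..<3]"
  have Pc: "P n \<in> carrier_mat N N" for n by (simp add: P_def)
  have QV: "Q n i \<in> V (Suc n)" if "i < N" for n i using Q that by (simp add: monic_family_def)
  have row: "rowof N (P n) i = Q n i" if i: "i < N" for n i
    using QV[OF i, of n] i by (auto simp: rowof_def P_def V_def rows_def fun_eq_iff)
  have mon: "monic_deg N (P n) n" for n
    unfolding monic_deg_def
  proof (intro conjI allI impI Pc)
    fix i j assume ij: "i < N" "j < N"
    show "degree (P n $$ (i, j)) \<le> n" using V_degree[OF QV[OF ij(1)], of n j] ij by (simp add: P_def)
    show "coeff (P n $$ (i, j)) n = (if i = j then 1 else 0)"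
      using Q ij by (simp add: P_def monic_family_def)
  qed
  have ops: "monic_OPS N S ?W P"
    unfolding monic_OPS_def
  proof (intro conjI allI impI mon)
    fix n m :: nat assume nm: "n \<noteq> m"
    show "ip N S ?W (P n) (P m) = 0\<^sub>m N N"
    proof (rule eq_matI)
      fix i k assume "i < dim_row (0\<^sub>m N N :: complex mat)" "k < dim_col (0\<^sub>m N N :: complex mat)"
      then have ik: "i < N" "k < N" by auto
      then show "ip N S ?W (P n) (P m) $$ (i, k) = 0\<^sub>m N N $$ (i, k)"
        using ip_entry[OF A Pc Pc ik l int, of n m] orth nm by (simp add: row)
    qed (simp_all add: ip_def)
  qed
  have len: "length D = 3" by (simp add: D_def)
  have Dn: "D ! d = mat N N (\<lambda>(m, j). h d m j)" if "d < 3" for d using that by (simp add: D_def)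
  have opD: "op_coeffs N D" by (simp add: op_coeffs_def len Dn)
  have "in_DW N S ?W D"
    unfolding in_DW_def
  proof (intro conjI opD exI[of _ P] ops allI)
    fix n
    define M where "M = mat N N (\<lambda>(i, k). \<Lambda> n i k)"
    have Mc: "M \<in> carrier_mat N N" by (simp add: M_def)
    have "apply_op N (P n) D = constP M * P n"
    proof (rule eq_matI)
      fix i j assume "i < dim_row (constP M * P n)" "j < dim_col (constP M * P n)"
      then have ij: "i < N" "j < N" by (auto simp: constP_def M_def P_def)
      have "apply_op N (P n) D $$ (i, j) = (\<Sum>d<3. \<Sum>m<N. (pderiv ^^ d) (Q n i m) * h d m j)"
        unfolding apply_op_entry[OF Pc opD ij] len using ij by (intro sum.cong refl) (simp add: Dn P_def)
      also have "\<dots> = (\<Sum>k<N. smult (\<Lambda> n i k) (Q n k j))" using eig ij by blast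
      also have "\<dots> = (\<Sum>k<N. constP M $$ (i, k) * P n $$ (k, j))"
        using ij by (intro sum.cong refl) (simp add: constP_def M_def P_def)
      also have "\<dots> = (constP M * P n) $$ (i, j)"
        using ij Mc Pc by (intro mat_mult_entry[symmetric]) (auto simp: constP_def)
      finally show "apply_op N (P n) D $$ (i, j) = (constP M * P n) $$ (i, j)" .
    qed (auto simp: constP_def M_def P_def apply_op_def msum_def)
    then show "\<exists>\<Lambda>\<in>carrier_mat N N. apply_op N (P n) D = constP \<Lambda> * P n" using Mc by blast
  qed
  moreover have "D ! 2 \<noteq> 0\<^sub>m N N"
  proof
    assume "D ! 2 = 0\<^sub>m N N"
    then have "D ! 2 $$ (0, 0) = 0" using N2 by simp
    then show False using nz N2 by (simp add: Dn)
  qed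
  ultimately show ?thesis using len by blast
qed

lemma classical_sum_diagonal: "classical_sum N S0 W0 \<Longrightarrow> \<exists>f. W0 = diagW N f"
  unfolding classical_sum_def by blast

lemma pearson_family_theorem:
  fixes N :: nat and a :: "nat \<Rightarrow> real" and w :: "nat \<Rightarrow> real \<Rightarrow> real"
  assumes N: "2 \<le> N" and a: "\<forall>j\<in>{1..N-1}. a j \<noteq> 0" and pw: "positive_weights N S w"
    and pearson: "\<And>i p. i < N \<Longrightarrow> positive_weights.L N S w i (\<rho> * pderiv p + \<psi> i * p) = 0"
    and rho: "\<rho> \<noteq> 0" "degree \<rho> \<le> 2" "cj \<rho> = \<rho>"
    and psi: "\<And>i. i < N \<Longrightarrow> degree (\<psi> i) \<le> 1 \<and> cj (\<psi> i) = \<psi> i"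
    and c: "\<And>i. i < N \<Longrightarrow> cnj (c i) = c i"
    and match: "\<And>i j n. i < N \<Longrightarrow> j < N \<Longrightarrow> even i \<Longrightarrow> odd j \<Longrightarrow>
      of_nat (Suc n) * of_nat n * coeff \<rho> 2 + of_nat (Suc n) * coeff (\<psi> j) 1 + c j
      = of_nat n * (of_nat n - 1) * coeff \<rho> 2 + of_nat n * coeff (\<psi> i) 1 + c i"
    and incompat: "\<And>i j r s. i < N \<Longrightarrow> j < N \<Longrightarrow> i \<noteq> j \<Longrightarrow>
      \<rho> * (r * pderiv s - pderiv r * s) = (\<psi> j - \<psi> i) * r * s \<Longrightarrow> r = 0 \<or> s = 0"
    and W: "W = (\<lambda>x. Tmat N a x * diagW N w x * cadj (Tmat N a x))"
  shows "(\<exists>D. in_DW N S W D \<and> length D = 3 \<and> D ! 2 \<noteq> 0\<^sub>m N N)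
    \<and> \<not> (\<exists>S0 W0. classical_sum N S0 W0 \<and> darboux N S0 W0 S W)"
proof -
  interpret pw: positive_weights N S w by (rule pw)
  interpret ws: weight_system N pw.L "Acoef N a" \<rho> \<psi>
  proof
    show "even i \<and> odd j \<and> i < N \<and> j < N" if "Acoef N a i j \<noteq> 0" for i j
      using that by (auto simp: Acoef_def split: if_splits)
    show "Acoef N a i (Suc i) \<noteq> 0" if "Suc i < N" "even i" for i using that a by (auto simp: Acoef_def)
    show "Acoef N a (Suc i) i \<noteq> 0" if "Suc i < N" "odd i" for i using that a by (auto simp: Acoef_def)
  qed (use N pearson rho in auto)
  interpret bw: bochner_weights N pw.L "Acoef N a" \<rho> \<psi> c
    by standard (use rho psi c match in auto)
  interpret iw: incompatible_weights N pw.L "Acoef N a" \<rho> \<psi>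
    by standard (rule incompat)
  have l: "pw.L j p = (LINT x:S|lborel. poly p (of_real x) * complex_of_real (w j x))" if "j < N" for j p
    using that by (simp add: pw.L_def)
  have "\<exists>D. in_DW N S W D \<and> length D = 3 \<and> D ! 2 \<noteq> 0\<^sub>m N N"
    unfolding W by (rule bw.bochner_solution[OF refl l pw.integrable_poly])
  moreover have False if dar: "classical_sum N S0 W0" "darboux N S0 W0 S W" for S0 W0
  proof -
    obtain f where f: "W0 = diagW N f" using classical_sum_diagonal[OF dar(1)] by blast
    show False by (rule iw.not_darboux_diagonal[OF refl l pw.integrable_poly dar(2)[unfolded f W]])
  qed
  ultimately show ?thesis by blast
qed

lemma cj_pCons [simp]: "cj (pCons a p) = pCons (cnj a) (cj p)"
  by (rule poly_ext) simp

lemma cj_one [simp]: "cj 1 = 1"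
  by (rule poly_ext) simp

text \<open>The eigenvalues are c_i - 2 n, so matching n with n + 1 asks for a difference of 2
  between odd and even constants. The quotient of two weights is an exponential, nonconstant as the
  b_i differ.\<close>

lemma hermite_theorem:
  assumes N: "2 \<le> N" and a: "\<forall>j\<in>{1..N-1}. a j \<noteq> 0" and b: "inj_on b {1..N}"
  shows "(\<exists>D. in_DW N UNIV (W_H N a b) D \<and> length D = 3 \<and> D ! 2 \<noteq> 0\<^sub>m N N)
    \<and> \<not> (\<exists>S0 W0. classical_sum N S0 W0 \<and> darboux N S0 W0 UNIV (W_H N a b))"
proof (rule pearson_family_theorem[OF N a hermite_positive[of N "\<lambda>i. b (i + 1)"] hermite_pearson,
      where c = "\<lambda>i. if odd i then 2 else 0"])
  show "W_H N a b = (\<lambda>x. Tmat N a x * diagW N (\<lambda>i. hermite_w (b (i + 1))) x * cadj (Tmat N a x))"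
    by (rule ext) (simp add: W_H_def)
  fix i j and r s :: "complex poly"
  assume ij: "i < N" "j < N" "i \<noteq> j"
  have "b (i + 1) \<noteq> b (j + 1)" using inj_onD[OF b, of "i + 1" "j + 1"] ij by auto
  then have c: "complex_of_real (2 * b (j + 1)) - of_real (2 * b (i + 1)) \<noteq> 0" by (simp flip: of_real_diff)
  assume "1 * (r * pderiv s - pderiv r * s) =
    ([:of_real (2 * b (j + 1)), -2:] - [:of_real (2 * b (i + 1)), -2:]) * r * s"
  then show "r = 0 \<or> s = 0" by (intro log_derivative_not_constant[OF _ c]) simp
qed (auto simp: algebra_simps)

text \<open>The eigenvalues are c_i - n, hence the difference 1. The residue at 0 of the logarithmic
  derivative of w_j / w_i is the difference of the exponents.\<close>

lemma laguerre_theorem: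
  assumes N: "2 \<le> N" and a: "\<forall>j\<in>{1..N-1}. a j \<noteq> 0" and \<alpha>: "\<forall>i\<in>{1..N}. \<alpha> i > -1"
    and nonint: "\<forall>i\<in>{1..N}. \<forall>j\<in>{1..N}. i \<noteq> j \<longrightarrow> \<alpha> i - \<alpha> j \<notin> \<int>"
  shows "(\<exists>D. in_DW N {0<..} (W_L N a \<alpha>) D \<and> length D = 3 \<and> D ! 2 \<noteq> 0\<^sub>m N N)
    \<and> \<not> (\<exists>S0 W0. classical_sum N S0 W0 \<and> darboux N S0 W0 {0<..} (W_L N a \<alpha>))"
proof -
  have \<alpha>': "\<And>i. i < N \<Longrightarrow> \<alpha> (i + 1) > -1" using \<alpha> by simp
  show ?thesis
  proof (rule pearson_family_theorem[OF N a laguerre_positive[of N "\<lambda>i. \<alpha> (i + 1)", OF \<alpha>']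
        laguerre_pearson[of N "\<lambda>i. \<alpha> (i + 1)", OF \<alpha>'], where c = "\<lambda>i. if odd i then 1 else 0"])
    show "W_L N a \<alpha> = (\<lambda>x. Tmat N a x * diagW N (\<lambda>i. laguerre_w (\<alpha> (i + 1))) x * cadj (Tmat N a x))"
      by (rule ext) (simp add: W_L_def)
    fix i j and r s :: "complex poly"
    assume ij: "i < N" "j < N" "i \<noteq> j"
    assume eq: "[:0, 1:] * (r * pderiv s - pderiv r * s) =
      ([:of_real (\<alpha> (j + 1) + 1), -1:] - [:of_real (\<alpha> (i + 1) + 1), -1:]) * r * s"
    show "r = 0 \<or> s = 0"
    proof (rule ccontr)
      assume "\<not> (r = 0 \<or> s = 0)"
      then obtain k :: int where "poly ([:of_real (\<alpha> (j + 1) + 1), -1:] - [:of_real (\<alpha> (i + 1) + 1), -1:]) 0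
          = poly (pderiv [:0, 1:]) 0 * complex_of_int k"
        using log_derivative_residue[OF eq, of 0] by auto
      then have "complex_of_real (\<alpha> (j + 1) - \<alpha> (i + 1)) = complex_of_real (of_int k)" by (simp add: pderiv_pCons)
      then have "\<alpha> (j + 1) - \<alpha> (i + 1) = of_int k" by (simp only: of_real_eq_iff)
      then show False using nonint[rule_format, of "j + 1" "i + 1"] ij by simp
    qed
  qed (auto simp: numeral_2_eq_2 algebra_simps)
qed

text \<open>In 0-based terms alpha + beta equals sigma = alpha_1 + beta_1 at even indices and sigma
  - 2 at odd ones. The eigenvalues are c - n (n + 1 + sigma) and c - n (n - 1 + sigma), which match
  at n and n + 1 when the odd constant is sigma. The residues at 1 and -1 are the differences of the
  alphas and of the betas, and one of them is not an integer.\<close>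

lemma jacobi_theorem:
  assumes N: "2 \<le> N" and a: "\<forall>j\<in>{1..N-1}. a j \<noteq> 0" and \<alpha>\<beta>: "\<forall>i\<in>{1..N}. \<alpha> i > -1 \<and> \<beta> i > -1"
    and nonint: "\<forall>i\<in>{1..N}. \<forall>j\<in>{1..N}. i \<noteq> j \<longrightarrow> \<alpha> i - \<alpha> j \<notin> \<int> \<or> \<beta> i - \<beta> j \<notin> \<int>"
    and sum: "\<forall>j\<in>{1..N}. \<alpha> 1 + \<beta> 1 = \<alpha> j + \<beta> j + 1 + (-1) ^ j"
  shows "(\<exists>D. in_DW N {-1<..<1} (W_J N a \<alpha> \<beta>) D \<and> length D = 3 \<and> D ! 2 \<noteq> 0\<^sub>m N N)
    \<and> \<not> (\<exists>S0 W0. classical_sum N S0 W0 \<and> darboux N S0 W0 {-1<..<1} (W_J N a \<alpha> \<beta>))"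
proof -
  have \<alpha>\<beta>': "\<And>i. i < N \<Longrightarrow> \<alpha> (i + 1) > -1 \<and> \<beta> (i + 1) > -1" using \<alpha>\<beta> by simp
  have s_even: "complex_of_real (\<alpha> (i + 1) + \<beta> (i + 1)) = of_real (\<alpha> 1 + \<beta> 1)" if "i < N" "even i" for i
    using sum[rule_format, of "i + 1"] that by simp
  have s_odd: "complex_of_real (\<alpha> (i + 1) + \<beta> (i + 1)) = of_real (\<alpha> 1 + \<beta> 1) - 2" if "i < N" "odd i" for i
  proof -
    have "\<alpha> 1 + \<beta> 1 = \<alpha> (i + 1) + \<beta> (i + 1) + 2"
      using sum[rule_format, of "i + 1"] that by simp
    then show ?thesis by simp
  qed
  show ?thesis
  proof (rule pearson_family_theorem[OF N a jacobi_positive[of N "\<lambda>i. \<alpha> (i + 1)" "\<lambda>i. \<beta> (i + 1)", OF \<alpha>\<beta>']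
        jacobi_pearson[of N "\<lambda>i. \<alpha> (i + 1)" "\<lambda>i. \<beta> (i + 1)", OF \<alpha>\<beta>'],
        where c = "\<lambda>i. if odd i then of_real (\<alpha> 1 + \<beta> 1) else 0"])
    show "W_J N a \<alpha> \<beta> = (\<lambda>x. Tmat N a x * diagW N (\<lambda>i. jacobi_w (\<alpha> (i + 1)) (\<beta> (i + 1))) x * cadj (Tmat N a x))"
      by (rule ext) (simp add: W_J_def)
    show "of_nat (Suc n) * of_nat n * coeff [:1, 0, -1:] 2
        + of_nat (Suc n) * coeff [:of_real (\<beta> (j + 1) - \<alpha> (j + 1)), - of_real (\<alpha> (j + 1) + \<beta> (j + 1) + 2):] 1
        + (if odd j then of_real (\<alpha> 1 + \<beta> 1) else 0)
      = of_nat n * (of_nat n - 1) * coeff [:1, 0, -1:] 2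
        + of_nat n * coeff [:of_real (\<beta> (i + 1) - \<alpha> (i + 1)), - complex_of_real (\<alpha> (i + 1) + \<beta> (i + 1) + 2):] 1
        + (if odd i then of_real (\<alpha> 1 + \<beta> 1) else 0)"
      if "i < N" "j < N" "even i" "odd j" for i j n
    proof -
      have "coeff [:1, 0, -1 :: complex:] 2 = -1" by (simp add: numeral_2_eq_2)
      moreover have "complex_of_real (\<alpha> (i + 1) + \<beta> (i + 1) + 2) = of_real (\<alpha> 1 + \<beta> 1) + 2"
        using s_even[of i] that by (simp only: of_real_add of_real_numeral)
      moreover have "complex_of_real (\<alpha> (j + 1) + \<beta> (j + 1) + 2) = of_real (\<alpha> 1 + \<beta> 1)"
        using s_odd[of j] that by (simp only: of_real_add of_real_numeral) simp
      ultimately show ?thesis using that by (simp add: algebra_simps del: of_real_add)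
    qed
    fix i j and r s :: "complex poly"
    assume ij: "i < N" "j < N" "i \<noteq> j"
    let ?\<psi> = "\<lambda>i. [:of_real (\<beta> (i + 1) - \<alpha> (i + 1)), - complex_of_real (\<alpha> (i + 1) + \<beta> (i + 1) + 2):]"
    assume eq: "[:1, 0, -1:] * (r * pderiv s - pderiv r * s) = (?\<psi> j - ?\<psi> i) * r * s"
    show "r = 0 \<or> s = 0"
    proof (rule ccontr)
      assume rs: "\<not> (r = 0 \<or> s = 0)"
      obtain k :: int where "poly (?\<psi> j - ?\<psi> i) 1 = poly (pderiv [:1, 0, -1:]) 1 * complex_of_int k"
        using log_derivative_residue[OF eq, of 1] rs by auto
      then have "2 * complex_of_real (\<alpha> (j + 1) - \<alpha> (i + 1)) = 2 * complex_of_real (of_int k)"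
        by (simp add: pderiv_pCons algebra_simps)
      then have "complex_of_real (\<alpha> (j + 1) - \<alpha> (i + 1)) = complex_of_real (of_int k)"
        by (simp only: mult_cancel_left) simp
      then have 1: "\<alpha> (j + 1) - \<alpha> (i + 1) = of_int k" by (simp only: of_real_eq_iff)
      obtain m :: int where "poly (?\<psi> j - ?\<psi> i) (-1) = poly (pderiv [:1, 0, -1:]) (-1) * complex_of_int m"
        using log_derivative_residue[OF eq, of "-1"] rs by auto
      then have "2 * complex_of_real (\<beta> (j + 1) - \<beta> (i + 1)) = 2 * complex_of_real (of_int m)"
        by (simp add: pderiv_pCons algebra_simps)
      then have "complex_of_real (\<beta> (j + 1) - \<beta> (i + 1)) = complex_of_real (of_int m)"
        by (simp only: mult_cancel_left) simp
      then have "\<beta> (j + 1) - \<beta> (i + 1) = of_int m" by (simp only: of_real_eq_iff)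
      then show False using nonint[rule_format, of "j + 1" "i + 1"] ij 1 by simp
    qed
  qed (auto simp: numeral_2_eq_2 algebra_simps)
qed

theorem theorem1p4:
  fixes N :: nat and a b \<alpha> \<beta> :: "nat \<Rightarrow> real"
    and S :: "real set" and W :: "real \<Rightarrow> complex mat"
  assumes "N \<ge> 2"
    and "\<forall>j\<in>{1..N-1}. a j \<noteq> 0"
    and "(S = UNIV \<and> W = W_H N a b \<and> inj_on b {1..N})
       \<or> (S = {0<..} \<and> W = W_L N a \<alpha> \<and> (\<forall>i\<in>{1..N}. \<alpha> i > -1) \<and>
          (\<forall>i\<in>{1..N}. \<forall>j\<in>{1..N}. i \<noteq> j \<longrightarrow> \<alpha> i - \<alpha> j \<notin> \<int>))
       \<or> (S = {-1<..<1} \<and> W = W_J N a \<alpha> \<beta> \<and> (\<forall>i\<in>{1..N}. \<alpha> i > -1 \<and> \<beta> i > -1) \<and>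
          (\<forall>i\<in>{1..N}. \<forall>j\<in>{1..N}. i \<noteq> j \<longrightarrow> \<alpha> i - \<alpha> j \<notin> \<int> \<or> \<beta> i - \<beta> j \<notin> \<int>) \<and>
          (\<forall>j\<in>{1..N}. \<alpha> 1 + \<beta> 1 = \<alpha> j + \<beta> j + 1 + (-1) ^ j))"
  shows "(\<exists>D. in_DW N S W D \<and> length D = 3 \<and> D ! 2 \<noteq> 0\<^sub>m N N)
       \<and> \<not> (\<exists>S0 W0. classical_sum N S0 W0 \<and> darboux N S0 W0 S W)"
  using assms(3)
proof (elim disjE conjE)
  assume "S = UNIV" "W = W_H N a b" "inj_on b {1..N}"
  then show ?thesis using hermite_theorem[OF assms(1,2)] by simp
next
  assume "S = {0<..}" "W = W_L N a \<alpha>" "\<forall>i\<in>{1..N}. \<alpha> i > -1"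
    "\<forall>i\<in>{1..N}. \<forall>j\<in>{1..N}. i \<noteq> j \<longrightarrow> \<alpha> i - \<alpha> j \<notin> \<int>"
  then show ?thesis using laguerre_theorem[OF assms(1,2), of \<alpha>] by simp
next
  assume SW: "S = {-1<..<1}" "W = W_J N a \<alpha> \<beta>"
    and "\<forall>i\<in>{1..N}. \<alpha> i > -1 \<and> \<beta> i > -1"
    "\<forall>i\<in>{1..N}. \<forall>j\<in>{1..N}. i \<noteq> j \<longrightarrow> \<alpha> i - \<alpha> j \<notin> \<int> \<or> \<beta> i - \<beta> j \<notin> \<int>"
    "\<forall>j\<in>{1..N}. \<alpha> 1 + \<beta> 1 = \<alpha> j + \<beta> j + 1 + (-1) ^ j"
  then show ?thesis unfolding SW by (intro jacobi_theorem[OF assms(1,2)])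
qed

end
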